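(* The following problems are decidable for one-dimensional stochastic cellular automata: (1) given $F$, is it noisy? (2) given $F$, is it surjective? (3) given $F$, is it injective? (4) given $F$, is it pre-injective? (5) given $F$ and $G$, do we have $\mathcal{N}_F^t=\mathcal{N}_G^t$? (where $t$ is any fixed positive integer) (6) given $F$, are there $u\in L$ and a configuration $c$ such that $\mathcal{N}_F(c)\subseteq[u]_0$? (where $L$ is any fixed rational language) (7) given $F$, are there $u\in L$ and a configuration $c$ such that $\mathcal{N}_F(c)\cap[u]_0\neq\varnothing$? (where $L$ is any fixed rational language)
   Context: A (one-dimensional) stochastic cellular automaton is a tuple $(Q,R,V,V',f)$ where $Q$ (states) and $R$ (random symbols) are finite sets, $V=\{v_1,\dots,v_\rho\}$ and $V'=\{v'_1,\dots,v'_{\rho'}\}$ are finite subsets of $\mathbb{Z}$, and $f:Q^\rho\times R^{\rho'}\to Q$. It is identified with its explicit global function $F:Q^{\mathbb{Z}}\times R^{\mathbb{Z}}\to Q^{\mathbb{Z}}$, $F(c,s)_z=f\big((c_{z+v_j})_j,(s_{z+v'_j})_j\big)$, and given as input by its finite description. Its non-deterministic global function is $\mathcal{N}_F(c)=\{F(c,s):s\in R^{\mathbb{Z}}\}$, with iterates $\mathcal{N}_F^0(c)=\{c\}$ and $\mathcal{N}_F^{t+1}(c)=\bigcup_{c'\in\mathcal{N}_F^t(c)}\mathcal{N}_F(c')$. $F$ is noisy if $\mathcal{N}_F(c)=Q^{\mathbb{Z}}$ for all $c\in Q^{\mathbb{Z}}$. $F$ is surjective if for any $c\in Q^{\mathbb{Z}}$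 there are $c'\in Q^{\mathbb{Z}}$, $s\in R^{\mathbb{Z}}$ with $F(c',s)=c$. $F$ is injective if for all $c_1,c_2\in Q^{\mathbb{Z}}$ and $s_1,s_2\in R^{\mathbb{Z}}$, $F(c_1,s_1)=F(c_2,s_2)\Rightarrow c_1=c_2$. $F$ is pre-injective if the same implication holds for all $s_1,s_2$ and all $c_1,c_2$ differing in only finitely many cells. A rational language is a regular language of finite words (here over the set of states). For a finite word $u=u_0\cdots u_{|u|-1}$, $[u]_0=\{c\in Q^{\mathbb{Z}}:c_x=u_x\text{ for all }0\le x<|u|\}$. *)

theory Defs
  imports Main "HOL-Library.Nat_Bijection"
begin

section \<open>Decidability\<close>

text \<open>
  Kleene's general recursive functions, as total functions on argument tuples: unbounded
  minimisation is only applied to regular functions, i.e. when a root always exists. By Kleene's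
  normal form theorem these are exactly the total computable functions. A function of arity
  \<open>n\<close> is only meaningful on lists of length \<open>n\<close>, whence the rule \<open>ext\<close>.
\<close>

inductive general_recursive :: "nat \<Rightarrow> (nat list \<Rightarrow> nat) \<Rightarrow> bool" where
  zero: "general_recursive n (\<lambda>xs. 0)"
| succ: "general_recursive 1 (\<lambda>xs. Suc (xs ! 0))"
| proj: "i < n \<Longrightarrow> general_recursive n (\<lambda>xs. xs ! i)"
| comp: "general_recursive (length gs) f \<Longrightarrow> (\<forall>g\<in>set gs. general_recursive n g) \<Longrightarrow>
    general_recursive n (\<lambda>xs. f (map (\<lambda>g. g xs) gs))"
| prim_rec: "general_recursive n f \<Longrightarrow> general_recursive (n + 2) g \<Longrightarrow>
    general_recursive (n + 1)
      (\<lambda>xs. rec_nat (f (tl xs)) (\<lambda>k r. g (k # r # tl xs)) (hd xs))"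
| minimise: "general_recursive (n + 1) f \<Longrightarrow>
    (\<forall>xs. length xs = n \<longrightarrow> (\<exists>k. f (k # xs) = 0)) \<Longrightarrow>
    general_recursive n (\<lambda>xs. LEAST k. f (k # xs) = 0)"
| ext: "general_recursive n f \<Longrightarrow> (\<forall>xs. length xs = n \<longrightarrow> f xs = g xs) \<Longrightarrow>
    general_recursive n g"

text \<open>
  Decidability of the problem \<open>P\<close> on the set \<open>I\<close> of instances, which are presented to the
  algorithm through the coding \<open>code\<close>.
\<close>

definition decidable :: "('i \<Rightarrow> nat) \<Rightarrow> 'i set \<Rightarrow> ('i \<Rightarrow> bool) \<Rightarrow> bool" where
  "decidable code I P \<longleftrightarrow>
     (\<exists>d. general_recursive 1 d \<and> (\<forall>x\<in>I. d [code x] = (if P x then 1 else 0)))"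


section \<open>Stochastic cellular automata\<close>

text \<open>
  The neighbourhoods are lists because the order \<open>v\<^sub>1, \<dots>, v\<^sub>\<rho>\<close> of their elements fixes the
  order of the arguments of the local rule. Only the values of \<open>local_rule\<close> on words over
  \<open>states\<close> and \<open>symbols\<close> of the appropriate lengths are relevant.
\<close>

record ('q, 'r) sca =
  states :: "'q set"
  symbols :: "'r set"
  nbhd :: "int list"
  rnbhd :: "int list"
  local_rule :: "'q list \<Rightarrow> 'r list \<Rightarrow> 'q"

definition words :: "nat \<Rightarrow> 'a set \<Rightarrow> 'a list set" where
  "words n A = {w. length w = n \<and> set w \<subseteq> A}"

definition wf_sca :: "('q, 'r) sca \<Rightarrow> bool" where
  "wf_sca F \<longleftrightarrow> finite (states F) \<and> finite (symbols F) \<and> distinct (nbhd F) \<and> distinct (rnbhd F) \<and>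
     (\<forall>a \<in> words (length (nbhd F)) (states F). \<forall>b \<in> words (length (rnbhd F)) (symbols F).
        local_rule F a b \<in> states F)"

definition configs :: "'a set \<Rightarrow> (int \<Rightarrow> 'a) set" where
  "configs A = {c. \<forall>z. c z \<in> A}"

definition global :: "('q, 'r) sca \<Rightarrow> (int \<Rightarrow> 'q) \<Rightarrow> (int \<Rightarrow> 'r) \<Rightarrow> int \<Rightarrow> 'q" where
  "global F c s z =
     local_rule F (map (\<lambda>v. c (z + v)) (nbhd F)) (map (\<lambda>v. s (z + v)) (rnbhd F))"

definition nondet :: "('q, 'r) sca \<Rightarrow> (int \<Rightarrow> 'q) \<Rightarrow> (int \<Rightarrow> 'q) set" where
  "nondet F c = {global F c s | s. s \<in> configs (symbols F)}"

fun nondet_iter :: "('q, 'r) sca \<Rightarrow> nat \<Rightarrow> (int \<Rightarrow> 'q) \<Rightarrow> (int \<Rightarrow> 'q) set" where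
  "nondet_iter F 0 c = {c}"
| "nondet_iter F (Suc t) c = (\<Union>c' \<in> nondet_iter F t c. nondet F c')"

text \<open>Equality of \<open>\<N>\<^sub>F\<^sup>t\<close> and \<open>\<N>\<^sub>G\<^sup>t\<close> as maps, whose domains are \<open>Q\<^sup>\<int>\<close> for the respective
  state sets.\<close>

definition same_iterate :: "nat \<Rightarrow> ('q, 'r) sca \<Rightarrow> ('q, 's) sca \<Rightarrow> bool" where
  "same_iterate t F G \<longleftrightarrow> states F = states G \<and>
     (\<forall>c \<in> configs (states F). nondet_iter F t c = nondet_iter G t c)"

definition noisy :: "('q, 'r) sca \<Rightarrow> bool" where
  "noisy F \<longleftrightarrow> (\<forall>c \<in> configs (states F). nondet F c = configs (states F))"

definition sca_surjective :: "('q, 'r) sca \<Rightarrow> bool" where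
  "sca_surjective F \<longleftrightarrow> (\<forall>c \<in> configs (states F).
     \<exists>c' \<in> configs (states F). \<exists>s \<in> configs (symbols F). global F c' s = c)"

definition sca_injective :: "('q, 'r) sca \<Rightarrow> bool" where
  "sca_injective F \<longleftrightarrow> (\<forall>c1 \<in> configs (states F). \<forall>c2 \<in> configs (states F).
     \<forall>s1 \<in> configs (symbols F). \<forall>s2 \<in> configs (symbols F).
       global F c1 s1 = global F c2 s2 \<longrightarrow> c1 = c2)"

definition sca_pre_injective :: "('q, 'r) sca \<Rightarrow> bool" where
  "sca_pre_injective F \<longleftrightarrow> (\<forall>c1 \<in> configs (states F). \<forall>c2 \<in> configs (states F).
     \<forall>s1 \<in> configs (symbols F). \<forall>s2 \<in> configs (symbols F).
       finite {z. c1 z \<noteq> c2 z} \<longrightarrow> global F c1 s1 = global F c2 s2 \<longrightarrow> c1 = c2)"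

definition cylinder :: "'a set \<Rightarrow> 'a list \<Rightarrow> (int \<Rightarrow> 'a) set" where
  "cylinder A u = {c \<in> configs A. \<forall>x < length u. c (int x) = u ! x}"

text \<open>Languages accepted by a deterministic finite automaton over a finite alphabet \<open>A\<close>; the
  automaton states are taken to be natural numbers.\<close>

definition rational :: "'a list set \<Rightarrow> bool" where
  "rational L \<longleftrightarrow> (\<exists>A (S :: nat set) q0 \<delta> Acc.
     finite A \<and> finite S \<and> q0 \<in> S \<and> Acc \<subseteq> S \<and> (\<forall>q\<in>S. \<forall>a\<in>A. \<delta> q a \<in> S) \<and>
     L = {w \<in> lists A. foldl \<delta> q0 w \<in> Acc})"


section \<open>Finite descriptions\<close>

text \<open>
  To be an input of an algorithm, an automaton has states and random symbols that are natural
  numbers. Its description consists of the elements of both alphabets in increasing order, the two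
  neighbourhoods, and the table of the local rule, as a list of triples (state word, symbol word,
  value).
\<close>

definition rule_table :: "(nat, nat) sca \<Rightarrow> ((nat list \<times> nat list) \<times> nat) list" where
  "rule_table F = map (\<lambda>(a, b). ((a, b), local_rule F a b))
     (List.product (List.n_lists (length (nbhd F)) (sorted_list_of_set (states F)))
                   (List.n_lists (length (rnbhd F)) (sorted_list_of_set (symbols F))))"

definition code_sca :: "(nat, nat) sca \<Rightarrow> nat" where
  "code_sca F = list_encode
     [list_encode (sorted_list_of_set (states F)),
      list_encode (sorted_list_of_set (symbols F)),
      list_encode (map int_encode (nbhd F)),
      list_encode (map int_encode (rnbhd F)),
      list_encode (map (\<lambda>((a, b), q). prod_encode (prod_encode (list_encode a, list_encode b), q))
        (rule_table F))]"

definition code_sca_pair :: "(nat, nat) sca \<times> (nat, nat) sca \<Rightarrow> nat" where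
  "code_sca_pair = (\<lambda>(F, G). prod_encode (code_sca F, code_sca G))"

definition SCA :: "(nat, nat) sca set" where
  "SCA = {F. wf_sca F}"

text \<open>The code determines the automaton, up to irrelevant values of the local rule.\<close>

lemma code_sca_eqD:
  assumes "wf_sca F" "wf_sca G" "code_sca F = code_sca G"
  shows "states F = states G \<and> symbols F = symbols G \<and> nbhd F = nbhd G \<and> rnbhd F = rnbhd G \<and>
    (\<forall>a \<in> words (length (nbhd F)) (states F). \<forall>b \<in> words (length (rnbhd F)) (symbols F).
       local_rule F a b = local_rule G a b)"
proof -
  let ?h = "\<lambda>((a, b), q). prod_encode (prod_encode (list_encode a, list_encode b), q)"
  have fin: "finite (states F)" "finite (symbols F)" "finite (states G)" "finite (symbols G)"
    using assms(1,2) by (auto simp: wf_sca_def)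
  have eqs: "sorted_list_of_set (states F) = sorted_list_of_set (states G)"
    "sorted_list_of_set (symbols F) = sorted_list_of_set (symbols G)"
    "map int_encode (nbhd F) = map int_encode (nbhd G)"
    "map int_encode (rnbhd F) = map int_encode (rnbhd G)"
    "map ?h (rule_table F) = map ?h (rule_table G)"
    using assms(3) by (simp_all add: code_sca_def list_encode_eq del: list_encode.simps)
  have st: "states F = states G" "symbols F = symbols G"
    using eqs(1,2) fin by (metis set_sorted_list_of_set)+
  have nb: "nbhd F = nbhd G" "rnbhd F = rnbhd G"
    using eqs(3,4) by (auto dest!: map_injective simp: inj_int_encode)
  have "inj ?h"
    by (rule injI) (auto simp: prod_encode_eq list_encode_eq)
  then have tab: "rule_table F = rule_table G"
    using eqs(5) by (rule map_injective[rotated])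
  have "local_rule F a b = local_rule G a b"
    if a: "a \<in> words (length (nbhd F)) (states F)"
      and b: "b \<in> words (length (rnbhd F)) (symbols F)" for a b
  proof -
    have "((a, b), local_rule F a b) \<in> set (rule_table F)"
      using a b fin by (auto simp: rule_table_def set_n_lists words_def)
    then have "((a, b), local_rule F a b) \<in> set (rule_table G)"
      by (simp only: tab)
    then show ?thesis
      by (auto simp: rule_table_def)
  qed
  then show ?thesis
    using st nb by blast
qed

end

theory Submission
  imports Defs "HOL-Library.FuncSet" "HOL-Library.Infinite_Set"
    "HOL-Library.Diagonal_Subsequence"
begin

text \<open>
  A configuration that violates or satisfies a local condition is a path in a de Bruijn graph, and
  each of the problems asks for a path, or for a finite word that a non-deterministic automaton
  rejects. By the subset construction and the pigeonhole principle a shortest such path or word has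
  a length bounded in terms of the code of the automaton, and one-sided infinite ends of a path can
  be pumped from finite ones; compactness of \<open>Q\<^sup>\<int>\<close> passes from finite words to configurations. For
  \<open>\<N>\<^sub>F\<^sup>t\<close> the path carries all intermediate configurations, for a rational language the run of an
  automaton. What remains are bounded searches over words, i.e. over natural numbers in positional
  notation, and these are recursive because predicates with recursive characteristic function are
  closed under bounded quantification.
\<close>

section \<open>Recursive functions and predicates\<close>

text \<open>The code of an automaton bounds its letters, its offsets and the length of its rule
  table. Since only upper bounds matter, the code itself (times \<open>t\<close> for iterates)
  serves as radius, and the alphabet base exceeds it by a positive constant. The exponential bound
  comes from a quantifier alternation: every visible word must admit a hidden one. Shortening a
  counterexample therefore has to preserve the absence of all hidden words, so it must remember the
  whole set of hidden windows that are still possible. The main obstacle is that a finite word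
  obeying a local condition need not be part of a configuration obeying it everywhere. For noise and
  surjectivity the visible word is free of conditions. For iterates the condition is checked on a
  space-time cone, so that a true orbit reproduces the result of a finite trace. For collisions the
  word gets two margins, each long enough to repeat a window.\<close>

definition rec_pred :: "nat \<Rightarrow> (nat list \<Rightarrow> bool) \<Rightarrow> bool" where
  "rec_pred n P \<longleftrightarrow> general_recursive n (\<lambda>xs. of_bool (P xs))"

lemma general_recursive_cong:
  "general_recursive n f \<Longrightarrow> (\<And>xs. length xs = n \<Longrightarrow> f xs = g xs) \<Longrightarrow> general_recursive n g"
  by (rule general_recursive.ext) auto

lemma rec_pred_cong:
  "rec_pred n P \<Longrightarrow> (\<And>xs. length xs = n \<Longrightarrow> P xs = Q xs) \<Longrightarrow> rec_pred n Q"
  unfolding rec_pred_def by (erule general_recursive_cong) auto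

lemma general_recursive_compose:
  assumes "general_recursive (length gs) f" "\<And>g. g \<in> set gs \<Longrightarrow> general_recursive n g"
    and "\<And>xs. length xs = n \<Longrightarrow> f (map (\<lambda>g. g xs) gs) = h xs"
  shows "general_recursive n h"
  by (rule general_recursive_cong[OF general_recursive.comp[of gs f n]]) (use assms in auto)

text \<open>Arguments are addressed from the head of the list, so that the variable bound by a
  quantifier is \<open>hd\<close> and the surrounding context is \<open>tl\<close>.\<close>

lemma rec_hd: "general_recursive (Suc n) hd"
  by (rule general_recursive_cong[OF general_recursive.proj[of 0]]) (auto intro!: hd_conv_nth[symmetric])

lemma rec_tl:
  assumes "general_recursive n f"
  shows "general_recursive (Suc n) (\<lambda>xs. f (tl xs))"
proof (rule general_recursive_compose[of "map (\<lambda>i xs. xs ! Suc i) [0..<n]" f])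
  fix xs :: "nat list"
  assume "length xs = Suc n"
  then have "map (\<lambda>g. g xs) (map (\<lambda>i xs. xs ! Suc i) [0..<n]) = tl xs"
    by (auto intro!: nth_equalityI simp: nth_tl)
  then show "f (map (\<lambda>g. g xs) (map (\<lambda>i xs. xs ! Suc i) [0..<n])) = f (tl xs)"
    by (rule arg_cong)
qed (use assms in \<open>auto intro: general_recursive.proj\<close>)

lemma rec_Suc: "general_recursive n f \<Longrightarrow> general_recursive n (\<lambda>xs. Suc (f xs))"
  by (rule general_recursive_compose[of "[f]" "\<lambda>xs. Suc (xs ! 0)"]) (use succ in auto)

lemma rec_const: "general_recursive n (\<lambda>xs. c)"
  by (induction c) (auto intro: general_recursive.zero rec_Suc)

text \<open>Kleene's scheme recurses on the head of the tuple with its tail as parameters.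
  Composition with \<open>b\<close> followed by all projections makes the recursion run up to any
  recursive bound and keeps the full context as parameters.\<close>

lemma rec_rec_nat:
  assumes b: "general_recursive n b" and f: "general_recursive n f"
    and g: "general_recursive (Suc (Suc n)) (\<lambda>ys. g (hd ys) (hd (tl ys)) (tl (tl ys)))"
  shows "general_recursive n (\<lambda>xs. rec_nat (f xs) (\<lambda>k r. g k r xs) (b xs))"
proof (rule general_recursive_compose[of "b # map (\<lambda>i xs. xs ! i) [0..<n]"
      "\<lambda>xs. rec_nat (f (tl xs)) (\<lambda>k r. g k r (tl xs)) (hd xs)"])
  show "general_recursive (length (b # map (\<lambda>i xs. xs ! i) [0..<n]))
      (\<lambda>xs. rec_nat (f (tl xs)) (\<lambda>k r. g k r (tl xs)) (hd xs))"
    using general_recursive.prim_rec[OF f, of "\<lambda>ys. g (hd ys) (hd (tl ys)) (tl (tl ys))"] g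
    by simp
next
  fix xs :: "nat list"
  assume "length xs = n"
  then have "map (\<lambda>g. g xs) (map (\<lambda>i xs. xs ! i) [0..<n]) = xs"
    by (auto intro!: nth_equalityI)
  then show "rec_nat (f (tl (map (\<lambda>g. g xs) (b # map (\<lambda>i xs. xs ! i) [0..<n]))))
      (\<lambda>k r. g k r (tl (map (\<lambda>g. g xs) (b # map (\<lambda>i xs. xs ! i) [0..<n]))))
      (hd (map (\<lambda>g. g xs) (b # map (\<lambda>i xs. xs ! i) [0..<n]))) =
      rec_nat (f xs) (\<lambda>k r. g k r xs) (b xs)"
    by (simp del: map_map)
qed (use b in \<open>auto intro: general_recursive.proj\<close>)

lemmas rec_vars = rec_hd rec_tl[OF rec_hd] rec_tl[OF rec_tl[OF rec_hd]]

lemma rec_add: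
  assumes "general_recursive n f" "general_recursive n g"
  shows "general_recursive n (\<lambda>xs. f xs + g xs)"
proof -
  have *: "rec_nat a (\<lambda>k r. Suc r) b = a + b" for a b by (induction b) auto
  have "general_recursive (Suc (Suc n)) (\<lambda>ys. Suc (hd (tl ys)))"
    by (intro rec_Suc rec_vars)
  from rec_rec_nat[OF assms(2,1), of "\<lambda>k r xs. Suc r", OF this] show ?thesis
    by (simp only: *)
qed

lemma rec_mult:
  assumes "general_recursive n f" "general_recursive n g"
  shows "general_recursive n (\<lambda>xs. f xs * g xs)"
proof -
  have *: "rec_nat 0 (\<lambda>k r. r + a) b = a * b" for a b :: nat by (induction b) auto
  have "general_recursive (Suc (Suc n)) (\<lambda>ys. hd (tl ys) + f (tl (tl ys)))"
    by (intro rec_add rec_vars rec_tl assms)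
  from rec_rec_nat[OF assms(2) rec_const, of "\<lambda>k r xs. r + f xs", OF this, of 0]
  show ?thesis by (simp only: *)
qed

lemma rec_power:
  assumes "general_recursive n f" "general_recursive n g"
  shows "general_recursive n (\<lambda>xs. f xs ^ g xs)"
proof -
  have *: "rec_nat 1 (\<lambda>k r. r * a) b = a ^ b" for a b :: nat by (induction b) auto
  have "general_recursive (Suc (Suc n)) (\<lambda>ys. hd (tl ys) * f (tl (tl ys)))"
    by (intro rec_mult rec_vars rec_tl assms)
  from rec_rec_nat[OF assms(2) rec_const, of "\<lambda>k r xs. r * f xs", OF this, of 1]
  show ?thesis by (simp only: *)
qed

lemma rec_diff:
  assumes "general_recursive n f" "general_recursive n g"
  shows "general_recursive n (\<lambda>xs. f xs - g xs)"
proof -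
  have pred: "rec_nat 0 (\<lambda>k r. k) b = b - 1" for b by (cases b) auto
  have *: "rec_nat a (\<lambda>k r. r - 1) b = a - b" for a b :: nat by (induction b) auto
  have "general_recursive (Suc (Suc n)) (\<lambda>ys. hd (tl ys) - 1)"
    using rec_rec_nat[OF rec_vars(2) rec_const, of n "\<lambda>k r xs. k" 0]
    by (simp only: pred) (simp add: rec_vars)
  then show ?thesis
    using rec_rec_nat[OF assms(2,1), of "\<lambda>k r xs. r - 1"] by (simp only: *)
qed

lemma rec_pred_pos:
  assumes "general_recursive n f"
  shows "rec_pred n (\<lambda>xs. 0 < f xs)"
proof -
  have *: "rec_nat 0 (\<lambda>k r. 1) b = of_bool (0 < b)" for b :: nat by (cases b) auto
  show ?thesis
    using rec_rec_nat[OF assms rec_const, of "\<lambda>k r xs. 1" 0]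
    by (simp only: * rec_pred_def) (simp add: rec_const)
qed

lemma rec_pred_less:
  assumes "general_recursive n f" "general_recursive n g"
  shows "rec_pred n (\<lambda>xs. f xs < g xs)"
  using rec_pred_pos[OF rec_diff[OF assms(2,1)]] by simp

lemma rec_pred_not:
  assumes "rec_pred n P"
  shows "rec_pred n (\<lambda>xs. \<not> P xs)"
proof -
  have "general_recursive n (\<lambda>xs. 1 - of_bool (P xs))"
    using assms by (intro rec_diff rec_const) (simp add: rec_pred_def)
  then show ?thesis
    unfolding rec_pred_def by (rule general_recursive_cong) auto
qed

lemma rec_pred_conj:
  assumes "rec_pred n P" "rec_pred n Q"
  shows "rec_pred n (\<lambda>xs. P xs \<and> Q xs)"
  using rec_mult[OF assms[unfolded rec_pred_def]] by (simp add: rec_pred_def of_bool_conj)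

lemma rec_pred_disj:
  assumes "rec_pred n P" "rec_pred n Q"
  shows "rec_pred n (\<lambda>xs. P xs \<or> Q xs)"
  using rec_pred_not[OF rec_pred_conj[OF assms[THEN rec_pred_not]]] by simp

lemma rec_pred_imp:
  assumes "rec_pred n P" "rec_pred n Q"
  shows "rec_pred n (\<lambda>xs. P xs \<longrightarrow> Q xs)"
  using rec_pred_disj[OF rec_pred_not[OF assms(1)] assms(2)] by simp

lemma rec_pred_const: "rec_pred n (\<lambda>xs. b)"
  by (simp add: rec_pred_def rec_const)

lemma rec_pred_le:
  assumes "general_recursive n f" "general_recursive n g"
  shows "rec_pred n (\<lambda>xs. f xs \<le> g xs)"
  using rec_pred_not[OF rec_pred_less[OF assms(2,1)]] by (simp add: not_less)

lemma rec_pred_eq: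
  assumes "general_recursive n f" "general_recursive n g"
  shows "rec_pred n (\<lambda>xs. f xs = g xs)"
  by (rule rec_pred_cong[OF rec_pred_conj[OF rec_pred_le[OF assms] rec_pred_le[OF assms(2,1)]]])
    auto

text \<open>The search is a primitive recursion whose accumulator turns to 1 at the first witness
  and stays there.\<close>

lemma rec_pred_bex:
  assumes "general_recursive n b" "rec_pred (Suc n) (\<lambda>ys. P (hd ys) (tl ys))"
  shows "rec_pred n (\<lambda>xs. \<exists>k<b xs. P k xs)"
proof -
  have *: "rec_nat 0 (\<lambda>k r. of_bool (r = 1 \<or> p k)) b = of_bool (\<exists>k<b. p k)" for p and b :: nat
    by (induction b) (auto simp: less_Suc_eq)

  \<comment> \<open>The recursion step receives the accumulator as its second argument. Projections
    that skip this position insert it as a dummy; \<open>rec_tl\<close> could only insert one at the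
    head.\<close>
  have "rec_pred (Suc (Suc n)) (\<lambda>ys. P (hd ys) (tl (tl ys)))"
    unfolding rec_pred_def
  proof (rule general_recursive_compose[of "hd # map (\<lambda>i xs. xs ! Suc (Suc i)) [0..<n]"])
    show "general_recursive (length (hd # map (\<lambda>i xs. xs ! Suc (Suc i)) [0..<n]))
        (\<lambda>ys. of_bool (P (hd ys) (tl ys)))"
      using assms(2) by (simp add: rec_pred_def)
  next
    fix xs :: "nat list"
    assume "length xs = Suc (Suc n)"
    then have "map (\<lambda>g. g xs) (map (\<lambda>i xs. xs ! Suc (Suc i)) [0..<n]) = tl (tl xs)"
      by (auto intro!: nth_equalityI simp: nth_tl)
    then show "of_bool (P (hd (map (\<lambda>g. g xs) (hd # map (\<lambda>i xs. xs ! Suc (Suc i)) [0..<n])))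
          (tl (map (\<lambda>g. g xs) (hd # map (\<lambda>i xs. xs ! Suc (Suc i)) [0..<n])))) =
        (of_bool (P (hd xs) (tl (tl xs))) :: nat)"
      by (simp del: map_map)
  qed (auto intro: general_recursive.proj rec_hd)
  then have "general_recursive (Suc (Suc n))
      (\<lambda>ys. of_bool (hd (tl ys) = 1 \<or> P (hd ys) (tl (tl ys))))"
    by (fold rec_pred_def) (intro rec_pred_disj rec_pred_eq rec_const rec_vars)
  from rec_rec_nat[OF assms(1) rec_const, of "\<lambda>k r xs. of_bool (r = 1 \<or> P k xs)", OF this, of 0]
  show ?thesis by (simp only: * rec_pred_def)
qed

lemma rec_pred_ball:
  assumes "general_recursive n b" "rec_pred (Suc n) (\<lambda>ys. P (hd ys) (tl ys))"
  shows "rec_pred n (\<lambda>xs. \<forall>k<b xs. P k xs)"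
  using rec_pred_not[OF rec_pred_bex[of n b "\<lambda>k xs. \<not> P k xs"]] assms
  by (simp add: rec_pred_not)

text \<open>The value is itself a root of the tested function, so the minimisation is regular. All
  unbounded search enters here: division and unpairing are obtained from their graphs.\<close>

lemma rec_graph:
  assumes "rec_pred (Suc n) (\<lambda>ys. f (tl ys) = hd ys)"
  shows "general_recursive n f"
proof -
  have "general_recursive (n + 1) (\<lambda>ys. of_bool (f (tl ys) \<noteq> hd ys))"
    using rec_pred_not[OF assms] by (simp add: rec_pred_def)
  from general_recursive.minimise[OF this]
  have "general_recursive n (\<lambda>xs. LEAST k. of_bool (f xs \<noteq> k) = (0::nat))" by auto
  moreover have "(LEAST k. of_bool (a \<noteq> k) = (0::nat)) = a" for a :: nat
    by (rule Least_equality) (auto split: if_splits)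
  ultimately show ?thesis by simp
qed

lemma rec_div:
  assumes "general_recursive n f" "general_recursive n g"
  shows "general_recursive n (\<lambda>xs. f xs div g xs)"
proof (rule rec_graph)
  have *: "a div b = q \<longleftrightarrow> (b = 0 \<and> q = 0) \<or> (q * b \<le> a \<and> a < (q + 1) * b)" for a b q :: nat
  proof (cases "b = 0")
    case False
    then show ?thesis
      using dividend_less_div_times[of b a]
      by (auto simp: algebra_simps intro!: div_nat_eqI)
  qed auto
  show "rec_pred (Suc n) (\<lambda>ys. f (tl ys) div g (tl ys) = hd ys)"
    unfolding * by (intro rec_pred_disj rec_pred_conj rec_pred_eq rec_pred_le rec_pred_less
        rec_mult rec_add rec_const rec_vars rec_tl assms)
qed

lemma rec_mod:
  assumes "general_recursive n f" "general_recursive n g"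
  shows "general_recursive n (\<lambda>xs. f xs mod g xs)"
  unfolding modulo_nat_def by (intro rec_diff rec_mult rec_div assms)

lemmas rec_intros = rec_vars
  rec_tl[OF rec_tl[OF rec_tl[OF rec_hd]]] rec_tl[OF rec_tl[OF rec_tl[OF rec_tl[OF rec_hd]]]]
  rec_const rec_Suc rec_add rec_mult rec_power rec_diff rec_div rec_mod
  rec_pred_const rec_pred_less rec_pred_le rec_pred_eq rec_pred_not rec_pred_conj rec_pred_disj
  rec_pred_imp rec_pred_bex rec_pred_ball

section \<open>Local conditions on configurations\<close>

definition agree :: "int set \<Rightarrow> (int \<Rightarrow> 'a) \<Rightarrow> int \<Rightarrow> (int \<Rightarrow> 'a) \<Rightarrow> int \<Rightarrow> bool" where
  "agree K v z v' z' \<longleftrightarrow> (\<forall>k\<in>K. v (z + k) = v' (z' + k))"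

text \<open>Since the base points may differ, this demands translation invariance together with
  dependence on the cells at offsets in \<open>K\<close> only.\<close>

definition local_on :: "int set \<Rightarrow> ((int \<Rightarrow> 'a) \<Rightarrow> int \<Rightarrow> bool) \<Rightarrow> bool" where
  "local_on K P \<longleftrightarrow> (\<forall>v z v' z'. agree K v z v' z' \<longrightarrow> P v z = P v' z')"

definition local_on2 :: "int set \<Rightarrow> ((int \<Rightarrow> 'a) \<Rightarrow> (int \<Rightarrow> 'b) \<Rightarrow> int \<Rightarrow> bool) \<Rightarrow> bool" where
  "local_on2 K Q \<longleftrightarrow>
     (\<forall>v h z v' h' z'. agree K v z v' z' \<longrightarrow> agree K h z h' z' \<longrightarrow> Q v h z = Q v' h' z')"

lemma local_onD: "local_on K P \<Longrightarrow> agree K v z v' z' \<Longrightarrow> P v z = P v' z'"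
  by (auto simp: local_on_def)

lemma local_on2D:
  "local_on2 K Q \<Longrightarrow> agree K v z v' z' \<Longrightarrow> agree K h z h' z' \<Longrightarrow> Q v h z = Q v' h' z'"
  by (auto simp: local_on2_def)

lemma agree_refl: "agree K v z v z"
  by (simp add: agree_def)

lemma configs_shift: "v \<in> configs A \<Longrightarrow> (\<lambda>z. v (z + d)) \<in> configs A"
  by (simp add: configs_def)

definition splice :: "(int \<Rightarrow> 'a) \<Rightarrow> (int \<Rightarrow> 'a) \<Rightarrow> int \<Rightarrow> int \<Rightarrow> int \<Rightarrow> 'a" where
  "splice v u i j = (\<lambda>z. if z < i then v z else u (z - i + j))"

lemma splice_configs: "v \<in> configs A \<Longrightarrow> u \<in> configs A \<Longrightarrow> splice v u i j \<in> configs A"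
  by (simp add: splice_def configs_def)

text \<open>The two pieces agree on the cells around the seam, so the splice coincides with either
  of them up to distance \<open>R\<close> beyond it. A neighbourhood of radius \<open>R\<close> thus
  never sees the seam.\<close>

lemma splice_left:
  assumes "agree {-R..<R} v i u j" "z < i + R"
  shows "splice v u i j z = v z"
  using assms(1)[unfolded agree_def, rule_format, of "z - i"] assms(2)
  by (cases "R \<ge> 0") (auto simp: splice_def algebra_simps)

lemma splice_right:
  assumes "agree {-R..<R} v i u j" "z \<ge> i - R"
  shows "splice v u i j z = u (z - i + j)"
  using assms(1)[unfolded agree_def, rule_format, of "z - i"] assms(2)
  by (cases "R \<ge> 0") (auto simp: splice_def algebra_simps)

lemma splice_agree_left:
  assumes "agree {-R..<R} v i u j" "z < i"
  shows "agree {-R..R} (splice v u i j) z v z"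
  using splice_left[OF assms(1)] assms(2) by (auto simp: agree_def)

lemma splice_agree_right:
  assumes "agree {-R..<R} v i u j" "z \<ge> i"
  shows "agree {-R..R} (splice v u i j) z u (z - i + j)"
  using splice_right[OF assms(1)] assms(2) by (auto simp: agree_def algebra_simps)

section \<open>Shortest counterexamples by pigeonhole on windows\<close>

definition window :: "nat \<Rightarrow> (int \<Rightarrow> 'a) \<Rightarrow> int \<Rightarrow> int \<Rightarrow> 'a" where
  "window R v i = restrict (\<lambda>k. v (i + k)) {- int R..<int R}"

lemma window_eq_iff:
  "window R v i = window R u j \<longleftrightarrow> agree {- int R..<int R} v i u j"
  by (auto simp: window_def agree_def restrict_def fun_eq_iff)

lemma window_in: "v \<in> configs A \<Longrightarrow> window R v i \<in> {- int R..<int R} \<rightarrow>\<^sub>E A"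
  by (auto simp: window_def configs_def)

lemma card_windows: "card ({- int R..<int R} \<rightarrow>\<^sub>E A) = card A ^ (2 * R)"
  by (simp add: card_PiE nat_mult_distrib)

lemma pigeonhole_nat:
  assumes "finite S" "\<And>i. i \<le> n \<Longrightarrow> \<sigma> i \<in> S" "card S \<le> n"
  obtains i j :: nat where "i < j" "j \<le> n" "\<sigma> i = \<sigma> j"
proof -
  have "card (\<sigma> ` {..n}) \<le> card S" using assms by (intro card_mono) auto
  then have "\<not> inj_on \<sigma> {..n}" using assms(3) by (auto dest: card_image)
  then show ?thesis
    unfolding inj_on_def by (metis atMost_iff linorder_neqE_nat that)
qed

text \<open>\<open>I\<close> and \<open>J\<close> constrain the two ends of \<open>v\<close>, up to \<open>b\<close> and from \<open>b + n\<close> onwards. Taking \<open>H\<close>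
  empty makes the last conjunct void.\<close>

definition unsolved ::
  "'a set \<Rightarrow> 'b set \<Rightarrow> ((int \<Rightarrow> 'a) \<Rightarrow> int \<Rightarrow> bool) \<Rightarrow> ((int \<Rightarrow> 'a) \<Rightarrow> int \<Rightarrow> bool) \<Rightarrow>
   ((int \<Rightarrow> 'a) \<Rightarrow> int \<Rightarrow> bool) \<Rightarrow> ((int \<Rightarrow> 'a) \<Rightarrow> (int \<Rightarrow> 'b) \<Rightarrow> int \<Rightarrow> bool) \<Rightarrow>
   int \<Rightarrow> nat \<Rightarrow> (int \<Rightarrow> 'a) \<Rightarrow> bool" where
  "unsolved A H I J P Q b n v \<longleftrightarrow> v \<in> configs A \<and> I v b \<and> J v (b + int n) \<and>
     (\<forall>z\<in>{b..<b + int n}. P v z) \<and> \<not> (\<exists>h\<in>configs H. \<forall>z\<in>{b..<b + int n}. Q v h z)"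

text \<open>The state reached at cell \<open>i\<close> by the subset construction for the hidden configuration.\<close>

definition profile ::
  "'b set \<Rightarrow> nat \<Rightarrow> ((int \<Rightarrow> 'a) \<Rightarrow> (int \<Rightarrow> 'b) \<Rightarrow> int \<Rightarrow> bool) \<Rightarrow> int \<Rightarrow> (int \<Rightarrow> 'a) \<Rightarrow> int \<Rightarrow>
   (int \<Rightarrow> 'a) \<times> (int \<Rightarrow> 'b) set" where
  "profile H R Q b v i =
     (window R v i, {window R h i | h. h \<in> configs H \<and> (\<forall>z\<in>{b..<i}. Q v h z)})"

text \<open>Between two cells of equal profile the block can be cut out: equal visible windows keep
  the local condition, and equal sets of hidden windows let a solution of the shorter block be
  turned into one of the original. The end conditions may look arbitrarily far outwards, because
  cutting only translates the outer parts.\<close>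

lemma unsolved_cut:
  fixes n i j :: nat
  assumes P: "local_on {- int R..int R} P" and Q: "local_on2 {- int R..int R} Q"
    and I: "local_on {..<int R} I" and J: "local_on {- int R..} J"
    and v: "unsolved A H I J P Q b n v" and ij: "i < j" "j \<le> n"
    and eq: "profile H R Q b v (b + int i) = profile H R Q b v (b + int j)"
  shows "unsolved A H I J P Q b (n - (j - i)) (splice v v (b + int i) (b + int j))"
proof -
  let ?i = "b + int i" and ?j = "b + int j"
  define n' where "n' = n - (j - i)"
  define v' where "v' = splice v v ?i ?j"
  have n': "int n' = int n - int j + int i" using ij by (simp add: n'_def)
  have ag: "agree {- int R..<int R} v ?i v ?j"
    using eq by (simp add: profile_def window_eq_iff)
  have left: "agree {- int R..int R} v' z v z" if "z < ?i" for z
    unfolding v'_def using splice_agree_left[OF ag that] .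
  have right: "agree {- int R..int R} v' z v (z - ?i + ?j)" if "z \<ge> ?i" for z
    unfolding v'_def using splice_agree_right[OF ag that] .
  have "v' \<in> configs A" using v by (simp add: v'_def unsolved_def splice_configs)
  moreover have "I v' b"
  proof -
    have "agree {..<int R} v' b v b"
      unfolding v'_def agree_def using splice_left[OF ag] by auto
    then show ?thesis using local_onD[OF I] v by (auto simp: unsolved_def)
  qed
  moreover have "J v' (b + int n')"
  proof -
    have "v' (b + int n' + k) = v (b + int n + k)" if "k \<ge> - int R" for k
    proof -
      have "v' (b + int n' + k) = v (b + int n' + k - ?i + ?j)"
        unfolding v'_def using that ij n' by (intro splice_right[OF ag]) linarith
      also have "b + int n' + k - ?i + ?j = b + int n + k" using n' by simp
      finally show ?thesis .
    qed
    then have "agree {- int R..} v' (b + int n') v (b + int n)"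
      by (simp add: agree_def)
    then show ?thesis using local_onD[OF J] v by (auto simp: unsolved_def)
  qed
  moreover have "P v' z" if "z \<in> {b..<b + int n'}" for z
  proof (cases "z < ?i")
    case True
    then have "P v z" using v that ij by (auto simp: unsolved_def)
    then show ?thesis using local_onD[OF P left[OF True]] by simp
  next
    case False
    then have "P v (z - ?i + ?j)" using v that ij n' by (auto simp: unsolved_def)
    then show ?thesis using local_onD[OF P right] False by simp
  qed
  moreover have "\<not> (\<exists>h\<in>configs H. \<forall>z\<in>{b..<b + int n'}. Q v' h z)"
  proof
    assume "\<exists>h\<in>configs H. \<forall>z\<in>{b..<b + int n'}. Q v' h z"
    then obtain h' where h': "h' \<in> configs H" "\<And>z. z \<in> {b..<b + int n'} \<Longrightarrow> Q v' h' z"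
      by auto
    \<comment> \<open>Before the seam \<open>v'\<close> looks like \<open>v\<close>, so
      \<open>h'\<close> is a hidden prefix for \<open>v\<close> as well and its window at
      \<open>?i\<close> belongs to the profile there, hence to the profile at
      \<open>?j\<close>.\<close>
    have "Q v h' z" if "z \<in> {b..<?i}" for z
      using h'(2)[of z] that local_on2D[OF Q left agree_refl, of z h'] n' ij by auto
    then have "window R h' ?i \<in> {window R h ?i | h. h \<in> configs H \<and> (\<forall>z\<in>{b..<?i}. Q v h z)}"
      using h'(1) by auto
    also have "\<dots> = {window R h ?j | h. h \<in> configs H \<and> (\<forall>z\<in>{b..<?j}. Q v h z)}"
      using eq by (simp add: profile_def)
    finally obtain h where h: "h \<in> configs H" "\<And>z. z \<in> {b..<?j} \<Longrightarrow> Q v h z"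
      and agh: "agree {- int R..<int R} h ?j h' ?i"
      by (auto simp: window_eq_iff agree_def)
    \<comment> \<open>\<open>h\<close> solves \<open>v\<close> before \<open>?j\<close> and shows
      there the window that \<open>h'\<close> shows at \<open>?i\<close>. Continuing with the
      translate of \<open>h'\<close> solves the entire original block.\<close>
    define g where "g = splice h h' ?j ?i"
    have "Q v g z" if "z \<in> {b..<b + int n}" for z
    proof (cases "z < ?j")
      case True
      have "agree {- int R..int R} g z h z"
        unfolding g_def using True by (rule splice_agree_left[OF agh])
      then show ?thesis
        using local_on2D[OF Q agree_refl] h(2)[of z] that True by auto
    next
      case False
      have "agree {- int R..int R} g z h' (z - ?j + ?i)"
        unfolding g_def using False by (intro splice_agree_right[OF agh]) simp
      moreover have "agree {- int R..int R} v z v' (z - ?j + ?i)"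
        using right[of "z - ?j + ?i"] False by (auto simp: agree_def)
      ultimately have "Q v g z = Q v' h' (z - ?j + ?i)"
        by (intro local_on2D[OF Q])
      then show ?thesis using h'(2)[of "z - ?j + ?i"] that False n' by auto
    qed
    moreover have "g \<in> configs H" using h(1) h'(1) by (simp add: g_def splice_configs)
    ultimately show False using v by (auto simp: unsolved_def)
  qed
  ultimately show ?thesis by (simp add: unsolved_def v'_def n'_def)
qed

text \<open>A block of minimal length repeats no profile before its end, and a profile is a window
  over \<open>A\<close> paired with a set of windows over \<open>H\<close>; the bound counts these
  pairs.\<close>

lemma unsolved_bounded:
  fixes R :: nat
  assumes fin: "finite A" "finite H"
    and P: "local_on {- int R..int R} P" and Q: "local_on2 {- int R..int R} Q"
    and I: "local_on {..<int R} I" and J: "local_on {- int R..} J"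
    and v: "unsolved A H I J P Q b n v"
    and B: "card A ^ (2 * R) * 2 ^ (card H ^ (2 * R)) \<le> B"
  shows "\<exists>n<B. \<exists>v. unsolved A H I J P Q b n v"
proof -
  define m where "m = (LEAST n. \<exists>v. unsolved A H I J P Q b n v)"
  have "\<exists>v. unsolved A H I J P Q b m v"
    unfolding m_def using v LeastI_ex[of "\<lambda>n. \<exists>v. unsolved A H I J P Q b n v"] by blast
  then obtain w where w: "unsolved A H I J P Q b m w" ..
  have least: "m \<le> k" if "unsolved A H I J P Q b k u" for k u
    unfolding m_def using that by (intro Least_le) auto
  have "m < B"
  proof (rule ccontr)
    assume "\<not> m < B"
    let ?S = "({- int R..<int R} \<rightarrow>\<^sub>E A) \<times> Pow ({- int R..<int R} \<rightarrow>\<^sub>E H)"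
    have S: "finite ?S" using fin by (intro finite_cartesian_product finite_PiE) (auto intro: finite_PiE)
    moreover have "card ?S \<le> m"
      using B \<open>\<not> m < B\<close> fin by (simp add: card_cartesian_product card_Pow finite_PiE card_windows)
    moreover have "profile H R Q b w (b + int i) \<in> ?S" for i
      using w by (auto simp: profile_def unsolved_def dest: window_in)
    ultimately obtain i j where "i < j" "j \<le> m"
      "profile H R Q b w (b + int i) = profile H R Q b w (b + int j)"
      using pigeonhole_nat[of ?S m "\<lambda>i. profile H R Q b w (b + int i)"] by metis
    from least[OF unsolved_cut[OF P Q I J w this]] this(1,2) show False by simp
  qed
  with w show ?thesis by blast
qed

text \<open>Sequential compactness, by a diagonal argument over the cells in the order of
  \<open>int_decode\<close>. Agreement occurs at arbitrarily late indices, so that conditions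
  imposed on growing intervals pass to the limit.\<close>

lemma configs_limit_point:
  fixes h :: "nat \<Rightarrow> int \<Rightarrow> 'a"
  assumes fin: "finite A" and h: "\<And>n. h n \<in> configs A"
  obtains g where "g \<in> configs A" "\<And>m :: nat. \<exists>n\<ge>m. \<forall>z\<in>{- int m..int m}. h n z = g z"
proof -
  interpret subseqs "\<lambda>i s. \<exists>a. \<forall>k. h (s k) (int_decode i) = a"
  proof
    fix i and s :: "nat \<Rightarrow> nat"
    have "range (\<lambda>k. h (s k) (int_decode i)) \<subseteq> A" using h by (auto simp: configs_def)
    then have "finite (range (\<lambda>k. h (s k) (int_decode i)))" using fin finite_subset by blast
    then obtain k0 where "infinite {k \<in> UNIV. h (s k) (int_decode i) = h (s k0) (int_decode i)}"
      using pigeonhole_infinite[of "UNIV :: nat set" "\<lambda>k. h (s k) (int_decode i)"]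
        infinite_UNIV_nat by blast
    from infinite_enumerate[OF this] obtain r :: "nat \<Rightarrow> nat" where r: "strict_mono r"
      "\<forall>k. r k \<in> {k \<in> UNIV. h (s k) (int_decode i) = h (s k0) (int_decode i)}"
      by blast
    from r(2) have "\<forall>k. h ((s \<circ> r) k) (int_decode i) = h (s k0) (int_decode i)" by simp
    with r(1) show "\<exists>r :: nat \<Rightarrow> nat. strict_mono r \<and> (\<exists>a. \<forall>k. h ((s \<circ> r) k) (int_decode i) = a)"
      by blast
  qed
  have "\<forall>i. \<exists>a. \<forall>k. h ((diagseq \<circ> (+) (Suc i)) k) (int_decode i) = a"
    by (intro allI diagseq_holds) auto
  then have "\<exists>a. \<forall>i k. h ((diagseq \<circ> (+) (Suc i)) k) (int_decode i) = a i"
    by (rule choice)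
  then obtain a where a: "\<And>i k. h (diagseq (Suc i + k)) (int_decode i) = a i"
    by auto
  show ?thesis
  proof
    have "a i \<in> A" for i
      unfolding a[of i 0, symmetric] using h by (simp add: configs_def)
    then show "(\<lambda>z. a (int_encode z)) \<in> configs A"
      by (simp add: configs_def)
    fix m :: nat
    \<comment> \<open>From index \<open>Suc i\<close> on, the diagonal sequence is constant at the
      cell with code \<open>i\<close>. \<open>N\<close> lies beyond the codes of all cells of the
      interval, and the summand \<open>m\<close> makes \<open>diagseq N\<close> late enough.\<close>
    define N where "N = m + Suc (Max (int_encode ` {- int m..int m}))"
    have "h (diagseq N) z = a (int_encode z)" if "z \<in> {- int m..int m}" for z
    proof -
      have "int_encode z \<le> Max (int_encode ` {- int m..int m})"
        by (rule Max_ge) (use that in blast)+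
      then have "Suc (int_encode z) + (N - Suc (int_encode z)) = N" by (simp add: N_def)
      then show ?thesis using a[of "int_encode z" "N - Suc (int_encode z)"] by simp
    qed
    moreover have "diagseq N \<ge> m"
      using strict_mono_imp_increasing[OF subseq_diagseq, of N] by (simp add: N_def)
    ultimately show "\<exists>n\<ge>m. \<forall>z\<in>{- int m..int m}. h n z = a (int_encode z)"
      by (intro exI[of _ "diagseq N"]) simp
  qed
qed

lemma solved_globally:
  assumes "finite H" and Q: "local_on2 {- int R..int R} Q"
    and "\<And>n :: nat. \<exists>h\<in>configs H. \<forall>z\<in>{- int n..int n}. Q v h z"
  shows "\<exists>h\<in>configs H. \<forall>z. Q v h z"
proof -
  obtain h where h: "\<And>n. h n \<in> configs H" "\<And>n z. z \<in> {- int n..int n} \<Longrightarrow> Q v (h n) z"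
    using assms(3) by metis
  obtain g where g: "g \<in> configs H" "\<And>m :: nat. \<exists>n\<ge>m. \<forall>z\<in>{- int m..int m}. h n z = g z"
    using configs_limit_point[where h = h, OF assms(1) h(1)] by blast
  have "Q v g z" for z
  proof -
    define m where "m = nat \<bar>z\<bar> + R"
    obtain n where n: "n \<ge> m" "\<And>z. z \<in> {- int m..int m} \<Longrightarrow> h n z = g z"
      using g(2)[of m] by blast
    have "agree {- int R..int R} g z (h n) z"
      unfolding agree_def by (intro ballI n(2)[symmetric]) (auto simp: m_def)
    then have "Q v g z = Q v (h n) z" by (rule local_on2D[OF Q agree_refl])
    moreover have "z \<in> {- int n..int n}" using n(1) by (auto simp: m_def)
    ultimately show ?thesis by (simp add: h(2))
  qed
  then show ?thesis by (intro bexI[OF _ g(1)] allI)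
qed

text \<open>A stretch of \<open>N\<close> good cells shows some window twice, and the part between
  the two occurrences may be traversed again. Instead of a periodic configuration, ever longer good
  stretches are produced one step at a time and a limit point is taken.\<close>

lemma extend_right:
  fixes R :: nat
  assumes fin: "finite A" and P: "local_on {- int R..int R} P"
    and v: "v \<in> configs A" "\<forall>z\<in>{b..<b + int N}. P v z" and N: "card A ^ (2 * R) \<le> N"
  shows "\<exists>u\<in>configs A. (\<forall>z<b + int R. u z = v z) \<and> (\<forall>z\<ge>b. P u z)"
proof -
  let ?ok = "\<lambda>n u. u \<in> configs A \<and> (\<forall>z<b + int R. u z = v z) \<and> (\<forall>z\<in>{b..<b + int n}. P u z)"
  have step: "\<exists>u'. ?ok (Suc n) u'" if "?ok n u" "n \<ge> N" for n u
  proof -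
    have "finite ({- int R..<int R} \<rightarrow>\<^sub>E A)" using fin by (simp add: finite_PiE)
    moreover have "window R u (b + int i) \<in> {- int R..<int R} \<rightarrow>\<^sub>E A" for i
      using that window_in by blast
    moreover have "card ({- int R..<int R} \<rightarrow>\<^sub>E A) \<le> n"
      using N that by (simp add: card_windows)
    ultimately obtain i j where ij: "i < j" "j \<le> n"
      "window R u (b + int i) = window R u (b + int j)"
      by (rule pigeonhole_nat)
    then have ag: "agree {- int R..<int R} u (b + int j) u (b + int i)"
      by (simp flip: window_eq_iff)
    \<comment> \<open>On reaching the later occurrence, \<open>u\<close> is read again from the
      earlier one. The good stretch grows by \<open>j - i\<close>, which is at least one
      cell.\<close>
    define u' where "u' = splice u u (b + int j) (b + int i)"
    have "u' \<in> configs A" using that by (simp add: u'_def splice_configs)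
    moreover have "u' z = v z" if "z < b + int R" for z
      using splice_left[OF ag, of z] that \<open>?ok n u\<close> by (simp add: u'_def)
    moreover have "P u' z" if z: "z \<in> {b..<b + int (Suc n)}" for z
    proof (cases "z < b + int j")
      case True
      then have "P u z" using z \<open>?ok n u\<close> ij by auto
      then show ?thesis
        unfolding u'_def using local_onD[OF P splice_agree_left[OF ag True]] by simp
    next
      case False
      then have "P u (z - (b + int j) + (b + int i))" using z \<open>?ok n u\<close> ij by auto
      then show ?thesis
        unfolding u'_def using local_onD[OF P splice_agree_right[OF ag, of z]] False by simp
    qed
    ultimately show ?thesis by blast
  qed
  have "\<exists>u. ?ok (N + n) u" for n
  proof (induction n)
    case 0
    then show ?case using v by auto
  next
    case (Suc n)
    then obtain u where "?ok (N + n) u" by blast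
    from step[OF this] show ?case by simp
  qed
  then have "\<exists>h. \<forall>n. ?ok (N + n) (h n)" by (intro choice allI)
  then obtain h where h: "\<And>n. ?ok (N + n) (h n)" by blast
  have hA: "h n \<in> configs A" for n using h by blast
  obtain g where g: "g \<in> configs A" "\<And>m :: nat. \<exists>n\<ge>m. \<forall>z\<in>{- int m..int m}. h n z = g z"
    using configs_limit_point[where h = h, OF fin hA] by blast
  have "g z = v z" if "z < b + int R" for z
  proof -
    obtain n where "\<forall>x\<in>{- int (nat \<bar>z\<bar>)..int (nat \<bar>z\<bar>)}. h n x = g x"
      using g(2) by blast
    then have "h n z = g z" by (rule bspec) auto
    then show ?thesis using h[of n] that by simp
  qed
  moreover have "P g z" if "z \<ge> b" for z
  proof -
    \<comment> \<open>The first two summands make the neighbourhood of \<open>z\<close> fit into the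
      interval of agreement; the others ensure \<open>z < b + int n\<close>, so that
      \<open>h n\<close> is good at \<open>z\<close>.\<close>
    define m where "m = nat \<bar>z\<bar> + R + nat \<bar>b\<bar> + 1"
    obtain n where n: "n \<ge> m" "\<And>z. z \<in> {- int m..int m} \<Longrightarrow> h n z = g z"
      using g(2)[of m] by blast
    have "agree {- int R..int R} g z (h n) z"
      unfolding agree_def by (intro ballI n(2)[symmetric]) (auto simp: m_def)
    then have "P g z = P (h n) z" by (rule local_onD[OF P])
    moreover have "P (h n) z" using h[of n] that n(1) by (auto simp: m_def)
    ultimately show ?thesis by simp
  qed
  ultimately show ?thesis by (intro bexI[OF _ g(1)] conjI allI impI)
qed

lemma extend_left:
  fixes R :: nat
  assumes fin: "finite A" and P: "local_on {- int R..int R} P"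
    and v: "v \<in> configs A" "\<forall>z\<in>{b - int N..<b}. P v z" and N: "card A ^ (2 * R) \<le> N"
  shows "\<exists>u\<in>configs A. (\<forall>z\<ge>b - int R. u z = v z) \<and> (\<forall>z<b. P u z)"
proof -
  define P' where "P' = (\<lambda>v z. P (\<lambda>x. v (- x)) (- z))"
  have P': "local_on {- int R..int R} P'"
    unfolding local_on_def
  proof (intro allI impI)
    fix v z v' z'
    assume ag: "agree {- int R..int R} v z (v' :: int \<Rightarrow> 'a) z'"
    have "agree {- int R..int R} (\<lambda>x. v (- x)) (- z) (\<lambda>x. v' (- x)) (- z')"
      unfolding agree_def
    proof
      fix k assume "k \<in> {- int R..int R}"
      then have "- k \<in> {- int R..int R}" by auto
      then have "v (z + - k) = v' (z' + - k)" using ag unfolding agree_def by (rule bspec[rotated])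
      then show "v (- (- z + k)) = v' (- (- z' + k))" by simp
    qed
    then show "P' v z = P' v' z'" unfolding P'_def by (rule local_onD[OF P])
  qed
  have v': "(\<lambda>x. v (- x)) \<in> configs A" using v(1) by (simp add: configs_def)
  \<comment> \<open>Reflection carries the cells below \<open>b\<close> to those from
    \<open>1 - b\<close> on; the shift by one comes from the half-open intervals.\<close>
  have ok: "\<forall>z\<in>{1 - b..<1 - b + int N}. P' (\<lambda>x. v (- x)) z"
    using v(2) by (auto simp: P'_def)
  obtain u where u: "u \<in> configs A" "\<And>z. z < 1 - b + int R \<Longrightarrow> u z = v (- z)"
    "\<And>z. z \<ge> 1 - b \<Longrightarrow> P' u z"
    using extend_right[OF fin P' v' ok N] by auto
  show ?thesis
  proof (intro bexI conjI allI impI)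
    show "(\<lambda>x. u (- x)) \<in> configs A" using u(1) by (simp add: configs_def)
    show "u (- z) = v z" if "z \<ge> b - int R" for z using u(2)[of "- z"] that by auto
    show "P (\<lambda>x. u (- x)) z" if "z < b" for z using u(3)[of "- z"] that by (auto simp: P'_def)
  qed
qed

text \<open>The right end is extended first. As \<open>b \<le> e\<close>, this leaves untouched
  everything that the left margin reads, and extending to the left afterwards does not disturb the
  right tail either.\<close>

lemma extend_both:
  fixes R :: nat
  assumes fin: "finite A" and P: "local_on {- int R..int R} P"
    and v: "v \<in> configs A" "\<forall>z\<in>{b - int N..<b}. P v z" "\<forall>z\<in>{e..<e + int N}. P v z"
    and be: "b \<le> e" and N: "card A ^ (2 * R) \<le> N"
  shows "\<exists>u\<in>configs A. (\<forall>z\<in>{b - int R..<e + int R}. u z = v z) \<and> (\<forall>z<b. P u z) \<and> (\<forall>z\<ge>e. P u z)"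
proof -
  obtain w where w: "w \<in> configs A" "\<And>z. z < e + int R \<Longrightarrow> w z = v z" "\<And>z. z \<ge> e \<Longrightarrow> P w z"
    using extend_right[OF fin P v(1,3) N] by auto
  have "P w z" if "z \<in> {b - int N..<b}" for z
  proof -
    have "agree {- int R..int R} w z v z" using w(2) that be by (auto simp: agree_def)
    from local_onD[OF P this] show ?thesis using v(2) that by simp
  qed
  then obtain u where u: "u \<in> configs A" "\<And>z. z \<ge> b - int R \<Longrightarrow> u z = w z" "\<And>z. z < b \<Longrightarrow> P u z"
    using extend_left[OF fin P w(1) _ N, of b] by auto
  have "P u z" if "z \<ge> e" for z
  proof -
    have "agree {- int R..int R} u z w z" using u(2) that be by (auto simp: agree_def)
    from local_onD[OF P this] show ?thesis using w(3) that by simp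
  qed
  then show ?thesis using u w by (intro bexI[of _ u]) auto
qed

section \<open>Codes of lists, words and automata\<close>

lemma rec_if:
  assumes "rec_pred n P" "general_recursive n f" "general_recursive n g"
  shows "general_recursive n (\<lambda>xs. if P xs then f xs else g xs)"
proof (rule general_recursive_cong)
  show "general_recursive n (\<lambda>xs. of_bool (P xs) * f xs + of_bool (\<not> P xs) * g xs)"
    using assms rec_pred_not[OF assms(1)] unfolding rec_pred_def by (intro rec_add rec_mult)
qed auto

lemma rec_pred_finite:
  assumes "finite S" "general_recursive n f"
  shows "rec_pred n (\<lambda>xs. f xs \<in> S)"
  using assms(1)
proof induction
  case empty
  then show ?case by (simp add: rec_pred_const)
next
  case (insert a S)
  then show ?case by (simp add: rec_pred_disj rec_pred_eq rec_const assms(2))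
qed

section \<open>Pairs and coded lists\<close>

lemma rec_prod_encode:
  assumes "general_recursive n f" "general_recursive n g"
  shows "general_recursive n (\<lambda>xs. prod_encode (f xs, g xs))"
  unfolding prod_encode_def triangle_def prod.case by (intro rec_intros assms)

lemma rec_fst_prod_decode:
  assumes "general_recursive n f"
  shows "general_recursive n (\<lambda>xs. fst (prod_decode (f xs)))"
proof (rule rec_graph)
  have *: "fst (prod_decode z) = a \<longleftrightarrow> (\<exists>b<Suc z. prod_encode (a, b) = z)" for z a
    by (metis fst_conv le_imp_less_Suc le_prod_encode_2 prod.collapse prod_decode_inverse
        prod_encode_inverse)
  show "rec_pred (Suc n) (\<lambda>ys. fst (prod_decode (f (tl ys))) = hd ys)"
    unfolding * by (intro rec_intros rec_prod_encode assms[THEN rec_tl] assms[THEN rec_tl, THEN rec_tl])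
qed

lemma rec_snd_prod_decode:
  assumes "general_recursive n f"
  shows "general_recursive n (\<lambda>xs. snd (prod_decode (f xs)))"
proof (rule rec_graph)
  have *: "snd (prod_decode z) = b \<longleftrightarrow> (\<exists>a<Suc z. prod_encode (a, b) = z)" for z b
    by (metis snd_conv le_imp_less_Suc le_prod_encode_1 prod.collapse prod_decode_inverse
        prod_encode_inverse)
  show "rec_pred (Suc n) (\<lambda>ys. snd (prod_decode (f (tl ys))) = hd ys)"
    unfolding * by (intro rec_intros rec_prod_encode assms[THEN rec_tl] assms[THEN rec_tl, THEN rec_tl])
qed

text \<open>A nonempty list is coded as the successor of the pair of its head and the code of its
  tail. The empty list has code 0, which is a fixed point of the step because
  \<open>prod_decode 0 = (0, 0)\<close>.\<close>

definition drop_code :: "nat \<Rightarrow> nat \<Rightarrow> nat" where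
  "drop_code c k = rec_nat c (\<lambda>_ r. snd (prod_decode (r - 1))) k"

definition nth_code :: "nat \<Rightarrow> nat \<Rightarrow> nat" where
  "nth_code c k = fst (prod_decode (drop_code c k - 1))"

definition mem_code :: "nat \<Rightarrow> nat \<Rightarrow> bool" where
  "mem_code c a \<longleftrightarrow> (\<exists>k<c. drop_code c k \<noteq> 0 \<and> nth_code c k = a)"

lemma list_encode_eq_0_iff: "list_encode l = 0 \<longleftrightarrow> l = []"
  by (cases l) auto

lemma drop_code_list_encode: "drop_code (list_encode l) k = list_encode (drop k l)"
proof (induction k)
  case 0
  then show ?case by (simp add: drop_code_def)
next
  case (Suc k)
  have "prod_decode 0 = (0, 0)"
    using prod_encode_inverse[of "(0, 0)"] by (simp add: prod_encode_def)
  then have "snd (prod_decode (list_encode l - 1)) = list_encode (tl l)" for l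
    by (cases l) auto
  with Suc show ?case by (simp add: drop_code_def drop_Suc drop_tl)
qed

lemma nth_code_list_encode: "k < length l \<Longrightarrow> nth_code (list_encode l) k = l ! k"
  unfolding nth_code_def drop_code_list_encode
  by (subst Cons_nth_drop_Suc[symmetric]) auto

lemma drop_code_nonzero_iff: "drop_code (list_encode l) k \<noteq> 0 \<longleftrightarrow> k < length l"
  by (simp add: drop_code_list_encode list_encode_eq_0_iff not_le)

lemma length_le_list_encode: "length l \<le> list_encode l"
proof (induction l)
  case (Cons a l)
  then show ?case using le_prod_encode_2[of "list_encode l" a] by simp
qed simp

lemma nth_le_list_encode: "a \<in> set l \<Longrightarrow> a \<le> list_encode l"
proof (induction l)
  case (Cons b l)
  then show ?case
    using le_prod_encode_2[of "list_encode l" b] le_prod_encode_1[of b "list_encode l"] by auto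
qed simp

text \<open>Lists are searched without computing their length: the index runs up to a crude bound,
  and a nonzero remaining code tells that it is still inside the list.\<close>

lemma ex_index_less_code_iff:
  assumes "length l \<le> c"
  shows "(\<exists>k<c. drop_code (list_encode l) k \<noteq> 0 \<and> S (nth_code (list_encode l) k)) \<longleftrightarrow>
    (\<exists>a\<in>set l. S a)"
  using assms unfolding drop_code_nonzero_iff in_set_conv_nth Bex_def
  by (metis less_le_trans nth_code_list_encode)

lemma mem_code_list_encode: "mem_code (list_encode l) a \<longleftrightarrow> a \<in> set l"
  using ex_index_less_code_iff[OF length_le_list_encode, of l "\<lambda>b. b = a"]
  by (simp add: mem_code_def)

lemma rec_drop_code:
  assumes "general_recursive n c" "general_recursive n k"
  shows "general_recursive n (\<lambda>xs. drop_code (c xs) (k xs))"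
  unfolding drop_code_def by (rule rec_rec_nat) (intro assms rec_snd_prod_decode rec_intros)+

lemma rec_nth_code:
  assumes "general_recursive n c" "general_recursive n k"
  shows "general_recursive n (\<lambda>xs. nth_code (c xs) (k xs))"
  unfolding nth_code_def by (intro assms rec_drop_code rec_fst_prod_decode rec_intros)

lemma rec_mem_code:
  assumes "general_recursive n c" "general_recursive n a"
  shows "rec_pred n (\<lambda>xs. mem_code (c xs) (a xs))"
  unfolding mem_code_def
  by (intro rec_intros rec_drop_code rec_nth_code assms assms[THEN rec_tl])

section \<open>Configurations as words in positional notation\<close>

definition digit :: "nat \<Rightarrow> nat \<Rightarrow> nat \<Rightarrow> nat" where
  "digit b w i = w div b ^ i mod b"

lemma rec_digit:
  assumes "general_recursive n b" "general_recursive n w" "general_recursive n i"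
  shows "general_recursive n (\<lambda>xs. digit (b xs) (w xs) (i xs))"
  unfolding digit_def by (intro rec_intros assms)

lemma ex_digits:
  assumes "\<And>i. i < n \<Longrightarrow> g i < b"
  shows "\<exists>w<b ^ n. \<forall>i<n. digit b w i = g i"
  using assms
proof (induction n arbitrary: g)
  case 0
  then show ?case by simp
next
  case (Suc n)
  obtain w where w: "w < b ^ n" "\<forall>i<n. digit b w i = g (Suc i)"
    using Suc.IH[of "\<lambda>i. g (Suc i)"] Suc.prems by auto
  have g: "g 0 < b" using Suc.prems by simp
  have "digit b (g 0 + b * w) i = g i" if "i < Suc n" for i
  proof (cases i)
    case 0
    then show ?thesis using g by (simp add: digit_def)
  next
    case (Suc j)
    then have "digit b (g 0 + b * w) i = digit b w j"
      using g by (simp add: digit_def div_mult2_eq)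
    then show ?thesis using w(2) that Suc by simp
  qed
  moreover have "g 0 + b * w < b ^ Suc n"
  proof -
    have "g 0 + b * w < b * Suc w" using g by simp
    also have "\<dots> \<le> b * b ^ n" using w(1) by (intro mult_le_mono) auto
    finally show ?thesis by simp
  qed
  ultimately show ?case by blast
qed

definition decode :: "nat \<Rightarrow> nat \<Rightarrow> int \<Rightarrow> nat" where
  "decode L w = (\<lambda>z. digit L w (nat z))"

text \<open>Several configurations are superposed into one whose letters are tuples in base
  \<open>M\<close>, so the one-configuration results on windows apply to all of them
  jointly.\<close>

definition track :: "nat \<Rightarrow> nat \<Rightarrow> (int \<Rightarrow> nat) \<Rightarrow> int \<Rightarrow> nat" where
  "track M j v = (\<lambda>z. digit M (v z) j)"

definition letters :: "nat \<Rightarrow> nat \<Rightarrow> (nat \<Rightarrow> nat set) \<Rightarrow> nat set" where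
  "letters M m D = {a. a < M ^ m \<and> (\<forall>j<m. digit M a j \<in> D j)}"

lemma finite_letters: "finite (letters M m D)"
  by (rule finite_subset[of _ "{..<M ^ m}"]) (auto simp: letters_def)

lemma card_letters: "card (letters M m D) \<le> M ^ m"
  using card_mono[of "{..<M ^ m}" "letters M m D"] by (auto simp: letters_def)

lemma track_configs: "v \<in> configs (letters M m D) \<Longrightarrow> j < m \<Longrightarrow> track M j v \<in> configs (D j)"
  by (auto simp: configs_def letters_def track_def)

lemma ex_tracks:
  assumes "\<And>j. j < m \<Longrightarrow> c j \<in> configs (D j)" "\<And>j. j < m \<Longrightarrow> D j \<subseteq> {..<M}"
  shows "\<exists>v\<in>configs (letters M m D). \<forall>j<m. track M j v = c j"
proof -
  have "\<exists>a<M ^ m. \<forall>j<m. digit M a j = c j z" for z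
    using assms by (intro ex_digits) (fastforce simp: configs_def)
  then obtain v where v: "\<And>z. v z < M ^ m" "\<And>z j. j < m \<Longrightarrow> digit M (v z) j = c j z"
    by metis
  then show ?thesis
    using assms(1) by (intro bexI[of _ v]) (auto simp: configs_def letters_def track_def)
qed

lemma ex_config_iff_ex_word:
  assumes A: "A \<subseteq> {..<L}" and n: "0 < n"
    and \<Phi>: "\<And>v v'. (\<And>z. 0 \<le> z \<Longrightarrow> z < int n \<Longrightarrow> v z = v' z) \<Longrightarrow> \<Phi> v = \<Phi> v'"
  shows "(\<exists>v\<in>configs A. \<Phi> v) \<longleftrightarrow>
    (\<exists>w<L ^ n. (\<forall>i<n. digit L w i \<in> A) \<and> \<Phi> (decode L w))"
proof
  assume "\<exists>v\<in>configs A. \<Phi> v"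
  then obtain v where v: "v \<in> configs A" "\<Phi> v" ..
  have "v (int i) < L" for i using v(1) A by (auto simp: configs_def)
  then obtain w where w: "w < L ^ n" "\<forall>i<n. digit L w i = v (int i)"
    using ex_digits[of n "\<lambda>i. v (int i)" L] by blast
  have "decode L w z = v z" if "0 \<le> z" "z < int n" for z
    using w(2)[rule_format, of "nat z"] that by (simp add: decode_def nat_less_iff)
  then have "\<Phi> (decode L w)" using v(2) \<Phi>[of "decode L w" v] by simp
  moreover have "\<forall>i<n. digit L w i \<in> A" using w(2) v(1) by (auto simp: configs_def)
  ultimately show "\<exists>w<L ^ n. (\<forall>i<n. digit L w i \<in> A) \<and> \<Phi> (decode L w)"
    using w(1) by blast
next
  assume "\<exists>w<L ^ n. (\<forall>i<n. digit L w i \<in> A) \<and> \<Phi> (decode L w)"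
  then obtain w where w: "\<forall>i<n. digit L w i \<in> A" "\<Phi> (decode L w)" by blast
  \<comment> \<open>Outside the word, \<open>decode\<close> may leave the alphabet. The first letter
    is used as padding, and \<open>0 < n\<close> guarantees that it exists.\<close>
  define v where "v z = (if 0 \<le> z \<and> z < int n then decode L w z else digit L w 0)" for z
  have "v \<in> configs A"
    using w(1) n by (auto simp: v_def configs_def decode_def nat_less_iff)
  moreover have "\<Phi> v" using w(2) \<Phi>[of v "decode L w"] by (simp add: v_def)
  ultimately show "\<exists>v\<in>configs A. \<Phi> v" by blast
qed

text \<open>Adds the integer with code \<open>e\<close> to the position \<open>i\<close> within the
  natural numbers: even codes stand for \<open>e div 2\<close>, odd ones for
  \<open>- (e div 2) - 1\<close>. Truncated subtraction is correct as long as the position has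
  enough room on its left.\<close>

definition offset :: "nat \<Rightarrow> nat \<Rightarrow> nat" where
  "offset e i = (if e mod 2 = 0 then i + e div 2 else i - e div 2 - 1)"

lemma int_encode_eq_if: "int_encode v = (if 0 \<le> v then 2 * nat v else Suc (2 * nat (- v - 1)))"
  by (simp add: int_encode_def sum_encode_def)

lemma int_offset: "\<bar>v\<bar> \<le> int i \<Longrightarrow> int (offset (int_encode v) i) = int i + v"
  by (auto simp: int_encode_eq_if offset_def)

lemma abs_le_int_encode: "\<bar>v\<bar> \<le> int (int_encode v)"
  by (auto simp: int_encode_eq_if)

lemma rec_offset:
  assumes "general_recursive n e" "general_recursive n i"
  shows "general_recursive n (\<lambda>xs. offset (e xs) (i xs))"
  unfolding offset_def by (intro rec_if rec_intros assms)

text \<open>Each letter of the word \<open>w\<close> in base \<open>L\<close> is itself a tuple in base \<open>M\<close>.\<close>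

definition matches :: "nat \<Rightarrow> nat \<Rightarrow> nat \<Rightarrow> nat \<Rightarrow> nat \<Rightarrow> nat \<Rightarrow> nat \<Rightarrow> bool" where
  "matches nb c L M w j i \<longleftrightarrow> (\<forall>k<nb. drop_code nb k \<noteq> 0 \<longrightarrow>
     nth_code c k = digit M (digit L w (offset (nth_code nb k) i)) j)"

lemma rec_matches:
  assumes "general_recursive n nb" "general_recursive n c" "general_recursive n L"
    "general_recursive n M" "general_recursive n w" "general_recursive n j" "general_recursive n i"
  shows "rec_pred n (\<lambda>xs. matches (nb xs) (c xs) (L xs) (M xs) (w xs) (j xs) (i xs))"
  unfolding matches_def
  by (intro rec_intros rec_drop_code rec_nth_code rec_digit rec_offset assms assms[THEN rec_tl])

lemma matches_iff:
  assumes "length a = length N" "\<forall>v\<in>set N. \<bar>v\<bar> \<le> int i"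
  shows "matches (list_encode (map int_encode N)) (list_encode a) L M w j i \<longleftrightarrow>
    a = map (\<lambda>v. track M j (decode L w) (int i + v)) N"
proof -
  let ?N = "list_encode (map int_encode N)"
  have "nat (int i + N ! k) = offset (int_encode (N ! k)) i" if "k < length N" for k
    using int_offset[of "N ! k" i] assms(2) that by (metis nat_int nth_mem)
  then have *: "nth_code (list_encode a) k = digit M (digit L w (offset (nth_code ?N k) i)) j \<longleftrightarrow>
      a ! k = map (\<lambda>v. track M j (decode L w) (int i + v)) N ! k" if "k < length N" for k
    using that assms(1) by (simp add: nth_code_list_encode track_def decode_def)
  have "k < ?N" if "k < length N" for k
    using that length_le_list_encode[of "map int_encode N"] by simp
  then have "matches ?N (list_encode a) L M w j i \<longleftrightarrow>
      (\<forall>k<length N. a ! k = map (\<lambda>v. track M j (decode L w) (int i + v)) N ! k)"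
    unfolding matches_def drop_code_nonzero_iff using * by auto
  also have "\<dots> \<longleftrightarrow> a = map (\<lambda>v. track M j (decode L w) (int i + v)) N"
    using assms(1) by (auto simp: list_eq_iff_nth_eq)
  finally show ?thesis .
qed

definition entry :: "nat \<Rightarrow> nat \<Rightarrow> nat" where
  "entry x k = nth_code (nth_code x 4) k"

definition rule_holds :: "nat \<Rightarrow> nat \<Rightarrow> nat \<Rightarrow> nat \<Rightarrow> nat \<Rightarrow> nat \<Rightarrow> nat \<Rightarrow> nat \<Rightarrow> bool" where
  "rule_holds x L M w j j' i q \<longleftrightarrow> (\<exists>k<x. drop_code (nth_code x 4) k \<noteq> 0 \<and>
     (matches (nth_code x 2) (fst (prod_decode (fst (prod_decode (entry x k))))) L M w j i \<and>
     matches (nth_code x 3) (snd (prod_decode (fst (prod_decode (entry x k))))) L M w j' i \<and>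
     snd (prod_decode (entry x k)) = q))"

text \<open>The symbol word of the table entry is left unmatched, so excluding entries with another
  value amounts to quantifying over all random words.\<close>

definition rule_forces :: "nat \<Rightarrow> nat \<Rightarrow> nat \<Rightarrow> nat \<Rightarrow> nat \<Rightarrow> nat \<Rightarrow> nat \<Rightarrow> bool" where
  "rule_forces x L M w j i q \<longleftrightarrow> \<not> (\<exists>k<x. drop_code (nth_code x 4) k \<noteq> 0 \<and>
     (matches (nth_code x 2) (fst (prod_decode (fst (prod_decode (entry x k))))) L M w j i \<and>
     snd (prod_decode (entry x k)) \<noteq> q))"

lemma rec_rule_holds:
  assumes "general_recursive n x" "general_recursive n L" "general_recursive n M"
    "general_recursive n w" "general_recursive n j" "general_recursive n j'"
    "general_recursive n i" "general_recursive n q"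
  shows "rec_pred n (\<lambda>xs. rule_holds (x xs) (L xs) (M xs) (w xs) (j xs) (j' xs) (i xs) (q xs))"
  unfolding rule_holds_def entry_def
  by (intro rec_intros rec_drop_code rec_nth_code rec_matches rec_fst_prod_decode
      rec_snd_prod_decode assms assms[THEN rec_tl])

lemma rec_rule_forces:
  assumes "general_recursive n x" "general_recursive n L" "general_recursive n M"
    "general_recursive n w" "general_recursive n j"
    "general_recursive n i" "general_recursive n q"
  shows "rec_pred n (\<lambda>xs. rule_forces (x xs) (L xs) (M xs) (w xs) (j xs) (i xs) (q xs))"
  unfolding rule_forces_def entry_def
  by (intro rec_intros rec_drop_code rec_nth_code rec_matches rec_fst_prod_decode
      rec_snd_prod_decode assms assms[THEN rec_tl])

lemma nth_code_code_sca:
  "nth_code (code_sca F) 0 = list_encode (sorted_list_of_set (states F))"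
  "nth_code (code_sca F) 1 = list_encode (sorted_list_of_set (symbols F))"
  "nth_code (code_sca F) 2 = list_encode (map int_encode (nbhd F))"
  "nth_code (code_sca F) 3 = list_encode (map int_encode (rnbhd F))"
  "nth_code (code_sca F) 4 = list_encode (map (\<lambda>((a, b), q).
     prod_encode (prod_encode (list_encode a, list_encode b), q)) (rule_table F))"
  unfolding code_sca_def by (subst nth_code_list_encode; simp del: list_encode.simps)+

text \<open>A list code dominates its members and its length, and this applies to both levels of
  nesting. Hence the code can stand in for every parameter of the automaton, and its positivity
  provides a positive radius.\<close>

lemma code_sca_bounds:
  assumes "wf_sca F"
  shows "a \<in> states F \<Longrightarrow> a \<le> code_sca F" "a \<in> symbols F \<Longrightarrow> a \<le> code_sca F"
    "v \<in> set (nbhd F) \<Longrightarrow> \<bar>v\<bar> \<le> int (code_sca F)"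
    "v \<in> set (rnbhd F) \<Longrightarrow> \<bar>v\<bar> \<le> int (code_sca F)"
    "length (rule_table F) \<le> code_sca F" "0 < code_sca F"
proof -
  have *: "c \<le> code_sca F" if "c = list_encode (sorted_list_of_set (states F)) \<or>
      c = list_encode (sorted_list_of_set (symbols F)) \<or> c = list_encode (map int_encode (nbhd F)) \<or>
      c = list_encode (map int_encode (rnbhd F)) \<or> c = list_encode (map (\<lambda>((a, b), q).
     prod_encode (prod_encode (list_encode a, list_encode b), q)) (rule_table F))" for c
    unfolding code_sca_def using that by (intro nth_le_list_encode) auto
  have fin: "finite (states F)" "finite (symbols F)" using assms by (auto simp: wf_sca_def)
  show "a \<le> code_sca F" if "a \<in> states F"
  proof -
    have "a \<le> list_encode (sorted_list_of_set (states F))"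
      using that fin by (intro nth_le_list_encode) auto
    also have "\<dots> \<le> code_sca F" by (rule *) blast
    finally show ?thesis .
  qed
  show "a \<le> code_sca F" if "a \<in> symbols F"
  proof -
    have "a \<le> list_encode (sorted_list_of_set (symbols F))"
      using that fin by (intro nth_le_list_encode) auto
    also have "\<dots> \<le> code_sca F" by (rule *) blast
    finally show ?thesis .
  qed
  show "\<bar>v\<bar> \<le> int (code_sca F)" if "v \<in> set (nbhd F)"
  proof -
    have "int_encode v \<le> list_encode (map int_encode (nbhd F))"
      using that by (intro nth_le_list_encode) auto
    also have "\<dots> \<le> code_sca F" by (rule *) blast
    finally show ?thesis using abs_le_int_encode[of v] by linarith
  qed
  show "\<bar>v\<bar> \<le> int (code_sca F)" if "v \<in> set (rnbhd F)"
  proof -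
    have "int_encode v \<le> list_encode (map int_encode (rnbhd F))"
      using that by (intro nth_le_list_encode) auto
    also have "\<dots> \<le> code_sca F" by (rule *) blast
    finally show ?thesis using abs_le_int_encode[of v] by linarith
  qed
  show "length (rule_table F) \<le> code_sca F"
  proof -
    have "length (rule_table F) \<le> list_encode (map (\<lambda>((a, b), q).
        prod_encode (prod_encode (list_encode a, list_encode b), q)) (rule_table F))"
      using length_le_list_encode by (metis length_map)
    also have "\<dots> \<le> code_sca F" by (rule *) blast
    finally show ?thesis .
  qed
  show "0 < code_sca F" by (simp add: code_sca_def)
qed

lemma set_rule_table:
  assumes "wf_sca F"
  shows "set (rule_table F) = {((a, b), local_rule F a b) | a b.
    a \<in> words (length (nbhd F)) (states F) \<and> b \<in> words (length (rnbhd F)) (symbols F)}"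
  using assms by (auto simp: rule_table_def set_n_lists words_def wf_sca_def)

lemma ex_entry_iff:
  assumes "wf_sca F" and x: "x = code_sca F"
  shows "(\<exists>k<x. drop_code (nth_code x 4) k \<noteq> 0 \<and> S (entry x k)) \<longleftrightarrow>
    (\<exists>a\<in>words (length (nbhd F)) (states F). \<exists>b\<in>words (length (rnbhd F)) (symbols F).
       S (prod_encode (prod_encode (list_encode a, list_encode b), local_rule F a b)))"
proof -
  have "(\<exists>k<x. drop_code (nth_code x 4) k \<noteq> 0 \<and> S (entry x k)) \<longleftrightarrow>
    (\<exists>e\<in>set (map (\<lambda>((a, b), q).
      prod_encode (prod_encode (list_encode a, list_encode b), q)) (rule_table F)). S e)"
    unfolding entry_def x nth_code_code_sca using code_sca_bounds(5)[OF assms(1)]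
    by (intro ex_index_less_code_iff) simp
  also have "\<dots> \<longleftrightarrow> (\<exists>a\<in>words (length (nbhd F)) (states F). \<exists>b\<in>words (length (rnbhd F)) (symbols F).
       S (prod_encode (prod_encode (list_encode a, list_encode b), local_rule F a b)))"
    unfolding set_map set_rule_table[OF assms(1)] by fastforce
  finally show ?thesis .
qed

lemma rule_holds_iff:
  assumes wf: "wf_sca F" and x: "x = code_sca F" "x \<le> i"
    and st: "\<And>v. v \<in> set (nbhd F) \<Longrightarrow> track M j (decode L w) (int i + v) \<in> states F"
    and sy: "\<And>v. v \<in> set (rnbhd F) \<Longrightarrow> track M j' (decode L w) (int i + v) \<in> symbols F"
  shows "rule_holds x L M w j j' i q \<longleftrightarrow>
    global F (track M j (decode L w)) (track M j' (decode L w)) (int i) = q"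
proof -
  have bd: "\<forall>v\<in>set (nbhd F). \<bar>v\<bar> \<le> int i" "\<forall>v\<in>set (rnbhd F). \<bar>v\<bar> \<le> int i"
    using code_sca_bounds(3,4)[OF wf] x by fastforce+
  have w: "map (\<lambda>v. track M j (decode L w) (int i + v)) (nbhd F) \<in> words (length (nbhd F)) (states F)"
    "map (\<lambda>v. track M j' (decode L w) (int i + v)) (rnbhd F) \<in> words (length (rnbhd F)) (symbols F)"
    using st sy by (auto simp: words_def)
  show ?thesis
    unfolding rule_holds_def
    apply (subst ex_entry_iff[OF wf x(1)])
    unfolding x(1) nth_code_code_sca prod_encode_inverse fst_conv snd_conv global_def
    using w by (auto simp: matches_iff bd words_def[of "length _"])
qed

lemma rule_forces_iff:
  assumes wf: "wf_sca F" and x: "x = code_sca F" "x \<le> i"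
    and st: "\<And>v. v \<in> set (nbhd F) \<Longrightarrow> track M j (decode L w) (int i + v) \<in> states F"
  shows "rule_forces x L M w j i q \<longleftrightarrow>
    (\<forall>b\<in>words (length (rnbhd F)) (symbols F).
       local_rule F (map (\<lambda>v. track M j (decode L w) (int i + v)) (nbhd F)) b = q)"
proof -
  have bd: "\<forall>v\<in>set (nbhd F). \<bar>v\<bar> \<le> int i"
    using code_sca_bounds(3)[OF wf] x by fastforce
  have w: "map (\<lambda>v. track M j (decode L w) (int i + v)) (nbhd F) \<in> words (length (nbhd F)) (states F)"
    using st by (auto simp: words_def)
  show ?thesis
    unfolding rule_forces_def
    apply (subst ex_entry_iff[OF wf x(1)])
    unfolding x(1) nth_code_code_sca prod_encode_inverse fst_conv snd_conv
    using w by (auto simp: matches_iff bd words_def[of "length (nbhd F)"])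
qed

section \<open>Bounded search for words\<close>

lemma ball_atLeastLessThan_int_iff:
  "(\<forall>z\<in>{int R..<int R + int n}. S z) \<longleftrightarrow> (\<forall>i<n. S (int (R + i)))"
proof safe
  fix z
  assume *: "\<forall>i<n. S (int (R + i))" "z \<in> {int R..<int R + int n}"
  then have "int (R + nat (z - int R)) = z" "nat (z - int R) < n" by auto
  then show "S z" using *(1) by metis
qed auto

definition solvable ::
  "'a set \<Rightarrow> 'b set \<Rightarrow> ((int \<Rightarrow> 'a) \<Rightarrow> int \<Rightarrow> bool) \<Rightarrow> ((int \<Rightarrow> 'a) \<Rightarrow> (int \<Rightarrow> 'b) \<Rightarrow> int \<Rightarrow> bool) \<Rightarrow>
   int \<Rightarrow> bool" where
  "solvable A H P Q b \<longleftrightarrow> (\<forall>n :: nat. \<forall>v\<in>configs A. (\<forall>z\<in>{b..<b + int n}. P v z) \<longrightarrow>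
     (\<exists>h\<in>configs H. \<forall>z\<in>{b..<b + int n}. Q v h z))"

text \<open>By translation invariance, blocks starting at \<open>b\<close> represent blocks
  anywhere; compactness then combines the hidden solutions on growing symmetric intervals.\<close>

lemma solvable_globally:
  assumes "finite H" and P: "local_on {- int R..int R} P" and Q: "local_on2 {- int R..int R} Q"
    and "solvable A H P Q b" and v: "v \<in> configs A" "\<And>z. P v z"
  shows "\<exists>h\<in>configs H. \<forall>z. Q v h z"
proof (rule solved_globally[OF assms(1) Q])
  fix n
  \<comment> \<open>The shift puts cell \<open>- int n\<close> of \<open>v\<close> at cell
    \<open>b\<close> of \<open>v'\<close>, so the symmetric interval becomes a block of length
    \<open>2 * n + 1\<close> starting at \<open>b\<close>.\<close>
  define d where "d = - b - int n"
  define v' where "v' = (\<lambda>z. v (z + d))"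
  have ag: "agree {- int R..int R} v z v' (z - d)" for z
    by (auto simp: v'_def agree_def)
  have "P v' z" for z
    using local_onD[OF P ag[of "z + d"]] v(2)[of "z + d"] by simp
  moreover have "v' \<in> configs A" using v(1) by (simp add: v'_def configs_shift)
  ultimately obtain h' where h': "h' \<in> configs H"
    "\<And>z. z \<in> {b..<b + int (2 * n + 1)} \<Longrightarrow> Q v' h' z"
    using assms(4) unfolding solvable_def by blast
  define h where "h = (\<lambda>z. h' (z - d))"
  have "Q v h z" if "z \<in> {- int n..int n}" for z
  proof -
    have "agree {- int R..int R} h z h' (z - d)"
      by (auto simp: h_def agree_def algebra_simps)
    then have "Q v h z = Q v' h' (z - d)" by (rule local_on2D[OF Q ag])
    then show ?thesis using h'(2)[of "z - d"] that by (auto simp: d_def)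
  qed
  moreover have "h \<in> configs H" using configs_shift[OF h'(1), of "- d"] by (simp add: h_def)
  ultimately show "\<exists>h\<in>configs H. \<forall>z\<in>{- int n..int n}. Q v h z" by blast
qed

text \<open>The \<open>n\<close> checked cells are surrounded by margins of \<open>R\<close> cells,
  which contain all that local conditions read. Starting at cell \<open>R\<close> keeps every cell
  read nonnegative, as decoding requires. The arithmetic predicates \<open>p\<close> and
  \<open>q\<close> have to be right only on words over the proper alphabets.\<close>

lemma solvable_iff_words:
  fixes A H :: "nat set" and R :: nat
  assumes A: "A \<subseteq> {..<L}" and H: "H \<subseteq> {..<L'}" and R: "0 < R"
    and B: "L ^ (2 * R) * 2 ^ (L' ^ (2 * R)) \<le> B"
    and P: "local_on {- int R..int R} P" and Q: "local_on2 {- int R..int R} Q"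
    and p: "\<And>w i. R \<le> i \<Longrightarrow> \<forall>k\<in>{i - R..i + R}. digit L w k \<in> A \<Longrightarrow> p w i \<longleftrightarrow> P (decode L w) (int i)"
    and q: "\<And>w h i. R \<le> i \<Longrightarrow> \<forall>k\<in>{i - R..i + R}. digit L w k \<in> A \<Longrightarrow>
      \<forall>k\<in>{i - R..i + R}. digit L' h k \<in> H \<Longrightarrow> q w h i \<longleftrightarrow> Q (decode L w) (decode L' h) (int i)"
  shows "solvable A H P Q (int R) \<longleftrightarrow>
    \<not> (\<exists>n<B. \<exists>w<L ^ (n + 2 * R). (\<forall>i<n + 2 * R. digit L w i \<in> A) \<and> (\<forall>i<n. p w (R + i)) \<and>
      \<not> (\<exists>h<L' ^ (n + 2 * R). (\<forall>i<n + 2 * R. digit L' h i \<in> H) \<and> (\<forall>i<n. q w h (R + i))))"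
proof -
  have fin: "finite A" "finite H" using A H finite_subset by blast+
  have "card A \<le> L" "card H \<le> L'" using card_mono[OF _ A] card_mono[OF _ H] by auto
  then have "card A ^ (2 * R) * 2 ^ (card H ^ (2 * R)) \<le> L ^ (2 * R) * 2 ^ (L' ^ (2 * R))"
    by (intro mult_le_mono power_mono power_increasing) auto
  then have B: "card A ^ (2 * R) * 2 ^ (card H ^ (2 * R)) \<le> B" using B by linarith
  let ?U = "\<lambda>n v. (\<forall>z\<in>{int R..<int R + int n}. P v z) \<and>
    \<not> (\<exists>h\<in>configs H. \<forall>z\<in>{int R..<int R + int n}. Q v h z)"
  have "\<not> solvable A H P Q (int R) \<longleftrightarrow> (\<exists>n. \<exists>v\<in>configs A. ?U n v)"
    unfolding solvable_def by blast
  also have "\<dots> \<longleftrightarrow> (\<exists>n v. unsolved A H (\<lambda>_ _. True) (\<lambda>_ _. True) P Q (int R) n v)"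
    unfolding unsolved_def by blast
  also have "\<dots> \<longleftrightarrow> (\<exists>n<B. \<exists>v. unsolved A H (\<lambda>_ _. True) (\<lambda>_ _. True) P Q (int R) n v)"
    using unsolved_bounded[OF fin P Q _ _ _ B, of "\<lambda>_ _. True" "\<lambda>_ _. True"]
    by (auto simp: local_on_def)
  also have "\<dots> \<longleftrightarrow> (\<exists>n<B. \<exists>v\<in>configs A. ?U n v)"
    unfolding unsolved_def by blast
  also have "\<dots> \<longleftrightarrow> (\<exists>n<B. \<exists>w<L ^ (n + 2 * R). (\<forall>i<n + 2 * R. digit L w i \<in> A) \<and> ?U n (decode L w))"
  proof (rule ex_cong1, rule conj_cong, rule refl, rule ex_config_iff_ex_word[OF A])
    fix n and v v' :: "int \<Rightarrow> nat"
    assume eq: "\<And>z. 0 \<le> z \<Longrightarrow> z < int (n + 2 * R) \<Longrightarrow> v z = v' z"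
    have ag: "agree {- int R..int R} v z v' z" if "z \<in> {int R..<int R + int n}" for z
      using eq that by (auto simp: agree_def)
    have "P v z = P v' z" "Q v h z = Q v' h z" if "z \<in> {int R..<int R + int n}" for z h
      using local_onD[OF P ag[OF that]] local_on2D[OF Q ag[OF that] agree_refl] by auto
    then show "?U n v = ?U n v'" by simp
  qed (use R in auto)
  also have "\<dots> \<longleftrightarrow> (\<exists>n<B. \<exists>w<L ^ (n + 2 * R). (\<forall>i<n + 2 * R. digit L w i \<in> A) \<and> (\<forall>i<n. p w (R + i)) \<and>
      \<not> (\<exists>h<L' ^ (n + 2 * R). (\<forall>i<n + 2 * R. digit L' h i \<in> H) \<and> (\<forall>i<n. q w h (R + i))))"
  proof (intro ex_cong1 conj_cong refl)
    fix n w
    assume w: "\<forall>i<n + 2 * R. digit L w i \<in> A"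
    then have w': "\<forall>k\<in>{R + i - R..R + i + R}. digit L w k \<in> A" if "i < n" for i using that by auto
    show "(\<forall>z\<in>{int R..<int R + int n}. P (decode L w) z) \<longleftrightarrow> (\<forall>i<n. p w (R + i))"
      unfolding ball_atLeastLessThan_int_iff using p[OF _ w'] by auto
    have "(\<exists>h\<in>configs H. \<forall>z\<in>{int R..<int R + int n}. Q (decode L w) h z) \<longleftrightarrow>
      (\<exists>h<L' ^ (n + 2 * R). (\<forall>i<n + 2 * R. digit L' h i \<in> H) \<and>
         (\<forall>z\<in>{int R..<int R + int n}. Q (decode L w) (decode L' h) z))"
    proof (rule ex_config_iff_ex_word[OF H])
      fix h h' :: "int \<Rightarrow> nat"
      assume eq: "\<And>z. 0 \<le> z \<Longrightarrow> z < int (n + 2 * R) \<Longrightarrow> h z = h' z"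
      have ag: "agree {- int R..int R} h z h' z" if "z \<in> {int R..<int R + int n}" for z
        using eq that by (auto simp: agree_def)
      show "(\<forall>z\<in>{int R..<int R + int n}. Q (decode L w) h z) =
          (\<forall>z\<in>{int R..<int R + int n}. Q (decode L w) h' z)"
        using local_on2D[OF Q agree_refl ag] by auto
    qed (use R in auto)
    also have "\<dots> \<longleftrightarrow> (\<exists>h<L' ^ (n + 2 * R). (\<forall>i<n + 2 * R. digit L' h i \<in> H) \<and> (\<forall>i<n. q w h (R + i)))"
    proof (intro ex_cong1 conj_cong refl)
      fix h
      assume "\<forall>i<n + 2 * R. digit L' h i \<in> H"
      then have "\<forall>k\<in>{R + i - R..R + i + R}. digit L' h k \<in> H" if "i < n" for i using that by auto
      then show "(\<forall>z\<in>{int R..<int R + int n}. Q (decode L w) (decode L' h) z) \<longleftrightarrow>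
          (\<forall>i<n. q w h (R + i))"
        unfolding ball_atLeastLessThan_int_iff using q[OF _ w'] by auto
    qed
    finally show "(\<not> (\<exists>h\<in>configs H. \<forall>z\<in>{int R..<int R + int n}. Q (decode L w) h z)) \<longleftrightarrow>
      \<not> (\<exists>h<L' ^ (n + 2 * R). (\<forall>i<n + 2 * R. digit L' h i \<in> H) \<and> (\<forall>i<n. q w h (R + i)))"
      by simp
  qed
  finally show ?thesis by blast
qed

text \<open>The premises hold for every arity and every recursive argument because the ingredients
  are evaluated beneath bounded quantifiers, where the instance has moved from the head of the tuple
  to a deeper position.\<close>

lemma rec_solvable:
  fixes A H :: "nat \<Rightarrow> nat set" and L L' R B :: "nat \<Rightarrow> nat"
  assumes "\<And>n x. general_recursive n x \<Longrightarrow> general_recursive n (\<lambda>xs. L (x xs))"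
    and "\<And>n x. general_recursive n x \<Longrightarrow> general_recursive n (\<lambda>xs. L' (x xs))"
    and "\<And>n x. general_recursive n x \<Longrightarrow> general_recursive n (\<lambda>xs. R (x xs))"
    and "\<And>n x. general_recursive n x \<Longrightarrow> general_recursive n (\<lambda>xs. B (x xs))"
    and "\<And>n x a. general_recursive n x \<Longrightarrow> general_recursive n a \<Longrightarrow> rec_pred n (\<lambda>xs. a xs \<in> A (x xs))"
    and "\<And>n x a. general_recursive n x \<Longrightarrow> general_recursive n a \<Longrightarrow> rec_pred n (\<lambda>xs. a xs \<in> H (x xs))"
    and "\<And>n x w i. general_recursive n x \<Longrightarrow> general_recursive n w \<Longrightarrow> general_recursive n i \<Longrightarrow>
      rec_pred n (\<lambda>xs. p (x xs) (w xs) (i xs))"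
    and "\<And>n x w h i. general_recursive n x \<Longrightarrow> general_recursive n w \<Longrightarrow> general_recursive n h \<Longrightarrow>
      general_recursive n i \<Longrightarrow> rec_pred n (\<lambda>xs. q (x xs) (w xs) (h xs) (i xs))"
  shows "rec_pred (Suc 0) (\<lambda>xs. \<not> (\<exists>n<B (hd xs). \<exists>w<L (hd xs) ^ (n + 2 * R (hd xs)).
      (\<forall>i<n + 2 * R (hd xs). digit (L (hd xs)) w i \<in> A (hd xs)) \<and> (\<forall>i<n. p (hd xs) w (R (hd xs) + i)) \<and>
      \<not> (\<exists>h<L' (hd xs) ^ (n + 2 * R (hd xs)). (\<forall>i<n + 2 * R (hd xs). digit (L' (hd xs)) h i \<in> H (hd xs)) \<and>
        (\<forall>i<n. q (hd xs) w h (R (hd xs) + i)))))"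
  by (intro rec_intros rec_digit assms)

lemma decidableI:
  assumes "rec_pred (Suc 0) (\<lambda>xs. S (hd xs))" "\<And>a. a \<in> I \<Longrightarrow> S (code a) \<longleftrightarrow> T a"
  shows "decidable code I T"
  unfolding decidable_def
  by (rule exI[of _ "\<lambda>xs. of_bool (S (hd xs))"]) (use assms in \<open>simp add: rec_pred_def\<close>)

lemma decidable_cong:
  "decidable code I S \<Longrightarrow> (\<And>a. a \<in> I \<Longrightarrow> T a \<longleftrightarrow> S a) \<Longrightarrow> decidable code I T"
  unfolding decidable_def by auto

section \<open>Alphabets and local rules recovered from the code\<close>

definition states_of :: "nat \<Rightarrow> nat set" where
  "states_of x = {a. mem_code (nth_code x 0) a}"

definition symbols_of :: "nat \<Rightarrow> nat set" where
  "symbols_of x = {a. mem_code (nth_code x 1) a}"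

lemma states_of_code_sca: "wf_sca F \<Longrightarrow> states_of (code_sca F) = states F"
  by (simp add: states_of_def nth_code_code_sca mem_code_list_encode wf_sca_def)

lemma symbols_of_code_sca: "wf_sca F \<Longrightarrow> symbols_of (code_sca F) = symbols F"
  by (simp add: symbols_of_def nth_code_code_sca mem_code_list_encode wf_sca_def del: One_nat_def)

lemma rec_states_of:
  "general_recursive n x \<Longrightarrow> general_recursive n a \<Longrightarrow> rec_pred n (\<lambda>xs. a xs \<in> states_of (x xs))"
  unfolding states_of_def mem_Collect_eq by (intro rec_mem_code rec_nth_code rec_intros)

lemma rec_symbols_of:
  "general_recursive n x \<Longrightarrow> general_recursive n a \<Longrightarrow> rec_pred n (\<lambda>xs. a xs \<in> symbols_of (x xs))"
  unfolding symbols_of_def mem_Collect_eq by (intro rec_mem_code rec_nth_code rec_intros)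

lemma rec_letters:
  assumes D: "\<And>n x j a. general_recursive n x \<Longrightarrow> general_recursive n j \<Longrightarrow> general_recursive n a \<Longrightarrow>
      rec_pred n (\<lambda>xs. a xs \<in> D (x xs) (j xs))"
    and "general_recursive n M" "general_recursive n x" "general_recursive n a"
  shows "rec_pred n (\<lambda>xs. a xs \<in> letters (M xs) m (D (x xs)))"
  unfolding letters_def mem_Collect_eq
  by (intro rec_intros D rec_digit assms(2-4) assms(2-4)[THEN rec_tl])

lemma letters_subset: "letters M m D \<subseteq> {..<M ^ m}"
  by (auto simp: letters_def)

lemma track_agree:
  assumes "agree K v z v' z'" "0 \<in> K"
  shows "track M j v z = track M j v' z'"
  using assms by (auto simp: agree_def track_def dest: bspec[of _ _ 0])

lemma track_agree_next:
  assumes "agree K v z v' z'" "1 \<in> K"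
  shows "track M j v (z + 1) = track M j v' (z' + 1)"
  using assms by (auto simp: agree_def track_def dest: bspec[of _ _ 1])

lemma global_agree:
  assumes "agree K v z v' z'" "set (nbhd F) \<subseteq> K" "set (rnbhd F) \<subseteq> K"
  shows "global F (track M i v) (track M j v) z = global F (track M i v') (track M j v') z'"
  using assms unfolding global_def agree_def track_def
  by (intro arg_cong2[of _ _ _ _ "local_rule F"] map_cong) (auto simp: subset_iff)

lemma nbhd_subset:
  assumes "wf_sca F" "code_sca F \<le> R"
  shows "set (nbhd F) \<subseteq> {- int R..int R}" "set (rnbhd F) \<subseteq> {- int R..int R}"
  using code_sca_bounds(3,4)[OF assms(1)] assms(2) by fastforce+

lemma track_digit: "track M j (decode L w) (int i) = digit M (digit L w i) j"
  by (simp add: track_def decode_def)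

lemma global_in_statesI:
  assumes "wf_sca F" "\<And>v. v \<in> set (nbhd F) \<Longrightarrow> c (z + v) \<in> states F"
    "\<And>v. v \<in> set (rnbhd F) \<Longrightarrow> s (z + v) \<in> symbols F"
  shows "global F c s z \<in> states F"
  using assms unfolding global_def wf_sca_def words_def by (simp add: image_subset_iff)

lemma global_in_states:
  assumes "wf_sca F" "c \<in> configs (states F)" "s \<in> configs (symbols F)"
  shows "global F c s \<in> configs (states F)"
  using global_in_statesI[OF assms(1)] assms(2,3) by (simp add: configs_def)

lemma track_decode_in:
  assumes "R \<le> i" "\<bar>v\<bar> \<le> int R" "l < m"
    and "\<And>k. k \<in> {i - R..i + R} \<Longrightarrow> digit L w k \<in> letters M m D"
  shows "track M l (decode L w) (int i + v) \<in> D l"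
proof -
  have "nat (int i + v) \<in> {i - R..i + R}" using assms(1,2) by auto
  from assms(4)[OF this] show ?thesis using assms(3) by (simp add: track_def decode_def letters_def)
qed

lemma rule_letters:
  assumes wf: "wf_sca F" and x: "code_sca F \<le> i" and jm: "j < m" "j' < m"
    and D: "D j \<subseteq> states F" "D j' \<subseteq> symbols F"
    and w: "\<And>k. k \<in> {i - code_sca F..i + code_sca F} \<Longrightarrow> digit L w k \<in> letters M m D"
  shows rule_holds_letters_iff: "rule_holds (code_sca F) L M w j j' i q \<longleftrightarrow>
      global F (track M j (decode L w)) (track M j' (decode L w)) (int i) = q"
    and global_letters: "global F (track M j (decode L w)) (track M j' (decode L w)) (int i) \<in> states F"
proof -
  have *: "track M j (decode L w) (int i + v) \<in> states F" if "v \<in> set (nbhd F)" for v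
    using track_decode_in[OF x code_sca_bounds(3)[OF wf that] jm(1) w] D by blast
  have **: "track M j' (decode L w) (int i + v) \<in> symbols F" if "v \<in> set (rnbhd F)" for v
    using track_decode_in[OF x code_sca_bounds(4)[OF wf that] jm(2) w] D by blast
  show "rule_holds (code_sca F) L M w j j' i q \<longleftrightarrow>
      global F (track M j (decode L w)) (track M j' (decode L w)) (int i) = q"
    using x by (intro rule_holds_iff[OF wf refl] * **) auto
  show "global F (track M j (decode L w)) (track M j' (decode L w)) (int i) \<in> states F"
    using * ** by (rule global_in_statesI[OF wf])
qed

lemma words_exist_iff:
  assumes A: "A \<subseteq> {..<L}" and "\<And>n. 0 < len n"
    and \<phi>: "\<And>n v v'. (\<And>z. 0 \<le> z \<Longrightarrow> z < int (len n) \<Longrightarrow> v z = v' z) \<Longrightarrow> \<phi> n v = \<phi> n v'"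
    and \<psi>: "\<And>n w. \<forall>i<len n. digit L w i \<in> A \<Longrightarrow> \<psi> n w \<longleftrightarrow> \<phi> n (decode L w)"
  shows "(\<exists>n<B. \<exists>v\<in>configs A. \<phi> n v) \<longleftrightarrow>
    (\<exists>n<B. \<exists>w<L ^ len n. (\<forall>i<len n. digit L w i \<in> A) \<and> \<psi> n w)"
proof -
  have "(\<exists>v\<in>configs A. \<phi> n v) \<longleftrightarrow> (\<exists>w<L ^ len n. (\<forall>i<len n. digit L w i \<in> A) \<and> \<phi> n (decode L w))" for n
    by (rule ex_config_iff_ex_word[OF A assms(2) \<phi>])
  then show ?thesis using \<psi> by (simp cong: conj_cong)
qed

lemma rec_mem_if:
  assumes "rec_pred n P" "rec_pred n (\<lambda>xs. a xs \<in> S xs)" "rec_pred n (\<lambda>xs. a xs \<in> T xs)"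
  shows "rec_pred n (\<lambda>xs. a xs \<in> (if P xs then S xs else T xs))"
  by (rule rec_pred_cong[OF rec_pred_conj[OF rec_pred_imp[OF assms(1,2)]
        rec_pred_disj[OF assms(1,3)]]]) auto

text \<open>An upper bound on the number of profiles, for alphabets of at most \<open>L\<close> visible and \<open>L'\<close>
  hidden letters.\<close>

definition search_bound :: "nat \<Rightarrow> nat \<Rightarrow> nat \<Rightarrow> nat" where
  "search_bound L L' R = L ^ (2 * R) * 2 ^ (L' ^ (2 * R))"

lemma rec_search_bound:
  assumes "general_recursive n L" "general_recursive n L'" "general_recursive n R"
  shows "general_recursive n (\<lambda>xs. search_bound (L xs) (L' xs) (R xs))"
  unfolding search_bound_def by (intro rec_intros assms)

section \<open>Noisiness and surjectivity\<close>

text \<open>One flag covers two problems: noisiness prescribes the preimage, surjectivity only asks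
  for one. In both cases the preimage is searched for as a hidden track.\<close>

definition reaches_all :: "bool \<Rightarrow> ('q, 'r) sca \<Rightarrow> bool" where
  "reaches_all e F \<longleftrightarrow> (\<forall>c\<in>configs (states F). \<forall>d\<in>configs (states F).
     \<exists>c'\<in>configs (states F). \<exists>s\<in>configs (symbols F). (e \<longrightarrow> c' = c) \<and> global F c' s = d)"

lemma noisy_iff_reaches_all:
  assumes "wf_sca F"
  shows "noisy F \<longleftrightarrow> reaches_all True F"
proof -
  have "nondet F c \<subseteq> configs (states F)" if "c \<in> configs (states F)" for c
    using global_in_states[OF assms that] by (auto simp: nondet_def)
  then have "noisy F \<longleftrightarrow> (\<forall>c\<in>configs (states F). configs (states F) \<subseteq> nondet F c)"
    unfolding noisy_def by auto
  moreover have "configs (states F) \<subseteq> nondet F c \<longleftrightarrow>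
      (\<forall>d\<in>configs (states F). \<exists>s\<in>configs (symbols F). global F c s = d)" for c
    unfolding nondet_def by fastforce
  ultimately show ?thesis unfolding reaches_all_def by auto
qed

lemma sca_surjective_iff_reaches_all: "sca_surjective F \<longleftrightarrow> reaches_all False F"
  unfolding sca_surjective_def reaches_all_def by auto

text \<open>Depending on parity alone, the same family serves one configuration with its symbols
  (two tracks) and two of them (four tracks).\<close>

definition rule_alphabets :: "'a set \<Rightarrow> 'a set \<Rightarrow> nat \<Rightarrow> 'a set" where
  "rule_alphabets S T j = (if j mod 2 = 0 then S else T)"

lemma rule_alphabets_simps:
  "rule_alphabets S T 0 = S" "rule_alphabets S T (Suc 0) = T"
  "rule_alphabets S T 1 = T" "rule_alphabets S T 2 = S" "rule_alphabets S T 3 = T"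
  by (simp_all add: rule_alphabets_def)

definition letters_of_rule :: "nat \<Rightarrow> nat \<Rightarrow> nat set" where
  "letters_of_rule x = rule_alphabets (states_of x) (symbols_of x)"

lemma letters_of_rule_code_sca:
  "wf_sca F \<Longrightarrow> letters_of_rule (code_sca F) = rule_alphabets (states F) (symbols F)"
  by (simp add: letters_of_rule_def states_of_code_sca symbols_of_code_sca)

lemma rec_letters_of_rule:
  "general_recursive n x \<Longrightarrow> general_recursive n j \<Longrightarrow> general_recursive n a \<Longrightarrow>
    rec_pred n (\<lambda>xs. a xs \<in> letters_of_rule (x xs) (j xs))"
  unfolding letters_of_rule_def rule_alphabets_def
  by (intro rec_mem_if rec_states_of rec_symbols_of rec_intros)

definition outputs :: "bool \<Rightarrow> (nat, nat) sca \<Rightarrow> nat \<Rightarrow> (int \<Rightarrow> nat) \<Rightarrow> (int \<Rightarrow> nat) \<Rightarrow> int \<Rightarrow> bool" where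
  "outputs e F M v h z \<longleftrightarrow> global F (track M 0 h) (track M 1 h) z = track M 1 v z \<and>
     (e \<longrightarrow> track M 0 h z = track M 0 v z)"

lemma local_outputs:
  assumes "wf_sca F" "code_sca F \<le> R"
  shows "local_on2 {- int R..int R} (outputs e F M)"
  unfolding local_on2_def
proof (intro allI impI)
  fix v h v' h' :: "int \<Rightarrow> nat" and z z' :: int
  assume ag: "agree {- int R..int R} v z v' z'" "agree {- int R..int R} h z h' z'"
  have "track M j v z = track M j v' z'" "track M j h z = track M j h' z'" for j
    using ag by (auto intro: track_agree)
  then show "outputs e F M v h z = outputs e F M v' h' z'"
    unfolding outputs_def using global_agree[OF ag(2) nbhd_subset[OF assms]] by simp
qed

text \<open>The prescribed input and output are visible, the preimage and its random symbols hidden.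
  The visible part is unconstrained, so each block comes from a genuine instance; the converse is
  compactness of the hidden part.\<close>

lemma reaches_all_iff_solvable:
  assumes wf: "wf_sca F" and M: "states F \<subseteq> {..<M}" "symbols F \<subseteq> {..<M}"
  shows "reaches_all e F \<longleftrightarrow> solvable (letters M 2 (\<lambda>_. states F))
    (letters M 2 (rule_alphabets (states F) (symbols F))) (\<lambda>_ _. True) (outputs e F M) b"
    (is "_ \<longleftrightarrow> solvable ?A ?H _ _ _")
proof
  assume F: "reaches_all e F"
  show "solvable ?A ?H (\<lambda>_ _. True) (outputs e F M) b"
    unfolding solvable_def
  proof (intro allI ballI impI)
    fix n v
    assume "v \<in> configs ?A"
    then have "track M 0 v \<in> configs (states F)" "track M 1 v \<in> configs (states F)"
      using track_configs[of v M 2] by fastforce+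
    then obtain c s where c: "c \<in> configs (states F)" "s \<in> configs (symbols F)"
      "e \<longrightarrow> c = track M 0 v" "global F c s = track M 1 v"
      using F unfolding reaches_all_def by blast
    let ?c = "\<lambda>j :: nat. if j = 0 then c else s"
    have "?c j \<in> configs (rule_alphabets (states F) (symbols F) j)"
      "rule_alphabets (states F) (symbols F) j \<subseteq> {..<M}" if "j < 2" for j
      using that c(1,2) M by (auto simp: less_2_cases_iff rule_alphabets_simps)
    from ex_tracks[of 2 ?c, OF this]
    obtain h where "h \<in> configs ?H" "\<forall>j<2. track M j h = ?c j" by blast
    then show "\<exists>h\<in>configs ?H. \<forall>z\<in>{b..<b + int n}. outputs e F M v h z"
      using c(3,4) by (intro bexI[of _ h]) (auto simp: outputs_def)
  qed
next
  assume solv: "solvable ?A ?H (\<lambda>_ _. True) (outputs e F M) b"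
  show "reaches_all e F"
    unfolding reaches_all_def
  proof (intro ballI)
    fix c d
    assume c: "c \<in> configs (states F)" "d \<in> configs (states F)"
    have "\<exists>v\<in>configs ?A. \<forall>j<2. track M j v = (if j = 0 then c else d)"
      using c M by (intro ex_tracks) auto
    then obtain v where v: "v \<in> configs ?A" "\<And>j. j < 2 \<Longrightarrow> track M j v = (if j = 0 then c else d)"
      by blast
    have "\<exists>h\<in>configs ?H. \<forall>z. outputs e F M v h z"
      using solvable_globally[OF finite_letters _ local_outputs[OF wf order_refl] solv v(1)]
      by (simp add: local_on_def)
    then obtain h where h: "h \<in> configs ?H" "\<And>z. outputs e F M v h z" by blast
    show "\<exists>c'\<in>configs (states F). \<exists>s\<in>configs (symbols F). (e \<longrightarrow> c' = c) \<and> global F c' s = d"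
      using h(2) v(2)[of 0] v(2)[of 1] track_configs[OF h(1), of 0] track_configs[OF h(1), of 1]
      by (intro bexI[of _ "track M 0 h"] bexI[of _ "track M 1 h"])
        (auto simp: outputs_def rule_alphabets_simps simp del: One_nat_def)
  qed
qed

definition outputs_word :: "bool \<Rightarrow> nat \<Rightarrow> nat \<Rightarrow> nat \<Rightarrow> nat \<Rightarrow> bool" where
  "outputs_word e x w h i \<longleftrightarrow>
     rule_holds x (Suc x ^ 2) (Suc x) h 0 1 i (digit (Suc x) (digit (Suc x ^ 2) w i) 1) \<and>
     (e \<longrightarrow> digit (Suc x) (digit (Suc x ^ 2) h i) 0 = digit (Suc x) (digit (Suc x ^ 2) w i) 0)"

lemma rec_outputs_word:
  assumes "general_recursive n x" "general_recursive n w" "general_recursive n h" "general_recursive n i"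
  shows "rec_pred n (\<lambda>xs. outputs_word e (x xs) (w xs) (h xs) (i xs))"
  unfolding outputs_word_def by (intro rec_intros rec_rule_holds rec_digit assms)

lemma code_alphabets:
  assumes "wf_sca F" "code_sca F \<le> n"
  shows "states F \<subseteq> {..<Suc n}" "symbols F \<subseteq> {..<Suc n}"
  using code_sca_bounds(1,2)[OF assms(1)] assms(2) by fastforce+

lemma decidable_reaches_all: "decidable code_sca SCA (reaches_all e)"
proof (rule decidableI[OF rec_solvable])
  fix F
  assume "F \<in> SCA"
  then have wf: "wf_sca F" by (simp add: SCA_def)
  let ?x = "code_sca F"
  let ?L = "Suc ?x ^ 2" and ?H = "letters (Suc ?x) 2 (letters_of_rule ?x)"
  have q: "outputs_word e ?x w h i \<longleftrightarrow> outputs e F (Suc ?x) (decode ?L w) (decode ?L h) (int i)"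
    if "?x \<le> i" "\<forall>k\<in>{i - ?x..i + ?x}. digit ?L h k \<in> ?H" for w h i
    unfolding outputs_word_def outputs_def track_digit
    using that letters_of_rule_code_sca[OF wf]
    by (subst rule_holds_letters_iff[OF wf that(1), of 0 2 1
          "letters_of_rule ?x"])
      (auto simp: rule_alphabets_simps)
  show "(\<not> (\<exists>n<search_bound ?L ?L ?x. \<exists>w<?L ^ (n + 2 * ?x).
      (\<forall>i<n + 2 * ?x. digit ?L w i \<in> letters (Suc ?x) 2 (\<lambda>_. states_of ?x)) \<and> (\<forall>i<n. True) \<and>
      \<not> (\<exists>h<?L ^ (n + 2 * ?x). (\<forall>i<n + 2 * ?x. digit ?L h i \<in> ?H) \<and>
        (\<forall>i<n. outputs_word e ?x w h (?x + i))))) \<longleftrightarrow> reaches_all e F"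
    unfolding reaches_all_iff_solvable[OF wf code_alphabets[OF wf order_refl], of e "int ?x"]
    by (subst solvable_iff_words[OF letters_subset letters_subset code_sca_bounds(6)[OF wf]
          _ _ local_outputs[OF wf order_refl] _ q, of _ "\<lambda>_ _. True"])
      (auto simp: search_bound_def local_on_def states_of_code_sca[OF wf] letters_of_rule_code_sca[OF wf])
qed (assumption | intro rec_intros rec_search_bound rec_letters[where D = "\<lambda>x _. states_of x"]
    rec_letters[where D = letters_of_rule] rec_letters_of_rule rec_states_of rec_outputs_word)+

section \<open>Equality of iterates\<close>

lemma in_nondet_iter_iff:
  "d \<in> nondet_iter F t c \<longleftrightarrow> (\<exists>C S. C 0 = c \<and> C t = d \<and>
     (\<forall>l<t. S l \<in> configs (symbols F) \<and> C (Suc l) = global F (C l) (S l)))"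
proof (induction t arbitrary: d)
  case 0
  show ?case by auto
next
  case (Suc t)
  show ?case
  proof
    assume "d \<in> nondet_iter F (Suc t) c"
    then obtain c' s where "c' \<in> nondet_iter F t c" and s: "s \<in> configs (symbols F)" "d = global F c' s"
      by (auto simp: nondet_def)
    then obtain C S where C: "C 0 = c" "C t = c'"
      "\<forall>l<t. S l \<in> configs (symbols F) \<and> C (Suc l) = global F (C l) (S l)"
      unfolding Suc.IH by blast
    with s show "\<exists>C S. C 0 = c \<and> C (Suc t) = d \<and>
       (\<forall>l<Suc t. S l \<in> configs (symbols F) \<and> C (Suc l) = global F (C l) (S l))"
      by (intro exI[of _ "C(Suc t := d)"] exI[of _ "S(t := s)"]) (auto simp: less_Suc_eq)
  next
    assume "\<exists>C S. C 0 = c \<and> C (Suc t) = d \<and>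
       (\<forall>l<Suc t. S l \<in> configs (symbols F) \<and> C (Suc l) = global F (C l) (S l))"
    then obtain C S where C: "C 0 = c" "C (Suc t) = d"
      "\<forall>l<Suc t. S l \<in> configs (symbols F) \<and> C (Suc l) = global F (C l) (S l)" by blast
    then have "C t \<in> nondet_iter F t c"
      unfolding Suc.IH by (intro exI[of _ C] exI[of _ S]) auto
    moreover have "d \<in> nondet F (C t)" using C(2,3) by (auto simp: nondet_def)
    ultimately show "d \<in> nondet_iter F (Suc t) c" by auto
  qed
qed

text \<open>Track \<open>l \<le> t\<close> holds the configuration at time \<open>l\<close>, track \<open>t + 1 + l\<close> the random symbols used
  at time \<open>l\<close>. The trace is checked on a cone above \<open>z\<close>, so that a locally checked trace agrees at
  \<open>z\<close> with the true evolution of its initial configuration.\<close>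

definition trace ::
  "(nat, nat) sca \<Rightarrow> nat \<Rightarrow> nat \<Rightarrow> nat \<Rightarrow> (int \<Rightarrow> nat) \<Rightarrow> int \<Rightarrow> bool" where
  "trace F t M r v z \<longleftrightarrow> (\<forall>l<t. \<forall>k. \<bar>k\<bar> \<le> int ((t - 1 - l) * r) \<longrightarrow>
     global F (track M l v) (track M (t + 1 + l) v) (z + k) = track M (Suc l) v (z + k))"

definition trace_alphabets :: "nat \<Rightarrow> 'a set \<Rightarrow> 'a set \<Rightarrow> nat \<Rightarrow> 'a set" where
  "trace_alphabets t S T j = (if j \<le> t then S else T)"

text \<open>The cone narrows by one neighbourhood radius per time step; truncated subtraction makes
  \<open>l < t\<close> essential.\<close>

lemma cone_radius: "l < t \<Longrightarrow> (t - 1 - l) * r + r = (t - l) * (r :: nat)"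
  by (simp add: Suc_diff_Suc flip: mult_Suc add.commute[of r])

lemma local_trace:
  assumes "wf_sca F" "code_sca F \<le> r"
  shows "local_on {- int (t * r)..int (t * r)} (trace F t M r)"
  unfolding local_on_def
proof (intro allI impI)
  fix v v' :: "int \<Rightarrow> nat" and z z' :: int
  assume ag: "agree {- int (t * r)..int (t * r)} v z v' z'"
  have "global F (track M l v) (track M (t + 1 + l) v) (z + k) =
      global F (track M l v') (track M (t + 1 + l) v') (z' + k)"
    "track M (Suc l) v (z + k) = track M (Suc l) v' (z' + k)"
    if "l < t" "\<bar>k\<bar> \<le> int ((t - 1 - l) * r)" for l k
  proof -
    have "(t - 1 - l) * r + r \<le> t * r"
      unfolding cone_radius[OF that(1)] by (rule mult_le_mono1) simp
    then have le: "int ((t - 1 - l) * r) + int r \<le> int (t * r)" by linarith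
    have ag': "agree {- int r..int r} v (z + k) v' (z' + k)"
      unfolding agree_def
    proof
      fix i assume "i \<in> {- int r..int r}"
      then have "k + i \<in> {- int (t * r)..int (t * r)}" using that(2) le by auto
      then show "v (z + k + i) = v' (z' + k + i)"
        using ag unfolding agree_def by (metis add.assoc)
    qed
    then show "global F (track M l v) (track M (t + 1 + l) v) (z + k) =
        global F (track M l v') (track M (t + 1 + l) v') (z' + k)"
      by (rule global_agree) (use nbhd_subset[OF assms] in auto)
    show "track M (Suc l) v (z + k) = track M (Suc l) v' (z' + k)"
      using ag' by (rule track_agree) auto
  qed
  then show "trace F t M r v z = trace F t M r v' z'"
    unfolding trace_def by (intro all_cong1 imp_cong refl) auto
qed

text \<open>When the check is made at all cells, the offset \<open>k = 0\<close> already gives the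
  full condition; the cone matters on finite blocks only.\<close>

lemma trace_everywhere_iff:
  "(\<forall>z. trace F t M r v z) \<longleftrightarrow>
    (\<forall>l<t. global F (track M l v) (track M (t + 1 + l) v) = track M (Suc l) v)"
proof
  assume *: "\<forall>z. trace F t M r v z"
  show "\<forall>l<t. global F (track M l v) (track M (t + 1 + l) v) = track M (Suc l) v"
  proof (intro allI impI)
    fix l assume "l < t"
    then have "global F (track M l v) (track M (t + 1 + l) v) z = track M (Suc l) v z" for z
      using *[unfolded trace_def, rule_format, of l 0 z] by simp
    then show "global F (track M l v) (track M (t + 1 + l) v) = track M (Suc l) v"
      by (rule HOL.ext)
  qed
qed (auto simp: trace_def)

lemma in_nondet_iter_iff_trace:
  assumes wf: "wf_sca F" and M: "states F \<subseteq> {..<M}" "symbols F \<subseteq> {..<M}"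
    and c: "c \<in> configs (states F)"
  shows "d \<in> nondet_iter F t c \<longleftrightarrow>
    (\<exists>v\<in>configs (letters M (2 * t + 1) (trace_alphabets t (states F) (symbols F))).
      (\<forall>z. trace F t M r v z) \<and> track M 0 v = c \<and> track M t v = d)"
    (is "_ \<longleftrightarrow> (\<exists>v\<in>configs ?A. _)")
proof
  assume "d \<in> nondet_iter F t c"
  then obtain C S where C: "C 0 = c" "C t = d"
    "\<And>l. l < t \<Longrightarrow> S l \<in> configs (symbols F)" "\<And>l. l < t \<Longrightarrow> C (Suc l) = global F (C l) (S l)"
    unfolding in_nondet_iter_iff by blast
  have st: "C l \<in> configs (states F)" if "l \<le> t" for l
    using that
  proof (induction l)
    case 0
    then show ?case using c C(1) by simp
  next
    case (Suc l)
    then show ?case using C(3,4)[of l] global_in_states[OF wf] by simp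
  qed
  let ?c = "\<lambda>j. if j \<le> t then C j else S (j - t - 1)"
  have "?c j \<in> configs (trace_alphabets t (states F) (symbols F) j)"
    "trace_alphabets t (states F) (symbols F) j \<subseteq> {..<M}" if "j < 2 * t + 1" for j
    using that st C(3) M by (auto simp: trace_alphabets_def)
  from ex_tracks[of "2 * t + 1" ?c, OF this]
  obtain v where v: "v \<in> configs ?A" "\<And>j. j < 2 * t + 1 \<Longrightarrow> track M j v = ?c j" by blast
  have "track M l v = C l" if "l \<le> t" for l using v(2)[of l] that by simp
  moreover have "track M (t + 1 + l) v = S l" if "l < t" for l
    using v(2)[of "t + 1 + l"] that by simp
  ultimately show "\<exists>v\<in>configs ?A. (\<forall>z. trace F t M r v z) \<and> track M 0 v = c \<and> track M t v = d"
    unfolding trace_everywhere_iff using v(1) C by (intro bexI[of _ v]) auto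
next
  assume "\<exists>v\<in>configs ?A. (\<forall>z. trace F t M r v z) \<and> track M 0 v = c \<and> track M t v = d"
  then obtain v where v: "v \<in> configs ?A" "track M 0 v = c" "track M t v = d"
    "\<forall>l<t. global F (track M l v) (track M (t + 1 + l) v) = track M (Suc l) v"
    unfolding trace_everywhere_iff by blast
  have "track M (t + 1 + l) v \<in> configs (symbols F)" if "l < t" for l
    using track_configs[OF v(1), of "t + 1 + l"] that by (simp add: trace_alphabets_def)
  with v show "d \<in> nondet_iter F t c"
    unfolding in_nondet_iter_iff
    by (intro exI[of _ "\<lambda>l. track M l v"] exI[of _ "\<lambda>l. track M (t + 1 + l) v"]) auto
qed

definition trace_between ::
  "(nat, nat) sca \<Rightarrow> nat \<Rightarrow> nat \<Rightarrow> nat \<Rightarrow> (int \<Rightarrow> nat) \<Rightarrow> (int \<Rightarrow> nat) \<Rightarrow> int \<Rightarrow> bool" where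
  "trace_between G t M r v h z \<longleftrightarrow> trace G t M r h z \<and>
     track M 0 h z = track M 0 v z \<and> track M t h z = track M t v z"

lemma local_trace_between:
  assumes "wf_sca G" "code_sca G \<le> r"
  shows "local_on2 {- int (t * r)..int (t * r)} (trace_between G t M r)"
  unfolding local_on2_def
proof (intro allI impI)
  fix v h v' h' :: "int \<Rightarrow> nat" and z z' :: int
  assume ag: "agree {- int (t * r)..int (t * r)} v z v' z'" "agree {- int (t * r)..int (t * r)} h z h' z'"
  have "track M j v z = track M j v' z'" "track M j h z = track M j h' z'" for j
    using ag by (auto intro: track_agree)
  then show "trace_between G t M r v h z = trace_between G t M r v' h' z'"
    unfolding trace_between_def using local_onD[OF local_trace[OF assms] ag(2)] by simp
qed

text \<open>Induction along the cone: at time \<open>l\<close>, agreement within distance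
  \<open>(t - l) * r\<close> of \<open>z\<close> determines the next row within distance
  \<open>(t - 1 - l) * r\<close>, and at time \<open>t\<close> only \<open>z\<close> itself
  remains.\<close>

lemma evolution_agrees_with_trace:
  assumes "wf_sca F" "code_sca F \<le> r"
    and C: "C 0 = track M 0 v" "\<And>l. l < t \<Longrightarrow> C (Suc l) = global F (C l) (track M (t + 1 + l) v)"
    and "trace F t M r v z"
  shows "C t z = track M t v z"
proof -
  have "C l (z + k) = track M l v (z + k)" if "l \<le> t" "\<bar>k\<bar> \<le> int ((t - l) * r)" for l k
    using that
  proof (induction l arbitrary: k)
    case 0
    then show ?case using C(1) by simp
  next
    case (Suc l)
    have l: "l < t" using Suc.prems(1) by simp
    have "\<bar>k\<bar> \<le> int ((t - 1 - l) * r)" using Suc.prems(2) by simp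
    moreover have "int ((t - l) * r) = int ((t - 1 - l) * r) + int r"
      unfolding cone_radius[OF l, symmetric] by (rule of_nat_add)
    ultimately have k: "\<bar>k\<bar> \<le> int ((t - 1 - l) * r)" "\<bar>k + i\<bar> \<le> int ((t - l) * r)"
      if "i \<in> {- int r..int r}" for i
      using that unfolding atLeastAtMost_iff by linarith+
    have "C l (z + k + i) = track M l v (z + k + i)" if "i \<in> {- int r..int r}" for i
      using Suc.IH[OF _ k(2)[OF that]] l by (simp only: add.assoc less_imp_le)
    then have "map (\<lambda>i. C l (z + k + i)) (nbhd F) = map (\<lambda>i. track M l v (z + k + i)) (nbhd F)"
      using nbhd_subset(1)[OF assms(1,2)] by (intro map_cong refl) blast
    then have "C (Suc l) (z + k) = global F (track M l v) (track M (t + 1 + l) v) (z + k)"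
      unfolding C(2)[OF l] global_def by (simp only:)
    also have "\<dots> = track M (Suc l) v (z + k)"
      using assms(5) Suc.prems l by (simp add: trace_def)
    finally show ?case .
  qed
  from this[of t 0] show ?thesis by simp
qed

lemma nondet_iter_subset_iff_solvable:
  assumes wf: "wf_sca F" "wf_sca G" and r: "code_sca F \<le> r" "code_sca G \<le> r"
    and FG: "states F = states G"
    and M: "states F \<subseteq> {..<M}" "symbols F \<subseteq> {..<M}" "symbols G \<subseteq> {..<M}"
  shows "(\<forall>c\<in>configs (states F). nondet_iter F t c \<subseteq> nondet_iter G t c) \<longleftrightarrow>
    solvable (letters M (2 * t + 1) (trace_alphabets t (states F) (symbols F)))
      (letters M (2 * t + 1) (trace_alphabets t (states G) (symbols G)))
      (trace F t M r) (trace_between G t M r) b"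
    (is "_ \<longleftrightarrow> solvable ?A ?H _ _ _")
proof
  assume sub: "\<forall>c\<in>configs (states F). nondet_iter F t c \<subseteq> nondet_iter G t c"
  show "solvable ?A ?H (trace F t M r) (trace_between G t M r) b"
    unfolding solvable_def
  proof (intro allI ballI impI)
    fix n :: nat and v
    assume v: "v \<in> configs ?A" "\<forall>z\<in>{b..<b + int n}. trace F t M r v z"
    \<comment> \<open>The trace in \<open>v\<close> is correct near the block only. It is replaced
      by the true orbit of its initial row under the same random symbols, which ends in the same
      letters on the block and to which the inclusion applies.\<close>
    define C where "C l = rec_nat (track M 0 v) (\<lambda>l c. global F c (track M (t + 1 + l) v)) l" for l
    have C: "C 0 = track M 0 v" "C (Suc l) = global F (C l) (track M (t + 1 + l) v)" for l
      by (simp_all add: C_def)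
    have "track M (t + 1 + l) v \<in> configs (symbols F)" if "l < t" for l
      using track_configs[OF v(1), of "t + 1 + l"] that by (simp add: trace_alphabets_def)
    then have "C t \<in> nondet_iter F t (C 0)"
      unfolding in_nondet_iter_iff using C
      by (intro exI[of _ C] exI[of _ "\<lambda>l. track M (t + 1 + l) v"]) auto
    moreover have c: "C 0 \<in> configs (states F)"
      using track_configs[OF v(1), of 0] C(1) by (simp add: trace_alphabets_def)
    ultimately have "C t \<in> nondet_iter G t (C 0)" using sub by blast
    then obtain h where h: "h \<in> configs ?H" "\<forall>z. trace G t M r h z"
      "track M 0 h = C 0" "track M t h = C t"
      using in_nondet_iter_iff_trace[OF wf(2), of M "C 0" "C t" t r] c FG M by auto
    have "C t z = track M t v z" if "z \<in> {b..<b + int n}" for z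
      by (rule evolution_agrees_with_trace[OF wf(1) r(1)]) (use C v that in auto)
    then have "\<forall>z\<in>{b..<b + int n}. trace_between G t M r v h z"
      using h C(1) by (simp add: trace_between_def)
    then show "\<exists>h\<in>configs ?H. \<forall>z\<in>{b..<b + int n}. trace_between G t M r v h z"
      using h(1) by blast
  qed
next
  assume solv: "solvable ?A ?H (trace F t M r) (trace_between G t M r) b"
  show "\<forall>c\<in>configs (states F). nondet_iter F t c \<subseteq> nondet_iter G t c"
  proof (intro ballI subsetI)
    fix c d
    assume c: "c \<in> configs (states F)" and "d \<in> nondet_iter F t c"
    then obtain v where v: "v \<in> configs ?A" "\<And>z. trace F t M r v z"
      "track M 0 v = c" "track M t v = d"
      using in_nondet_iter_iff_trace[OF wf(1) M(1,2) c] by blast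
    obtain h where h: "h \<in> configs ?H" "\<And>z. trace_between G t M r v h z"
      using solvable_globally[OF finite_letters local_trace[OF wf(1) r(1)]
          local_trace_between[OF wf(2) r(2)] solv v(1,2)] by blast
    have "\<forall>z. trace G t M r h z" "track M 0 h = c" "track M t h = d"
      using h(2) v(3,4) by (auto simp: trace_between_def)
    then show "d \<in> nondet_iter G t c"
      using in_nondet_iter_iff_trace[OF wf(2), of M c d t r] c FG M h(1) by auto
  qed
qed

text \<open>With \<open>s = (t - 1 - l) * r\<close>, the offsets from \<open>-s\<close> to
  \<open>s\<close> are enumerated as \<open>k - s\<close> for \<open>k < 2 * s + 1\<close>; the
  subtraction is exact for positions \<open>i\<close> that have room for the cone.\<close>

definition trace_word :: "nat \<Rightarrow> nat \<Rightarrow> nat \<Rightarrow> nat \<Rightarrow> nat \<Rightarrow> nat \<Rightarrow> nat \<Rightarrow> bool" where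
  "trace_word x t r L M w i \<longleftrightarrow> (\<forall>l<t. \<forall>k<2 * ((t - 1 - l) * r) + 1.
     rule_holds x L M w l (t + 1 + l) (i + k - (t - 1 - l) * r)
       (digit M (digit L w (i + k - (t - 1 - l) * r)) (Suc l)))"

lemma rec_trace_word:
  assumes "general_recursive n x" "general_recursive n r" "general_recursive n L"
    "general_recursive n M" "general_recursive n w" "general_recursive n i"
  shows "rec_pred n (\<lambda>xs. trace_word (x xs) t (r xs) (L xs) (M xs) (w xs) (i xs))"
  unfolding trace_word_def
  by (intro rec_intros rec_rule_holds rec_digit assms[THEN rec_tl] assms[THEN rec_tl, THEN rec_tl])

lemma trace_word_iff:
  assumes wf: "wf_sca F" and r: "code_sca F \<le> r" "t * r \<le> i"
    and w: "\<forall>k\<in>{i - t * r..i + t * r}.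
      digit L w k \<in> letters M (2 * t + 1) (trace_alphabets t (states F) (symbols F))"
  shows "trace_word (code_sca F) t r L M w i \<longleftrightarrow> trace F t M r (decode L w) (int i)"
proof -
  have "(\<forall>k<2 * ((t - 1 - l) * r) + 1.
      rule_holds (code_sca F) L M w l (t + 1 + l) (i + k - (t - 1 - l) * r)
        (digit M (digit L w (i + k - (t - 1 - l) * r)) (Suc l))) \<longleftrightarrow>
    (\<forall>k. \<bar>k\<bar> \<le> int ((t - 1 - l) * r) \<longrightarrow>
      global F (track M l (decode L w)) (track M (t + 1 + l) (decode L w)) (int i + k) =
        track M (Suc l) (decode L w) (int i + k))" if l: "l < t" for l
  proof -
    define s where "s = (t - 1 - l) * r"
    have "s + r \<le> t * r"
      unfolding s_def cone_radius[OF l] by (rule mult_le_mono1) simp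
    then have s: "s + r \<le> i" using r(2) by linarith
    have *: "rule_holds (code_sca F) L M w l (t + 1 + l) p (digit M (digit L w p) (Suc l)) \<longleftrightarrow>
        global F (track M l (decode L w)) (track M (t + 1 + l) (decode L w)) (int p) =
        track M (Suc l) (decode L w) (int p)" if "i - s \<le> p" "p \<le> i + s" for p
    proof -
      have "digit L w k \<in> letters M (2 * t + 1) (trace_alphabets t (states F) (symbols F))"
        if "k \<in> {p - code_sca F..p + code_sca F}" for k
        using w that \<open>i - s \<le> p\<close> \<open>p \<le> i + s\<close> \<open>s + r \<le> t * r\<close> s r by auto
      then show ?thesis
        unfolding track_digit using l s r that
        by (intro rule_holds_letters_iff[OF wf, of _ _ "2 * t + 1" _
              "trace_alphabets t (states F) (symbols F)"])
          (auto simp: trace_alphabets_def)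
    qed
    show ?thesis
      unfolding s_def[symmetric]
    proof safe
      fix k :: int
      assume h: "\<forall>k<2 * s + 1. rule_holds (code_sca F) L M w l (t + 1 + l) (i + k - s)
        (digit M (digit L w (i + k - s)) (Suc l))" and k: "\<bar>k\<bar> \<le> int s"
      have p: "nat (int i + k) = i + nat (k + int s) - s" "int (nat (int i + k)) = int i + k"
        using k s by auto
      show "global F (track M l (decode L w)) (track M (t + 1 + l) (decode L w)) (int i + k) =
        track M (Suc l) (decode L w) (int i + k)"
        using *[of "nat (int i + k)"] h[rule_format, of "nat (k + int s)"] k s
        unfolding p(2) unfolding p(1) by auto
    next
      fix k
      assume h: "\<forall>k. \<bar>k\<bar> \<le> int s \<longrightarrow>
        global F (track M l (decode L w)) (track M (t + 1 + l) (decode L w)) (int i + k) =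
        track M (Suc l) (decode L w) (int i + k)" and k: "k < 2 * s + 1"
      have "int (i + k - s) = int i + (int k - int s)" using s by auto
      then show "rule_holds (code_sca F) L M w l (t + 1 + l) (i + k - s)
        (digit M (digit L w (i + k - s)) (Suc l))"
        using *[of "i + k - s"] h[rule_format, of "int k - int s"] k s by (auto simp: add_diff_eq)
    qed
  qed
  then show ?thesis unfolding trace_word_def trace_def by auto
qed

definition letters_of_trace :: "nat \<Rightarrow> nat \<Rightarrow> nat \<Rightarrow> nat set" where
  "letters_of_trace t x = trace_alphabets t (states_of x) (symbols_of x)"

lemma letters_of_trace_code_sca:
  "wf_sca F \<Longrightarrow> letters_of_trace t (code_sca F) = trace_alphabets t (states F) (symbols F)"
  by (simp add: letters_of_trace_def states_of_code_sca symbols_of_code_sca)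

lemma rec_letters_of_trace:
  "general_recursive n x \<Longrightarrow> general_recursive n j \<Longrightarrow> general_recursive n a \<Longrightarrow>
    rec_pred n (\<lambda>xs. a xs \<in> letters_of_trace t (x xs) (j xs))"
  unfolding letters_of_trace_def trace_alphabets_def
  by (intro rec_mem_if rec_states_of rec_symbols_of rec_intros)

definition trace_between_word :: "nat \<Rightarrow> nat \<Rightarrow> nat \<Rightarrow> nat \<Rightarrow> nat \<Rightarrow> nat \<Rightarrow> nat \<Rightarrow> nat \<Rightarrow> bool" where
  "trace_between_word x t r L M w h i \<longleftrightarrow> trace_word x t r L M h i \<and>
     (digit M (digit L h i) 0 = digit M (digit L w i) 0 \<and>
      digit M (digit L h i) t = digit M (digit L w i) t)"

lemma rec_trace_between_word:
  assumes "general_recursive n x" "general_recursive n r" "general_recursive n L"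
    "general_recursive n M" "general_recursive n w" "general_recursive n h" "general_recursive n i"
  shows "rec_pred n (\<lambda>xs. trace_between_word (x xs) t (r xs) (L xs) (M xs) (w xs) (h xs) (i xs))"
  unfolding trace_between_word_def by (intro rec_intros rec_trace_word rec_digit assms)

text \<open>The instance is \<open>y\<close>, from which \<open>f\<close> and \<open>g\<close> extract the codes of the two automata.\<close>

definition inclusion_words :: "nat \<Rightarrow> (nat \<Rightarrow> nat) \<Rightarrow> (nat \<Rightarrow> nat) \<Rightarrow> nat \<Rightarrow> bool" where
  "inclusion_words t f g y \<longleftrightarrow>
    \<not> (\<exists>n<search_bound (Suc y ^ (2 * t + 1)) (Suc y ^ (2 * t + 1)) (t * y).
      \<exists>w<(Suc y ^ (2 * t + 1)) ^ (n + 2 * (t * y)).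
        (\<forall>i<n + 2 * (t * y). digit (Suc y ^ (2 * t + 1)) w i \<in>
          letters (Suc y) (2 * t + 1) (letters_of_trace t (f y))) \<and>
        (\<forall>i<n. trace_word (f y) t y (Suc y ^ (2 * t + 1)) (Suc y) w (t * y + i)) \<and>
        \<not> (\<exists>h<(Suc y ^ (2 * t + 1)) ^ (n + 2 * (t * y)).
          (\<forall>i<n + 2 * (t * y). digit (Suc y ^ (2 * t + 1)) h i \<in>
            letters (Suc y) (2 * t + 1) (letters_of_trace t (g y))) \<and>
          (\<forall>i<n. trace_between_word (g y) t y (Suc y ^ (2 * t + 1)) (Suc y) w h (t * y + i))))"

lemma rec_inclusion_words:
  assumes "\<And>n x. general_recursive n x \<Longrightarrow> general_recursive n (\<lambda>xs. f (x xs))"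
    "\<And>n x. general_recursive n x \<Longrightarrow> general_recursive n (\<lambda>xs. g (x xs))"
  shows "rec_pred (Suc 0) (\<lambda>xs. inclusion_words t f g (hd xs))"
  unfolding inclusion_words_def
  by (intro rec_intros rec_search_bound rec_letters[where D = "letters_of_trace t"]
      rec_letters_of_trace rec_trace_word rec_trace_between_word rec_digit assms)

lemma inclusion_words_iff:
  assumes wf: "wf_sca F" "wf_sca G" and FG: "states F = states G" and t: "0 < t"
    and fg: "f y = code_sca F" "g y = code_sca G" and y: "code_sca F \<le> y" "code_sca G \<le> y"
  shows "inclusion_words t f g y \<longleftrightarrow>
    (\<forall>c\<in>configs (states F). nondet_iter F t c \<subseteq> nondet_iter G t c)"
proof -
  let ?L = "Suc y ^ (2 * t + 1)"
  \<comment> \<open>The word search requires a positive radius, which is where \<open>0 < t\<close>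
    enters.\<close>
  have pos: "0 < t * y" using t y code_sca_bounds(6)[OF wf(1)] by simp
  note bd = code_alphabets[OF wf(1) y(1)] code_alphabets[OF wf(2) y(2)]
  have p: "trace_word (code_sca F) t y ?L (Suc y) w i \<longleftrightarrow> trace F t (Suc y) y (decode ?L w) (int i)"
    if "t * y \<le> i" "\<forall>k\<in>{i - t * y..i + t * y}.
      digit ?L w k \<in> letters (Suc y) (2 * t + 1) (trace_alphabets t (states F) (symbols F))" for w i
    by (rule trace_word_iff[OF wf(1) y(1) that])
  have q: "trace_between_word (code_sca G) t y ?L (Suc y) w h i \<longleftrightarrow>
      trace_between G t (Suc y) y (decode ?L w) (decode ?L h) (int i)"
    if "t * y \<le> i" "\<forall>k\<in>{i - t * y..i + t * y}.
      digit ?L h k \<in> letters (Suc y) (2 * t + 1) (trace_alphabets t (states G) (symbols G))" for w h i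
    unfolding trace_between_word_def trace_between_def track_digit
    using trace_word_iff[OF wf(2) y(2) that] by simp
  show ?thesis
    unfolding nondet_iter_subset_iff_solvable[OF wf y FG bd(1,2,4), of t "int (t * y)"]
      inclusion_words_def fg letters_of_trace_code_sca[OF wf(1)] letters_of_trace_code_sca[OF wf(2)]
    by (rule solvable_iff_words[OF letters_subset letters_subset pos _
          local_trace[OF wf(1) y(1)] local_trace_between[OF wf(2) y(2)] p q, symmetric])
      (auto simp: search_bound_def)
qed

lemma decidable_same_iterate:
  assumes "0 < t"
  shows "decidable code_sca_pair (SCA \<times> SCA) (\<lambda>(F, G). same_iterate t F G)"
proof (rule decidableI)
  let ?f = "\<lambda>y. fst (prod_decode y)" and ?g = "\<lambda>y. snd (prod_decode y)"
  show "rec_pred (Suc 0) (\<lambda>xs. (\<forall>a<Suc (hd xs). (a \<in> states_of (?f (hd xs)) \<longrightarrow> a \<in> states_of (?g (hd xs))) \<and>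
      (a \<in> states_of (?g (hd xs)) \<longrightarrow> a \<in> states_of (?f (hd xs)))) \<and>
      (inclusion_words t ?f ?g (hd xs) \<and> inclusion_words t ?g ?f (hd xs)))"
    by (intro rec_intros rec_states_of rec_inclusion_words rec_fst_prod_decode rec_snd_prod_decode)
  fix FG :: "(nat, nat) sca \<times> (nat, nat) sca"
  assume "FG \<in> SCA \<times> SCA"
  then obtain F G where FG: "FG = (F, G)" and wf: "wf_sca F" "wf_sca G" by (auto simp: SCA_def)
  \<comment> \<open>The code of the pair dominates both codes, so one number provides a common
    radius and a common alphabet base for the two automata.\<close>
  define y where "y = code_sca_pair FG"
  have fg: "?f y = code_sca F" "?g y = code_sca G"
    by (simp_all add: y_def FG code_sca_pair_def)
  have y: "code_sca F \<le> y" "code_sca G \<le> y"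
    by (simp_all add: y_def FG code_sca_pair_def le_prod_encode_1 le_prod_encode_2)
  have "(\<forall>a<Suc y. (a \<in> states F \<longrightarrow> a \<in> states G) \<and> (a \<in> states G \<longrightarrow> a \<in> states F)) \<longleftrightarrow>
      states F = states G"
    using code_alphabets(1)[OF wf(1) y(1)] code_alphabets(1)[OF wf(2) y(2)] by blast
  moreover have "inclusion_words t ?f ?g y \<and> inclusion_words t ?g ?f y \<longleftrightarrow>
      (\<forall>c\<in>configs (states F). nondet_iter F t c = nondet_iter G t c)" if "states F = states G"
    using inclusion_words_iff[of F G t ?f y ?g, OF wf that assms fg y]
      inclusion_words_iff[of G F t ?g y ?f, OF wf(2,1) that[symmetric] assms fg(2,1) y(2,1)] that
    by auto
  ultimately show "(\<forall>a<Suc (code_sca_pair FG).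
      (a \<in> states_of (?f (code_sca_pair FG)) \<longrightarrow> a \<in> states_of (?g (code_sca_pair FG))) \<and>
      (a \<in> states_of (?g (code_sca_pair FG)) \<longrightarrow> a \<in> states_of (?f (code_sca_pair FG)))) \<and>
      (inclusion_words t ?f ?g (code_sca_pair FG) \<and> inclusion_words t ?g ?f (code_sca_pair FG)) \<longleftrightarrow>
      (case FG of (F, G) \<Rightarrow> same_iterate t F G)"
    unfolding y_def[symmetric] fg states_of_code_sca[OF wf(1)] states_of_code_sca[OF wf(2)]
    unfolding FG prod.case same_iterate_def by blast
qed

section \<open>Injectivity and pre-injectivity\<close>

definition collision :: "bool \<Rightarrow> ('q, 'r) sca \<Rightarrow> bool" where
  "collision e F \<longleftrightarrow> (\<exists>c1\<in>configs (states F). \<exists>c2\<in>configs (states F).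
     \<exists>s1\<in>configs (symbols F). \<exists>s2\<in>configs (symbols F).
       global F c1 s1 = global F c2 s2 \<and> c1 \<noteq> c2 \<and> (e \<longrightarrow> finite {z. c1 z \<noteq> c2 z}))"

lemma sca_injective_iff_collision: "sca_injective F \<longleftrightarrow> \<not> collision False F"
  unfolding sca_injective_def collision_def by auto

lemma sca_pre_injective_iff_collision: "sca_pre_injective F \<longleftrightarrow> \<not> collision True F"
  unfolding sca_pre_injective_def collision_def by auto

text \<open>Tracks 0 and 1 hold one configuration with its random symbols, tracks 2 and 3 the other.\<close>

definition same_image :: "(nat, nat) sca \<Rightarrow> nat \<Rightarrow> (int \<Rightarrow> nat) \<Rightarrow> int \<Rightarrow> bool" where
  "same_image F M v z \<longleftrightarrow>
     global F (track M 0 v) (track M 1 v) z = global F (track M 2 v) (track M 3 v) z"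

definition tail_ok :: "bool \<Rightarrow> (nat, nat) sca \<Rightarrow> nat \<Rightarrow> (int \<Rightarrow> nat) \<Rightarrow> int \<Rightarrow> bool" where
  "tail_ok e F M v z \<longleftrightarrow> same_image F M v z \<and> (e \<longrightarrow> track M 0 v z = track M 2 v z)"

lemma local_same_image:
  assumes "wf_sca F" "code_sca F \<le> R"
  shows "local_on {- int R..int R} (same_image F M)"
  unfolding local_on_def same_image_def
  by (intro allI impI arg_cong2[of _ _ _ _ "(=)"] global_agree[OF _ nbhd_subset[OF assms]])

lemma local_tail_ok:
  assumes "wf_sca F" "code_sca F \<le> R"
  shows "local_on {- int R..int R} (tail_ok e F M)"
  unfolding local_on_def
proof (intro allI impI)
  fix v v' :: "int \<Rightarrow> nat" and z z' :: int
  assume ag: "agree {- int R..int R} v z v' z'"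
  have "track M j v z = track M j v' z'" for j using ag by (rule track_agree) auto
  then show "tail_ok e F M v z = tail_ok e F M v' z'"
    unfolding tail_ok_def using local_onD[OF local_same_image[OF assms] ag] by simp
qed

lemma finite_int_interval:
  assumes "finite (D :: int set)" "D \<noteq> {}"
  obtains b n :: int where "b \<in> D" "0 \<le> n" "D \<subseteq> {b..<b + n}"
proof
  show "Min D \<in> D" using assms by simp
  show "0 \<le> Max D + 1 - Min D" using Max_ge[OF assms(1) Min_in[OF assms]] by simp
  show "D \<subseteq> {Min D..<Min D + (Max D + 1 - Min D)}" using assms by (auto simp: less_Suc_eq)
qed

text \<open>A condition of radius \<open>R\<close> at a cell strictly before \<open>z\<close> reads
  only cells strictly before \<open>z + R\<close>. The entire left tail can thus serve as an end
  condition that survives cutting.\<close>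

lemma local_left_tail:
  assumes "local_on {- int R..int R} T" "0 < R"
  shows "local_on {..<int R} (\<lambda>v z. (\<forall>y<z. T v y) \<and> track M 0 v z \<noteq> track M 2 v z)"
  unfolding local_on_def
proof (intro allI impI)
  fix v v' :: "int \<Rightarrow> nat" and z z' :: int
  assume ag: "agree {..<int R} v z v' z'"
  have "T v y = T v' (y - z + z')" if "y < z" for y
  proof (rule local_onD[OF assms(1)])
    show "agree {- int R..int R} v y v' (y - z + z')"
      unfolding agree_def
    proof
      fix k assume "k \<in> {- int R..int R}"
      then have "y - z + k \<in> {..<int R}" using that by auto
      then have "v (z + (y - z + k)) = v' (z' + (y - z + k))" using ag unfolding agree_def by blast
      then show "v (y + k) = v' (y - z + z' + k)" by (simp add: algebra_simps)
    qed
  qed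
  then have "(\<forall>y<z. T v y) \<longleftrightarrow> (\<forall>y<z. T v' (y - z + z'))" by simp
  also have "\<dots> \<longleftrightarrow> (\<forall>y<z'. T v' y)"
  proof safe
    fix y assume "\<forall>y<z. T v' (y - z + z')" "y < z'"
    then show "T v' y" by (auto dest: spec[of _ "y - z' + z"])
  qed auto
  finally show "((\<forall>y<z. T v y) \<and> track M 0 v z \<noteq> track M 2 v z) =
      ((\<forall>y<z'. T v' y) \<and> track M 0 v' z' \<noteq> track M 2 v' z')"
    using track_agree[OF ag, of M] assms(2) by simp
qed

lemma local_right_tail:
  assumes "local_on {- int R..int R} T"
  shows "local_on {- int R..} (\<lambda>v z. \<forall>y\<ge>z. T v y)"
  unfolding local_on_def
proof (intro allI impI)
  fix v v' :: "int \<Rightarrow> 'a" and z z' :: int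
  assume ag: "agree {- int R..} v z v' z'"
  have "T v y = T v' (y - z + z')" if "y \<ge> z" for y
  proof (rule local_onD[OF assms(1)])
    show "agree {- int R..int R} v y v' (y - z + z')"
      unfolding agree_def
    proof
      fix k assume "k \<in> {- int R..int R}"
      then have "y - z + k \<in> {- int R..}" using that by auto
      then have "v (z + (y - z + k)) = v' (z' + (y - z + k))" using ag unfolding agree_def by blast
      then show "v (y + k) = v' (y - z + z' + k)" by (simp add: algebra_simps)
    qed
  qed
  then have "(\<forall>y\<ge>z. T v y) \<longleftrightarrow> (\<forall>y\<ge>z. T v' (y - z + z'))" by simp
  also have "\<dots> \<longleftrightarrow> (\<forall>y\<ge>z'. T v' y)"
  proof safe
    fix y assume "\<forall>y\<ge>z. T v' (y - z + z')" "y \<ge> z'"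
    then show "T v' y" by (auto dest: spec[of _ "y - z' + z"])
  qed auto
  finally show "(\<forall>y\<ge>z. T v y) = (\<forall>y\<ge>z'. T v' y)" .
qed

text \<open>A core of \<open>n\<close> cells lies between two margins of \<open>B\<close> cells that
  stand for the infinite tails; the required difference sits at the first cell after the left
  margin.\<close>

definition collision_at :: "bool \<Rightarrow> (nat, nat) sca \<Rightarrow> nat \<Rightarrow> nat \<Rightarrow> nat \<Rightarrow> nat \<Rightarrow> (int \<Rightarrow> nat) \<Rightarrow> bool" where
  "collision_at e F M R B n v \<longleftrightarrow>
     (\<forall>i<n + 2 * B. same_image F M v (int (R + i)) \<and>
       (e \<longrightarrow> i < B \<or> n + B \<le> i \<longrightarrow> track M 0 v (int (R + i)) = track M 2 v (int (R + i)))) \<and>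
     track M 0 v (int (R + B)) \<noteq> track M 2 v (int (R + B))"

text \<open>In one direction the core is shortened while the complete tails are carried along as end
  conditions, and the tails are then truncated to margins. In the other direction the margins are
  pumped back into tails.\<close>

lemma collision_iff_collision_at:
  assumes wf: "wf_sca F" and R: "code_sca F \<le> R"
    and M: "states F \<subseteq> {..<M}" "symbols F \<subseteq> {..<M}"
    and B: "search_bound (M ^ 4) 1 R \<le> B"
  shows "collision e F \<longleftrightarrow>
    (\<exists>n<B. \<exists>v\<in>configs (letters M 4 (rule_alphabets (states F) (symbols F))). collision_at e F M R B n v)"
    (is "_ \<longleftrightarrow> (\<exists>n<B. \<exists>v\<in>configs ?A. _)")
proof -
  define b where "b = int R + int B"
  have R0: "0 < R" using R code_sca_bounds(6)[OF wf] by linarith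
  note T = local_tail_ok[OF wf R, of e M] and P = local_same_image[OF wf R, of M]
  have "card ?A ^ (2 * R) \<le> (M ^ 4) ^ (2 * R)"
    using card_letters by (intro power_mono) auto
  moreover have "(M ^ 4) ^ (2 * R) * 2 \<le> B" using B by (simp add: search_bound_def)
  ultimately have "card ?A ^ (2 * R) \<le> B" by linarith
  \<comment> \<open>With an empty hidden alphabet only the visible windows count; a positive
    \<open>R\<close> makes the exponent vanish.\<close>
  moreover have "2 ^ (card ({} :: nat set) ^ (2 * R)) = (1 :: nat)" using R0 by simp
  ultimately have cB: "card ?A ^ (2 * R) \<le> B"
    "card ?A ^ (2 * R) * 2 ^ (card ({} :: nat set) ^ (2 * R)) \<le> B"
    by (simp_all only: mult_1_right)
  show ?thesis
  proof
    assume "collision e F"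
    then obtain c1 c2 s1 s2 where c: "c1 \<in> configs (states F)" "c2 \<in> configs (states F)"
      "s1 \<in> configs (symbols F)" "s2 \<in> configs (symbols F)"
      "global F c1 s1 = global F c2 s2" "c1 \<noteq> c2" "e \<longrightarrow> finite {z. c1 z \<noteq> c2 z}"
      unfolding collision_def by blast
    have ne: "{z. c1 z \<noteq> c2 z} \<noteq> {}" using c(6) by auto
    \<comment> \<open>With \<open>e\<close>, \<open>a\<close> is the leftmost difference and
      \<open>n\<close> covers all others, so both tails are free of differences; otherwise any
      difference will do.\<close>
    have "\<exists>a n. c1 a \<noteq> c2 a \<and> (e \<longrightarrow> {z. c1 z \<noteq> c2 z} \<subseteq> {a..<a + int n})"
    proof (cases e)
      case True
      then obtain a n where "a \<in> {z. c1 z \<noteq> c2 z}" "0 \<le> n" "{z. c1 z \<noteq> c2 z} \<subseteq> {a..<a + n}"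
        using finite_int_interval ne c(7) by metis
      then show ?thesis by (intro exI[of _ a] exI[of _ "nat n"]) auto
    qed (use ne in auto)
    then obtain a n where a: "c1 a \<noteq> c2 a" "e \<longrightarrow> {z. c1 z \<noteq> c2 z} \<subseteq> {a..<a + int n}" by blast
    let ?c = "\<lambda>j :: nat. if j = 0 then c1 else if j = 1 then s1 else if j = 2 then c2 else s2"
    have four: "j = 0 \<or> j = 1 \<or> j = 2 \<or> j = 3" if "j < 4" for j :: nat using that by auto
    have "?c j \<in> configs (rule_alphabets (states F) (symbols F) j)"
      "rule_alphabets (states F) (symbols F) j \<subseteq> {..<M}" if "j < 4" for j
      using four[OF that] c(1-4) M by (auto simp: rule_alphabets_simps)
    from ex_tracks[of 4 ?c, OF this]
    obtain u where u: "u \<in> configs ?A" "\<forall>j<4. track M j u = ?c j" by blast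
    have tu: "track M 0 u = c1" "track M 1 u = s1" "track M 2 u = c2" "track M 3 u = s2"
      using u(2) by (simp_all add: numeral_eq_Suc)
    \<comment> \<open>The chosen difference is moved to \<open>b\<close>, leaving room for the left
      margin and its neighbourhoods.\<close>
    define v where "v = (\<lambda>z. u (z + (a - b)))"
    have sh: "tail_ok e F M v z = tail_ok e F M u (z + (a - b))"
      "same_image F M v z = same_image F M u (z + (a - b))"
      "track M j v z = track M j u (z + (a - b))" for z j
    proof -
      have ag: "agree {- int R..int R} v z u (z + (a - b))"
        by (auto simp: agree_def v_def algebra_simps)
      show "tail_ok e F M v z = tail_ok e F M u (z + (a - b))"
        "same_image F M v z = same_image F M u (z + (a - b))"
        using local_onD[OF T ag] local_onD[OF P ag] by auto
      show "track M j v z = track M j u (z + (a - b))" using ag by (rule track_agree) auto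
    qed
    have img: "same_image F M u z" for z using c(5) by (simp add: same_image_def tu del: One_nat_def)
    have tl: "tail_ok e F M u z" if "z \<notin> {a..<a + int n}" for z
      using img a(2) that by (auto simp: tail_ok_def tu)
    let ?I = "\<lambda>v z. (\<forall>y<z. tail_ok e F M v y) \<and> track M 0 v z \<noteq> track M 2 v z"
    let ?J = "\<lambda>v z. \<forall>y\<ge>z. tail_ok e F M v y"
    have "v \<in> configs ?A" using u(1) by (simp add: v_def configs_shift)
    moreover have "?I v b" "?J v (b + int n)" "\<forall>z\<in>{b..<b + int n}. same_image F M v z"
      unfolding sh using a(1) img by (auto simp: tu intro!: tl)
    ultimately have un: "unsolved ?A ({} :: nat set) ?I ?J (same_image F M) (\<lambda>_ _ _. True) b n v"
      by (simp add: unsolved_def configs_def)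
    have "local_on2 {- int R..int R} (\<lambda>_ _ _. True)" by (simp add: local_on2_def)
    from unsolved_bounded[OF finite_letters _ P this local_left_tail[OF T R0] local_right_tail[OF T]
        un cB(2)]
    obtain n v where n: "n < B"
      and v: "unsolved ?A ({} :: nat set) ?I ?J (same_image F M) (\<lambda>_ _ _. True) b n v"
      by auto
    have "collision_at e F M R B n v"
      unfolding collision_at_def
    proof (intro conjI allI impI)
      fix i assume "i < n + 2 * B"
      have "int (R + i) < b \<or> b + int n \<le> int (R + i) \<or> int (R + i) \<in> {b..<b + int n}"
        by (auto simp: b_def)
      then show "same_image F M v (int (R + i))"
        using v unfolding unsolved_def by (auto simp: tail_ok_def)
      assume "e" "i < B \<or> n + B \<le> i"
      then have "tail_ok e F M v (int (R + i))"
        using v unfolding unsolved_def by (auto simp: b_def)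
      with \<open>e\<close> show "track M 0 v (int (R + i)) = track M 2 v (int (R + i))"
        by (simp add: tail_ok_def)
    next
      show "track M 0 v (int (R + B)) \<noteq> track M 2 v (int (R + B))"
        using v unfolding unsolved_def by (simp add: b_def)
    qed
    then show "\<exists>n<B. \<exists>v\<in>configs ?A. collision_at e F M R B n v"
      using n v unfolding unsolved_def by blast
  next
    assume "\<exists>n<B. \<exists>v\<in>configs ?A. collision_at e F M R B n v"
    then obtain n v where v: "v \<in> configs ?A" "collision_at e F M R B n v" by blast
    have img: "same_image F M v z" if "z \<in> {b - int B..<b + int n + int B}" for z
      using v(2)[unfolded collision_at_def, THEN conjunct1, rule_format, of "nat (z - int R)"] that
      by (auto simp: b_def)
    have "tail_ok e F M v z" if "z \<in> {b - int B..<b} \<union> {b + int n..<b + int n + int B}" for z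
    proof -
      have "int (R + nat (z - int R)) = z" using that by (auto simp: b_def)
      then show ?thesis
        using v(2)[unfolded collision_at_def, THEN conjunct1, rule_format, of "nat (z - int R)"] that
        unfolding tail_ok_def by (auto simp: b_def)
    qed
    \<comment> \<open>\<open>B\<close> is at least the number of windows, so each margin can be
      pumped to an infinite tail. All cells read by conditions on the core are preserved.\<close>
    then obtain u where u: "u \<in> configs ?A" "\<forall>z\<in>{b - int R..<b + int n + int R}. u z = v z"
      "\<forall>z<b. tail_ok e F M u z" "\<forall>z\<ge>b + int n. tail_ok e F M u z"
      using extend_both[OF finite_letters T v(1), of b B "b + int n"] cB(1) by auto
    have img: "same_image F M u z" for z
    proof (cases "z \<in> {b..<b + int n}")
      case True
      then have "agree {- int R..int R} u z v z" using u(2) by (auto simp: agree_def)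
      from local_onD[OF P this] show ?thesis using img[of z] True by auto
    next
      case False
      then show ?thesis using u(3,4) by (auto simp: tail_ok_def not_less)
    qed
    have "{z. track M 0 u z \<noteq> track M 2 u z} \<subseteq> {b..<b + int n}" if e
      using u(3,4) that by (auto simp: tail_ok_def) (meson not_le)+
    then have fin: "e \<longrightarrow> finite {z. track M 0 u z \<noteq> track M 2 u z}"
      using finite_subset by blast
    have "u b = v b" using u(2) R0 by auto
    then have "track M 0 u b \<noteq> track M 2 u b"
      using v(2) by (simp add: collision_at_def track_def b_def)
    moreover have "track M 0 u \<in> configs (states F)" "track M 1 u \<in> configs (symbols F)"
      "track M 2 u \<in> configs (states F)" "track M 3 u \<in> configs (symbols F)"
      using track_configs[OF u(1), of 0] track_configs[OF u(1), of 1]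
        track_configs[OF u(1), of 2] track_configs[OF u(1), of 3]
      by (simp_all add: rule_alphabets_simps del: One_nat_def)
    ultimately show "collision e F"
      unfolding collision_def using img fin
      by (intro bexI[of _ "track M 0 u"] bexI[of _ "track M 2 u"] bexI[of _ "track M 1 u"]
          bexI[of _ "track M 3 u"]) (auto simp: same_image_def fun_eq_iff)
  qed
qed

text \<open>The local rule is available as a graph, so equality of two outputs is expressed through
  a common value \<open>q\<close>.\<close>

definition collision_word :: "bool \<Rightarrow> nat \<Rightarrow> nat \<Rightarrow> nat \<Rightarrow> nat \<Rightarrow> nat \<Rightarrow> nat \<Rightarrow> bool" where
  "collision_word e x L M B n w \<longleftrightarrow>
     (\<forall>i<n + 2 * B. (\<exists>q<M. rule_holds x L M w 0 1 (x + i) q \<and> rule_holds x L M w 2 3 (x + i) q) \<and>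
       (e \<longrightarrow> i < B \<or> n + B \<le> i \<longrightarrow> digit M (digit L w (x + i)) 0 = digit M (digit L w (x + i)) 2)) \<and>
     \<not> digit M (digit L w (x + B)) 0 = digit M (digit L w (x + B)) 2"

lemma rec_collision_word:
  assumes "general_recursive n x" "general_recursive n L" "general_recursive n M"
    "general_recursive n B" "general_recursive n k" "general_recursive n w"
  shows "rec_pred n (\<lambda>xs. collision_word e (x xs) (L xs) (M xs) (B xs) (k xs) (w xs))"
  unfolding collision_word_def
  by (intro rec_intros rec_rule_holds rec_digit assms assms[THEN rec_tl] assms[THEN rec_tl, THEN rec_tl])

lemma collision_word_iff:
  assumes wf: "wf_sca F" and x: "x = code_sca F"
    and w: "\<forall>i<n + 2 * B + 2 * x. digit L w i \<in> letters (Suc x) 4 (rule_alphabets (states F) (symbols F))"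
  shows "collision_word e x L (Suc x) B n w \<longleftrightarrow> collision_at e F (Suc x) x B n (decode L w)"
proof -
  have "(\<exists>q<Suc x. rule_holds x L (Suc x) w 0 1 (x + i) q \<and> rule_holds x L (Suc x) w 2 3 (x + i) q) \<longleftrightarrow>
      same_image F (Suc x) (decode L w) (int (x + i))" if i: "i < n + 2 * B" for i
  proof -
    have w': "digit L w k \<in> letters (Suc x) 4 (rule_alphabets (states F) (symbols F))"
      if "k \<in> {x + i - code_sca F..x + i + code_sca F}" for k
      using w that i x by auto
    note * = rule_letters[OF wf _ _ _ _ _ w', where j = 0 and j' = 1 and i = "x + i"]
      rule_letters[OF wf _ _ _ _ _ w', where j = 2 and j' = 3 and i = "x + i"]
    show ?thesis
      using * code_sca_bounds(1)[OF wf] x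
      by (auto simp: rule_alphabets_simps same_image_def less_Suc_eq_le simp del: One_nat_def)
  qed
  then show ?thesis
    unfolding collision_word_def collision_at_def track_digit by auto
qed

lemma decidable_collision: "decidable code_sca SCA (\<lambda>F. \<not> collision e F)"
proof (rule decidableI)
  let ?L = "\<lambda>x. Suc x ^ 4"
  let ?B = "\<lambda>x. search_bound (?L x) 1 x"
  show "rec_pred (Suc 0) (\<lambda>xs. \<not> (\<exists>n<?B (hd xs). \<exists>w<?L (hd xs) ^ (n + 2 * ?B (hd xs) + 2 * hd xs).
      (\<forall>i<n + 2 * ?B (hd xs) + 2 * hd xs. digit (?L (hd xs)) w i \<in> letters (Suc (hd xs)) 4 (letters_of_rule (hd xs))) \<and>
      collision_word e (hd xs) (?L (hd xs)) (Suc (hd xs)) (?B (hd xs)) n w))"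
    by (intro rec_intros rec_search_bound rec_letters[where D = letters_of_rule] rec_letters_of_rule
        rec_collision_word rec_digit)
  fix F
  assume "F \<in> SCA"
  then have wf: "wf_sca F" by (simp add: SCA_def)
  define x where "x = code_sca F"
  have x: "code_sca F \<le> x" "0 < x" using code_sca_bounds(6)[OF wf] by (simp_all add: x_def)
  let ?A = "letters (Suc x) 4 (rule_alphabets (states F) (symbols F))"
  have loc: "collision_at e F (Suc x) x (?B x) n v = collision_at e F (Suc x) x (?B x) n v'"
    if eq: "\<And>z. 0 \<le> z \<Longrightarrow> z < int (n + 2 * ?B x + 2 * x) \<Longrightarrow> v z = v' z" for n v v'
  proof -
    have ag: "agree {- int x..int x} v (int (x + i)) v' (int (x + i))" if "i < n + 2 * ?B x" for i
      using that by (auto simp: agree_def intro!: eq)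
    have "track (Suc x) j v (int (x + i)) = track (Suc x) j v' (int (x + i))" if "i < n + 2 * ?B x" for i j
      using ag[OF that] by (rule track_agree) auto
    \<comment> \<open>A positive margin puts the cell of the required difference within the range of
      checked cells.\<close>
    moreover have "?B x < n + 2 * ?B x" using x(2) by (simp add: search_bound_def)
    moreover have "same_image F (Suc x) v (int (x + i)) = same_image F (Suc x) v' (int (x + i))"
      if "i < n + 2 * ?B x" for i
      by (rule local_onD[OF local_same_image[OF wf x(1)] ag[OF that]])
    ultimately show ?thesis unfolding collision_at_def by simp
  qed
  have "collision e F \<longleftrightarrow> (\<exists>n<?B x. \<exists>v\<in>configs ?A. collision_at e F (Suc x) x (?B x) n v)"
    by (rule collision_iff_collision_at[OF wf x(1) code_alphabets[OF wf x(1)]]) simp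
  also have "\<dots> \<longleftrightarrow> (\<exists>n<?B x. \<exists>w<?L x ^ (n + 2 * ?B x + 2 * x).
      (\<forall>i<n + 2 * ?B x + 2 * x. digit (?L x) w i \<in> ?A) \<and>
      collision_word e x (?L x) (Suc x) (?B x) n w)"
    using x(2) by (intro words_exist_iff letters_subset collision_word_iff[OF wf x_def] loc) auto
  finally show "(\<not> (\<exists>n<?B (code_sca F). \<exists>w<?L (code_sca F) ^ (n + 2 * ?B (code_sca F) + 2 * code_sca F).
      (\<forall>i<n + 2 * ?B (code_sca F) + 2 * code_sca F.
        digit (?L (code_sca F)) w i \<in> letters (Suc (code_sca F)) 4 (letters_of_rule (code_sca F))) \<and>
      collision_word e (code_sca F) (?L (code_sca F)) (Suc (code_sca F)) (?B (code_sca F)) n w)) \<longleftrightarrow>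
      \<not> collision e F"
    unfolding x_def letters_of_rule_code_sca[OF wf] by blast
qed

section \<open>Images and cylinders over a rational language\<close>

text \<open>Without repeated offsets, every word of random symbols is seen by some symbol
  configuration. This links quantification over configurations to the entries of the rule
  table.\<close>

lemma distinct_assignment:
  assumes "distinct ks" "length b = length ks" "set b \<subseteq> S" "S \<noteq> {}"
  obtains f where "\<And>k. f k \<in> S" "map f ks = b"
proof -
  obtain a where "a \<in> S" using assms(4) by blast
  define f where "f k = (case map_of (zip ks b) k of Some y \<Rightarrow> y | None \<Rightarrow> a)" for k
  have "f k \<in> S" for k
    using assms(3) \<open>a \<in> S\<close> by (auto simp: f_def split: option.split dest!: map_of_SomeD set_zip_rightD)
  moreover have "map f ks = b"
    using assms(1,2) by (auto intro!: nth_equalityI simp: f_def map_of_zip_nth)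
  ultimately show ?thesis by (rule that)
qed

definition determines :: "('q, 'r) sca \<Rightarrow> (int \<Rightarrow> 'q) \<Rightarrow> int \<Rightarrow> 'q \<Rightarrow> bool" where
  "determines F c z q \<longleftrightarrow> (\<forall>b\<in>words (length (rnbhd F)) (symbols F).
     local_rule F (map (\<lambda>v. c (z + v)) (nbhd F)) b = q)"

lemma determines_global:
  assumes "determines F c z q" "s \<in> configs (symbols F)"
  shows "global F c s z = q"
proof -
  have "map (\<lambda>v. s (z + v)) (rnbhd F) \<in> words (length (rnbhd F)) (symbols F)"
    using assms(2) by (auto simp: words_def configs_def)
  with assms(1) show ?thesis unfolding determines_def global_def by (rule bspec)
qed

text \<open>The alphabet of symbols must be nonempty: with an empty alphabet and an empty random
  neighbourhood there is still the empty word, but no configuration.\<close>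

lemma determines_iff:
  assumes "wf_sca F" "symbols F \<noteq> {}"
  shows "determines F c z q \<longleftrightarrow> (\<forall>s\<in>configs (symbols F). global F c s z = q)"
proof
  assume all: "\<forall>s\<in>configs (symbols F). global F c s z = q"
  show "determines F c z q"
    unfolding determines_def
  proof
    fix b
    assume b: "b \<in> words (length (rnbhd F)) (symbols F)"
    obtain f where f: "\<And>k. f k \<in> symbols F" "map f (rnbhd F) = b"
      using distinct_assignment[of "rnbhd F" b "symbols F"] assms b by (auto simp: wf_sca_def words_def)
    then have "(\<lambda>y. f (y - z)) \<in> configs (symbols F)" by (simp add: configs_def)
    then have "global F c (\<lambda>y. f (y - z)) z = q" using all by blast
    then show "local_rule F (map (\<lambda>v. c (z + v)) (nbhd F)) b = q"
      by (simp add: global_def f(2))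
  qed
qed (auto intro: determines_global)

lemma global_shift: "global F (\<lambda>z. c (z + d)) (\<lambda>z. s (z + d)) z = global F c s (z + d)"
  by (simp add: global_def ac_simps)

lemma determines_shift: "determines F (\<lambda>z. c (z + d)) z q = determines F c (z + d) q"
  by (simp add: determines_def ac_simps)

definition output_ok ::
  "bool \<Rightarrow> ('q, 'r) sca \<Rightarrow> (int \<Rightarrow> 'q) \<Rightarrow> (int \<Rightarrow> 'r) \<Rightarrow> int \<Rightarrow> 'q \<Rightarrow> bool" where
  "output_ok e F c s z q \<longleftrightarrow> (e \<longrightarrow> determines F c z q) \<and> (\<not> e \<longrightarrow> global F c s z = q)"

text \<open>A symbol configuration is demanded for both values of \<open>e\<close>: it exhibits the
  determined letters as actual outputs, hence as states. The case of no symbols has to be treated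
  apart for this reason.\<close>

definition produces :: "bool \<Rightarrow> ('q, 'r) sca \<Rightarrow> 'q list set \<Rightarrow> bool" where
  "produces e F L \<longleftrightarrow> (\<exists>u\<in>L. \<exists>c\<in>configs (states F). \<exists>s\<in>configs (symbols F).
     \<forall>i<length u. output_ok e F c s (int i) (u ! i))"

text \<open>Cylinders begin at cell 0, whereas coded words need a left margin; the dynamics commutes
  with translations, so the output may begin at any cell.\<close>

lemma produces_iff_shifted:
  "produces e F L \<longleftrightarrow> (\<exists>u\<in>L. \<exists>c\<in>configs (states F). \<exists>s\<in>configs (symbols F).
     \<forall>i<length u. output_ok e F c s (b + int i) (u ! i))"
proof
  assume "produces e F L"
  then obtain u c s where u: "u \<in> L" "c \<in> configs (states F)" "s \<in> configs (symbols F)"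
    "\<forall>i<length u. output_ok e F c s (int i) (u ! i)"
    unfolding produces_def by blast
  let ?c = "\<lambda>z. c (z + - b)" and ?s = "\<lambda>z. s (z + - b)"
  have "\<forall>i<length u. output_ok e F ?c ?s (b + int i) (u ! i)"
    using u(4) unfolding output_ok_def global_shift determines_shift by simp
  then show "\<exists>u\<in>L. \<exists>c\<in>configs (states F). \<exists>s\<in>configs (symbols F).
     \<forall>i<length u. output_ok e F c s (b + int i) (u ! i)"
    using u(1) configs_shift[OF u(2)] configs_shift[OF u(3)] by blast
next
  assume "\<exists>u\<in>L. \<exists>c\<in>configs (states F). \<exists>s\<in>configs (symbols F).
     \<forall>i<length u. output_ok e F c s (b + int i) (u ! i)"
  then obtain u c s where u: "u \<in> L" "c \<in> configs (states F)" "s \<in> configs (symbols F)"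
    "\<forall>i<length u. output_ok e F c s (b + int i) (u ! i)"
    by blast
  let ?c = "\<lambda>z. c (z + b)" and ?s = "\<lambda>z. s (z + b)"
  have "\<forall>i<length u. output_ok e F ?c ?s (int i) (u ! i)"
    using u(4) unfolding output_ok_def global_shift determines_shift by (simp add: add.commute)
  then show "produces e F L"
    unfolding produces_def using u(1) configs_shift[OF u(2)] configs_shift[OF u(3)] by blast
qed

lemma meets_cylinder_iff_produces:
  assumes "wf_sca F"
  shows "(\<exists>u\<in>L. \<exists>c\<in>configs (states F). nondet F c \<inter> cylinder (states F) u \<noteq> {}) \<longleftrightarrow>
    produces False F L"
proof -
  have "nondet F c \<inter> cylinder (states F) u \<noteq> {} \<longleftrightarrow>
      (\<exists>s\<in>configs (symbols F). \<forall>i<length u. global F c s (int i) = u ! i)"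
    if "c \<in> configs (states F)" for c u
    using global_in_states[OF assms that] by (auto simp: nondet_def cylinder_def)
  then show ?thesis unfolding produces_def output_ok_def by auto
qed

text \<open>Without random symbols the image is empty, hence trivially inside every cylinder.\<close>

lemma inside_cylinder_iff_produces:
  assumes "wf_sca F"
  shows "(\<exists>u\<in>L. \<exists>c\<in>configs (states F). nondet F c \<subseteq> cylinder (states F) u) \<longleftrightarrow>
    produces True F L \<or> (symbols F = {} \<and> states F \<noteq> {} \<and> L \<noteq> {})"
proof (cases "symbols F = {}")
  case True
  then have "configs (symbols F) = {}" by (simp add: configs_def)
  moreover have "configs (states F) = {} \<longleftrightarrow> states F = {}"
    by (auto simp: configs_def)
  ultimately show ?thesis using True unfolding produces_def nondet_def by auto
next
  case False
  have "nondet F c \<subseteq> cylinder (states F) u \<longleftrightarrow>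
      (\<exists>s\<in>configs (symbols F). \<forall>i<length u. determines F c (int i) (u ! i))"
    if "c \<in> configs (states F)" for c u
  proof -
    have ex: "\<exists>s. s \<in> configs (symbols F)"
      using False by (auto simp: configs_def)
    have "global F c s \<in> cylinder (states F) u \<longleftrightarrow> (\<forall>i<length u. global F c s (int i) = u ! i)"
      if "s \<in> configs (symbols F)" for s
      using global_in_states[OF assms \<open>c \<in> configs (states F)\<close> that] by (simp add: cylinder_def)
    then have "nondet F c \<subseteq> cylinder (states F) u \<longleftrightarrow>
        (\<forall>s\<in>configs (symbols F). \<forall>i<length u. global F c s (int i) = u ! i)"
      unfolding nondet_def by blast
    also have "\<dots> \<longleftrightarrow> (\<forall>i<length u. determines F c (int i) (u ! i))"
      unfolding determines_iff[OF assms False] by blast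
    finally show ?thesis using ex by blast
  qed
  then show ?thesis using False unfolding produces_def output_ok_def by auto
qed

section \<open>Accepting runs along the output of the cellular automaton\<close>

definition run_alphabets :: "'a set \<Rightarrow> 'a set \<Rightarrow> 'a set \<Rightarrow> nat \<Rightarrow> 'a set" where
  "run_alphabets S T U j = (if j = 1 then T else if j = 3 then U else S)"

lemma run_alphabets_simps:
  "run_alphabets S T U 0 = S" "run_alphabets S T U 1 = T" "run_alphabets S T U (Suc 0) = T"
  "run_alphabets S T U 2 = S" "run_alphabets S T U 3 = U"
  by (simp_all add: run_alphabets_def)

definition run_step ::
  "bool \<Rightarrow> (nat, nat) sca \<Rightarrow> nat set \<Rightarrow> nat \<Rightarrow> (int \<Rightarrow> nat) \<Rightarrow> int \<Rightarrow> bool" where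
  "run_step e F \<Delta> M v z \<longleftrightarrow> output_ok e F (track M 0 v) (track M 1 v) z (track M 2 v z) \<and>
     prod_encode (prod_encode (track M 3 v z, track M 2 v z), track M 3 v (z + 1)) \<in> \<Delta>"

lemma determines_agree:
  assumes "agree K v z v' z'" "set (nbhd F) \<subseteq> K"
  shows "determines F (track M i v) z q = determines F (track M i v') z' q"
proof -
  have "map (\<lambda>x. track M i v (z + x)) (nbhd F) = map (\<lambda>x. track M i v' (z' + x)) (nbhd F)"
    using assms by (intro map_cong) (auto simp: agree_def track_def)
  then show ?thesis by (simp only: determines_def)
qed

lemma local_run_step:
  assumes "wf_sca F" "code_sca F \<le> R"
  shows "local_on {- int R..int R} (run_step e F \<Delta> M)"
  unfolding local_on_def
proof (intro allI impI)
  fix v v' :: "int \<Rightarrow> nat" and z z' :: int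
  assume ag: "agree {- int R..int R} v z v' z'"
  \<comment> \<open>The transition reads the automaton state one cell to the right, so the radius
    must be at least 1.\<close>
  have "0 < R" using code_sca_bounds(6)[OF assms(1)] assms(2) by linarith
  then have "track M j v z = track M j v' z'" "track M j v (z + 1) = track M j v' (z' + 1)" for j
    using track_agree[OF ag] track_agree_next[OF ag] by auto
  then show "run_step e F \<Delta> M v z = run_step e F \<Delta> M v' z'"
    unfolding run_step_def output_ok_def
    using global_agree[OF ag nbhd_subset[OF assms]] determines_agree[OF ag nbhd_subset(1)[OF assms]]
    by simp
qed

text \<open>Tracks 0 to 3 hold the configuration, the random symbols, the output and the states of the
  automaton reading it.\<close>

definition run_at ::
  "bool \<Rightarrow> (nat, nat) sca \<Rightarrow> nat set \<Rightarrow> nat \<Rightarrow> nat set \<Rightarrow> nat \<Rightarrow> nat \<Rightarrow> nat \<Rightarrow> (int \<Rightarrow> nat) \<Rightarrow> bool" where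
  "run_at e F \<Delta> q0 Acc M R n v \<longleftrightarrow> track M 3 v (int R) = q0 \<and> track M 3 v (int (R + n)) \<in> Acc \<and>
     (\<forall>i<n. run_step e F \<Delta> M v (int (R + i)))"

text \<open>The initial and the accepting state are end conditions at single cells. Cutting between
  equal windows also keeps the run coherent, since the automaton state is part of each
  letter.\<close>

lemma run_at_bounded:
  assumes wf: "wf_sca F" and R: "code_sca F \<le> R" and B: "search_bound (M ^ 4) 1 R \<le> B"
    and v: "v \<in> configs (letters M 4 D)" "run_at e F \<Delta> q0 Acc M R n v"
  shows "\<exists>n<B. \<exists>v\<in>configs (letters M 4 D). run_at e F \<Delta> q0 Acc M R n v"
proof -
  let ?I = "\<lambda>v z. track M 3 v z = q0" and ?J = "\<lambda>v z. track M 3 v z \<in> Acc"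
  let ?U = "unsolved (letters M 4 D) ({} :: nat set) ?I ?J (run_step e F \<Delta> M) (\<lambda>_ _ _. True) (int R)"
  have R0: "0 < R" using R code_sca_bounds(6)[OF wf] by linarith
  have I: "local_on {..<int R} ?I" and J: "local_on {- int R..} ?J"
    unfolding local_on_def using R0 by (auto dest!: track_agree[where M = M and j = 3])
  have U: "?U n v \<longleftrightarrow> v \<in> configs (letters M 4 D) \<and> run_at e F \<Delta> q0 Acc M R n v" for n v
    unfolding unsolved_def run_at_def ball_atLeastLessThan_int_iff by (auto simp: configs_def)
  have "card (letters M 4 D) ^ (2 * R) \<le> (M ^ 4) ^ (2 * R)"
    using card_letters by (intro power_mono) auto
  moreover have "(M ^ 4) ^ (2 * R) * 2 \<le> B" using B by (simp add: search_bound_def)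
  ultimately have "card (letters M 4 D) ^ (2 * R) \<le> B" by linarith
  moreover have "2 ^ (card ({} :: nat set) ^ (2 * R)) = (1 :: nat)" using R0 by simp
  ultimately have cB: "card (letters M 4 D) ^ (2 * R) * 2 ^ (card ({} :: nat set) ^ (2 * R)) \<le> B"
    by (simp only: mult_1_right)
  have "?U n v" using v U by blast
  from unsolved_bounded[OF finite_letters _ local_run_step[OF wf R] _ I J this cB]
  show ?thesis unfolding U by (auto simp: local_on2_def)
qed

text \<open>The language is fixed in advance, so its automaton enters the algorithm as a constant:
  membership in its finite sets of states and transitions is recursive whatever these sets
  are.\<close>

locale dfa =
  fixes \<Sigma> :: "nat set" and S :: "nat set" and q0 :: nat and \<delta> :: "nat \<Rightarrow> nat \<Rightarrow> nat" and Acc :: "nat set"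
  assumes finite: "finite \<Sigma>" "finite S" and q0: "q0 \<in> S" and Acc: "Acc \<subseteq> S"
    and \<delta>: "\<And>q a. q \<in> S \<Longrightarrow> a \<in> \<Sigma> \<Longrightarrow> \<delta> q a \<in> S"
begin

definition language :: "nat list set" where
  "language = {w \<in> lists \<Sigma>. foldl \<delta> q0 w \<in> Acc}"

definition transitions :: "nat set" where
  "transitions = (\<lambda>(q, a). prod_encode (prod_encode (q, a), \<delta> q a)) ` (S \<times> \<Sigma>)"

text \<open>Added to the code of a cellular automaton, this gives a base exceeding both the
  automaton states and, being positive, all states and symbols.\<close>

definition state_bound :: nat where
  "state_bound = Suc (Max S)"

lemma finite_transitions: "finite transitions"
  unfolding transitions_def using finite by (intro finite_imageI finite_cartesian_product)

lemma transitions_iff: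
  "prod_encode (prod_encode (q, a), q') \<in> transitions \<longleftrightarrow> q \<in> S \<and> a \<in> \<Sigma> \<and> q' = \<delta> q a"
  by (auto simp: transitions_def)

lemma states_less_bound: "q \<in> S \<Longrightarrow> q < state_bound + n"
  using Max_ge[OF finite(2), of q] by (simp add: state_bound_def)

lemma foldl_in_S: "w \<in> lists \<Sigma> \<Longrightarrow> q \<in> S \<Longrightarrow> foldl \<delta> q w \<in> S"
  by (induction w arbitrary: q) (auto simp: \<delta>)

lemma produces_iff_run:
  assumes wf: "wf_sca F" and M: "states F \<subseteq> {..<M}" "symbols F \<subseteq> {..<M}" "S \<subseteq> {..<M}"
  shows "produces e F language \<longleftrightarrow>
    (\<exists>n. \<exists>v\<in>configs (letters M 4 (run_alphabets (states F) (symbols F) S)).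
       run_at e F transitions q0 Acc M R n v)"
    (is "_ \<longleftrightarrow> (\<exists>n. \<exists>v\<in>configs ?A. _)")
proof
  assume "produces e F language"
  then obtain u c s where u: "u \<in> language" and c: "c \<in> configs (states F)"
    and s: "s \<in> configs (symbols F)"
    and ok: "\<And>i. i < length u \<Longrightarrow> output_ok e F c s (int (R + i)) (u ! i)"
    unfolding produces_iff_shifted[of e F _ "int R"] by auto
  let ?n = "length u"
  \<comment> \<open>The output track carries \<open>u\<close> on the block and is filled up with
    \<open>c\<close>. The run below stays at \<open>q0\<close> before the block and at its last
    state after it, so both tracks keep to their alphabets everywhere.\<close>
  define p where "p z = (if z \<in> {int R..<int R + int ?n} then u ! nat (z - int R) else c z)" for z
  define q where "q z = foldl \<delta> q0 (take (nat (z - int R)) u)" for z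
  have uS: "u \<in> lists \<Sigma>" "foldl \<delta> q0 u \<in> Acc" using u by (auto simp: language_def)
  \<comment> \<open>A word of the language is only known to be over the alphabet \<Sigma>; its
    letters are states because they are outputs.\<close>
  have "u ! i \<in> states F" if "i < ?n" for i
  proof -
    have "global F c s (int (R + i)) = u ! i"
      using ok[OF that] determines_global[OF _ s] by (auto simp: output_ok_def)
    moreover have "global F c s (int (R + i)) \<in> states F"
      using global_in_states[OF wf c s] by (simp add: configs_def)
    ultimately show ?thesis by simp
  qed
  then have "p \<in> configs (states F)"
    using c by (auto simp: p_def configs_def nat_less_iff)
  moreover have "q \<in> configs S"
    using uS(1) q0 unfolding configs_def q_def by (auto intro!: foldl_in_S dest: in_set_takeD)
  moreover let ?c = "\<lambda>j :: nat. if j = 0 then c else if j = 1 then s else if j = 2 then p else q"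
  have four: "j = 0 \<or> j = 1 \<or> j = 2 \<or> j = 3" if "j < 4" for j :: nat using that by auto
  ultimately have "?c j \<in> configs (run_alphabets (states F) (symbols F) S j)"
    "run_alphabets (states F) (symbols F) S j \<subseteq> {..<M}" if "j < 4" for j
    using four[OF that] c s M by (auto simp: run_alphabets_simps)
  from ex_tracks[of 4 ?c, OF this]
  obtain v where v: "v \<in> configs ?A" "\<forall>j<4. track M j v = ?c j" by blast
  have tv: "track M 0 v = c" "track M 1 v = s" "track M 2 v = p" "track M 3 v = q"
    using v(2) by (simp_all add: numeral_eq_Suc)
  have "run_step e F transitions M v (int (R + i))" if i: "i < ?n" for i
  proof -
    have "p (int (R + i)) = u ! i" using i by (simp add: p_def)
    moreover have "q (int (R + i)) = foldl \<delta> q0 (take i u)" by (simp add: q_def)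
    moreover have "q (int (R + i) + 1) = foldl \<delta> q0 (take (Suc i) u)"
    proof -
      have "nat (int (R + i) + 1 - int R) = Suc i" by simp
      then show ?thesis by (simp only: q_def)
    qed
    moreover have "foldl \<delta> q0 (take i u) \<in> S"
      using uS(1) q0 by (intro foldl_in_S) (auto dest: in_set_takeD)
    ultimately show ?thesis
      unfolding run_step_def tv using ok[OF i] i uS(1)
      by (auto simp: transitions_iff take_Suc_conv_app_nth)
  qed
  then have "run_at e F transitions q0 Acc M R ?n v"
    unfolding run_at_def tv using uS(2) by (simp add: q_def)
  with v(1) show "\<exists>n. \<exists>v\<in>configs ?A. run_at e F transitions q0 Acc M R n v" by blast
next
  assume "\<exists>n. \<exists>v\<in>configs ?A. run_at e F transitions q0 Acc M R n v"
  then obtain n v where v: "v \<in> configs ?A" "run_at e F transitions q0 Acc M R n v" by blast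
  define u where "u = map (\<lambda>i. track M 2 v (int (R + i))) [0..<n]"
  have step: "track M 2 v (int (R + i)) \<in> \<Sigma>"
    "track M 3 v (int (R + Suc i)) = \<delta> (track M 3 v (int (R + i))) (track M 2 v (int (R + i)))"
    "output_ok e F (track M 0 v) (track M 1 v) (int (R + i)) (track M 2 v (int (R + i)))"
    if "i < n" for i
  proof -
    have *: "run_step e F transitions M v (int (R + i))"
      using v(2) that by (auto simp: run_at_def)
    have "int (R + i) + 1 = int (R + Suc i)" by simp
    from *[unfolded run_step_def transitions_iff this] show "track M 2 v (int (R + i)) \<in> \<Sigma>"
      "track M 3 v (int (R + Suc i)) = \<delta> (track M 3 v (int (R + i))) (track M 2 v (int (R + i)))"
      "output_ok e F (track M 0 v) (track M 1 v) (int (R + i)) (track M 2 v (int (R + i)))"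
      by blast+
  qed
  have "foldl \<delta> q0 (take i u) = track M 3 v (int (R + i))" if "i \<le> n" for i
    using that
  proof (induction i)
    case 0
    then show ?case using v(2) by (simp add: run_at_def)
  next
    case (Suc i)
    then show ?case using step(2)[of i] by (simp add: u_def take_Suc_conv_app_nth)
  qed
  from this[of n] have "foldl \<delta> q0 u \<in> Acc" using v(2) by (simp add: u_def run_at_def)
  then have "u \<in> language" using step(1) by (auto simp: language_def u_def)
  moreover have "track M 0 v \<in> configs (states F)" "track M 1 v \<in> configs (symbols F)"
    using track_configs[OF v(1), of 0] track_configs[OF v(1), of 1]
    by (simp_all add: run_alphabets_simps del: One_nat_def)
  moreover have "\<forall>i<length u. output_ok e F (track M 0 v) (track M 1 v) (int R + int i) (u ! i)"
    using step(3) by (simp add: u_def)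
  ultimately show "produces e F language"
    unfolding produces_iff_shifted[of e F _ "int R"] by blast
qed

definition letters_of_run :: "nat \<Rightarrow> nat \<Rightarrow> nat set" where
  "letters_of_run x = run_alphabets (states_of x) (symbols_of x) S"

lemma letters_of_run_code_sca:
  "wf_sca F \<Longrightarrow> letters_of_run (code_sca F) = run_alphabets (states F) (symbols F) S"
  by (simp add: letters_of_run_def states_of_code_sca symbols_of_code_sca)

lemma rec_letters_of_run:
  "general_recursive n x \<Longrightarrow> general_recursive n j \<Longrightarrow> general_recursive n a \<Longrightarrow>
    rec_pred n (\<lambda>xs. a xs \<in> letters_of_run (x xs) (j xs))"
  unfolding letters_of_run_def run_alphabets_def
  by (intro rec_mem_if rec_states_of rec_symbols_of rec_intros rec_pred_finite finite(2))

definition run_word :: "bool \<Rightarrow> nat \<Rightarrow> nat \<Rightarrow> nat \<Rightarrow> nat \<Rightarrow> nat \<Rightarrow> bool" where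
  "run_word e x L M n w \<longleftrightarrow> digit M (digit L w x) 3 = q0 \<and> digit M (digit L w (x + n)) 3 \<in> Acc \<and>
     (\<forall>i<n. ((e \<longrightarrow> rule_forces x L M w 0 (x + i) (digit M (digit L w (x + i)) 2)) \<and>
         (\<not> e \<longrightarrow> rule_holds x L M w 0 1 (x + i) (digit M (digit L w (x + i)) 2))) \<and>
       prod_encode (prod_encode (digit M (digit L w (x + i)) 3, digit M (digit L w (x + i)) 2),
         digit M (digit L w (x + i + 1)) 3) \<in> transitions)"

lemma rec_run_word:
  assumes "general_recursive n x" "general_recursive n L" "general_recursive n M"
    "general_recursive n k" "general_recursive n w"
  shows "rec_pred n (\<lambda>xs. run_word e (x xs) (L xs) (M xs) (k xs) (w xs))"
  unfolding run_word_def
  by (intro rec_intros rec_rule_holds rec_rule_forces rec_digit rec_prod_encode rec_pred_finite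
      finite_transitions finite_subset[OF Acc finite(2)] assms assms[THEN rec_tl])

lemma run_word_iff:
  assumes wf: "wf_sca F" and x: "x = code_sca F"
    and w: "\<forall>i<n + 2 * x. digit L w i \<in> letters M 4 (run_alphabets (states F) (symbols F) S)"
  shows "run_word e x L M n w \<longleftrightarrow> run_at e F transitions q0 Acc M x n (decode L w)"
proof -
  have A: "((e \<longrightarrow> rule_forces x L M w 0 (x + i) q) \<and> (\<not> e \<longrightarrow> rule_holds x L M w 0 1 (x + i) q)) \<longleftrightarrow>
      output_ok e F (track M 0 (decode L w)) (track M 1 (decode L w)) (int (x + i)) q"
    if i: "i < n" for i q
  proof -
    have w': "digit L w k \<in> letters M 4 (run_alphabets (states F) (symbols F) S)"
      if "k \<in> {x + i - code_sca F..x + i + code_sca F}" for k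
      using w that i x by auto
    have "rule_holds x L M w 0 1 (x + i) q \<longleftrightarrow>
        global F (track M 0 (decode L w)) (track M 1 (decode L w)) (int (x + i)) = q"
      unfolding x using w' x
      by (intro rule_holds_letters_iff[OF wf, where m = 4 and
            D = "run_alphabets (states F) (symbols F) S"]) (auto simp: run_alphabets_simps)
    moreover have "rule_forces x L M w 0 (x + i) q \<longleftrightarrow>
        determines F (track M 0 (decode L w)) (int (x + i)) q"
      unfolding determines_def
    proof (rule rule_forces_iff[OF wf x])
      fix v assume "v \<in> set (nbhd F)"
      then have "track M 0 (decode L w) (int (x + i) + v) \<in> run_alphabets (states F) (symbols F) S 0"
        using x w' by (intro track_decode_in[of "code_sca F" _ _ _ 4] code_sca_bounds(3)[OF wf]) auto
      then show "track M 0 (decode L w) (int (x + i) + v) \<in> states F"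
        by (simp add: run_alphabets_simps)
    qed simp
    ultimately show ?thesis by (simp add: output_ok_def)
  qed
  have B: "int (x + i) + 1 = int (x + i + 1)" for i by simp
  show ?thesis
    unfolding run_word_def run_at_def run_step_def B track_digit
    by (intro conj_cong all_cong1 imp_cong refl A)
qed

definition run_exists :: "bool \<Rightarrow> nat \<Rightarrow> bool" where
  "run_exists e x \<longleftrightarrow> (\<exists>n<search_bound ((state_bound + x) ^ 4) 1 x.
     \<exists>w<((state_bound + x) ^ 4) ^ (n + 2 * x).
       (\<forall>i<n + 2 * x. digit ((state_bound + x) ^ 4) w i \<in> letters (state_bound + x) 4 (letters_of_run x)) \<and>
       run_word e x ((state_bound + x) ^ 4) (state_bound + x) n w)"

lemma rec_run_exists: "rec_pred (Suc 0) (\<lambda>xs. run_exists e (hd xs))"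
  unfolding run_exists_def
  by (intro rec_intros rec_search_bound rec_letters[where D = letters_of_run] rec_letters_of_run
      rec_run_word rec_digit)

lemma run_exists_iff:
  assumes wf: "wf_sca F"
  shows "run_exists e (code_sca F) \<longleftrightarrow> produces e F language"
proof -
  define x where "x = code_sca F"
  let ?M = "state_bound + x"
  have x: "code_sca F \<le> x" "0 < x" using code_sca_bounds(6)[OF wf] by (simp_all add: x_def)
  have M: "states F \<subseteq> {..<?M}" "symbols F \<subseteq> {..<?M}" "S \<subseteq> {..<?M}"
    using code_alphabets[OF wf x(1)] states_less_bound by (auto simp: state_bound_def)
  let ?A = "letters ?M 4 (run_alphabets (states F) (symbols F) S)"
  have loc: "run_at e F transitions q0 Acc ?M x n v = run_at e F transitions q0 Acc ?M x n v'"
    if eq: "\<And>z. 0 \<le> z \<Longrightarrow> z < int (n + 2 * x) \<Longrightarrow> v z = v' z" for n v v'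
  proof -
    have ag: "agree {- int x..int x} v (int (x + i)) v' (int (x + i))" if "i < n" for i
      using that by (auto simp: agree_def intro!: eq)
    have "run_step e F transitions ?M v (int (x + i)) = run_step e F transitions ?M v' (int (x + i))"
      if "i < n" for i
      by (rule local_onD[OF local_run_step[OF wf x(1)] ag[OF that]])
    moreover have "v (int x) = v' (int x)" "v (int (x + n)) = v' (int (x + n))"
      using eq x(2) by auto
    ultimately show ?thesis unfolding run_at_def track_def by simp
  qed
  have "produces e F language \<longleftrightarrow> (\<exists>n. \<exists>v\<in>configs ?A. run_at e F transitions q0 Acc ?M x n v)"
    by (rule produces_iff_run[OF wf M])
  also have "\<dots> \<longleftrightarrow> (\<exists>n<search_bound (?M ^ 4) 1 x. \<exists>v\<in>configs ?A. run_at e F transitions q0 Acc ?M x n v)"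
    using run_at_bounded[OF wf x(1) order_refl] by blast
  also have "\<dots> \<longleftrightarrow> run_exists e x"
    unfolding run_exists_def letters_of_run_code_sca[OF wf, folded x_def]
    using x(2) by (intro words_exist_iff letters_subset run_word_iff[OF wf x_def] loc) auto
  finally show ?thesis by (simp add: x_def)
qed

lemma decidable_meets_cylinder:
  "decidable code_sca SCA (\<lambda>F. \<exists>u\<in>language. \<exists>c\<in>configs (states F).
     nondet F c \<inter> cylinder (states F) u \<noteq> {})"
proof (rule decidableI)
  show "rec_pred (Suc 0) (\<lambda>xs. run_exists False (hd xs))"
    by (rule rec_run_exists)
qed (simp only: SCA_def mem_Collect_eq run_exists_iff meets_cylinder_iff_produces)

lemma decidable_inside_cylinder:
  "decidable code_sca SCA (\<lambda>F. \<exists>u\<in>language. \<exists>c\<in>configs (states F).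
     nondet F c \<subseteq> cylinder (states F) u)"
proof (rule decidableI)
  \<comment> \<open>Emptiness of the language is a fixed truth value independent of the instance, so
    it enters as a constant predicate. Emptiness of the alphabets is tested up to the code, which
    bounds their letters.\<close>
  show "rec_pred (Suc 0) (\<lambda>xs. run_exists True (hd xs) \<or>
      (\<not> (\<exists>a<Suc (hd xs). a \<in> symbols_of (hd xs)) \<and> (\<exists>a<Suc (hd xs). a \<in> states_of (hd xs)) \<and>
       language \<noteq> {}))"
    by (intro rec_run_exists rec_states_of rec_symbols_of rec_intros)
  fix F
  assume "F \<in> SCA"
  then have wf: "wf_sca F" by (simp add: SCA_def)
  have "(\<exists>a<Suc (code_sca F). a \<in> symbols F) \<longleftrightarrow> symbols F \<noteq> {}"
    "(\<exists>a<Suc (code_sca F). a \<in> states F) \<longleftrightarrow> states F \<noteq> {}"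
    using code_alphabets[OF wf order_refl] by auto
  then show "(run_exists True (code_sca F) \<or>
      (\<not> (\<exists>a<Suc (code_sca F). a \<in> symbols_of (code_sca F)) \<and>
       (\<exists>a<Suc (code_sca F). a \<in> states_of (code_sca F)) \<and> language \<noteq> {})) \<longleftrightarrow>
      (\<exists>u\<in>language. \<exists>c\<in>configs (states F). nondet F c \<subseteq> cylinder (states F) u)"
    unfolding inside_cylinder_iff_produces[OF wf] run_exists_iff[OF wf] states_of_code_sca[OF wf]
      symbols_of_code_sca[OF wf] by simp
qed

end

lemma rational_imp_dfa:
  assumes "rational L"
  obtains \<Sigma> S q0 \<delta> Acc where "dfa \<Sigma> S q0 \<delta> Acc" "L = dfa.language \<Sigma> q0 \<delta> Acc"
  using assms unfolding rational_def
proof (elim exE conjE)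
  fix A S Acc :: "nat set" and q0 \<delta>
  assume *: "finite A" "finite S" "q0 \<in> S" "Acc \<subseteq> S" "\<forall>q\<in>S. \<forall>a\<in>A. \<delta> q a \<in> S"
    and L: "L = {w \<in> lists A. foldl \<delta> q0 w \<in> Acc}"
  then have dfa: "dfa A S q0 \<delta> Acc" by unfold_locales auto
  show thesis by (rule that[OF dfa]) (simp only: L dfa.language_def[OF dfa])
qed

theorem corollary6p8:
  "decidable code_sca SCA noisy \<and>
   decidable code_sca SCA sca_surjective \<and>
   decidable code_sca SCA sca_injective \<and>
   decidable code_sca SCA sca_pre_injective \<and>
   (\<forall>t > 0. decidable code_sca_pair (SCA \<times> SCA) (\<lambda>(F, G). same_iterate t F G)) \<and>
   (\<forall>L. rational L \<longrightarrow>
      decidable code_sca SCA (\<lambda>F. \<exists>u \<in> L. \<exists>c \<in> configs (states F).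
        nondet F c \<subseteq> cylinder (states F) u)) \<and>
   (\<forall>L. rational L \<longrightarrow>
      decidable code_sca SCA (\<lambda>F. \<exists>u \<in> L. \<exists>c \<in> configs (states F).
        nondet F c \<inter> cylinder (states F) u \<noteq> {}))"
proof (intro conjI allI impI)
  show "decidable code_sca SCA noisy"
    using decidable_reaches_all[of True]
    by (rule decidable_cong) (simp add: SCA_def noisy_iff_reaches_all)
  show "decidable code_sca SCA sca_surjective"
    using decidable_reaches_all[of False] by (rule decidable_cong) (rule sca_surjective_iff_reaches_all)
  show "decidable code_sca SCA sca_injective"
    using decidable_collision[of False] by (rule decidable_cong) (rule sca_injective_iff_collision)
  show "decidable code_sca SCA sca_pre_injective"
    using decidable_collision[of True] by (rule decidable_cong) (rule sca_pre_injective_iff_collision)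
  show "decidable code_sca_pair (SCA \<times> SCA) (\<lambda>(F, G). same_iterate t F G)" if "0 < t" for t
    using that by (rule decidable_same_iterate)
  fix L :: "nat list set"
  assume "rational L"
  then obtain \<Sigma> S q0 \<delta> Acc where "dfa \<Sigma> S q0 \<delta> Acc" and L: "L = dfa.language \<Sigma> q0 \<delta> Acc"
    by (rule rational_imp_dfa)
  then interpret dfa \<Sigma> S q0 \<delta> Acc by simp
  show "decidable code_sca SCA (\<lambda>F. \<exists>u\<in>L. \<exists>c\<in>configs (states F).
      nondet F c \<subseteq> cylinder (states F) u)"
    unfolding L by (rule decidable_inside_cylinder)
  show "decidable code_sca SCA (\<lambda>F. \<exists>u\<in>L. \<exists>c\<in>configs (states F).
      nondet F c \<inter> cylinder (states F) u \<noteq> {})"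
    unfolding L by (rule decidable_meets_cylinder)
qed

end
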